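(* There exist a finite alphabet $A$ and a continuous roof function $\rho:\Sigma\to(0,\infty)$ on the full shift $(\Sigma,\sigma)$, $\Sigma=A^{\mathbb{Z}}$, such that the suspension flow $(\Sigma_\rho,\Phi)$ over $(\Sigma,\sigma)$ with roof function $\rho$ has two distinct ergodic measures of maximal entropy with the same support.
   Context: For a finite set $A$ (with the discrete topology), the full shift on $A$ is $\Sigma=A^{\mathbb{Z}}$ with the product topology and the left shift homeomorphism $\sigma$, $(\sigma x)_i=x_{i+1}$. Suspension flow: for a continuous $\rho:\Sigma\to(0,\infty)$, $\Sigma_\rho$ is the quotient of $\{(x,s):x\in\Sigma,\ 0\le s\le\rho(x)\}$ by the equivalence relation generated by $(x,\rho(x))\sim(\sigma(x),0)$. The flow $\Phi=(\varphi_t)_{t\in\mathbb{R}}$ on $\Sigma_\rho$ is the one given locally by $\varphi_t(x,s)=(x,s+t)$, i.e. $\varphi_t(x,s)=\bigl(\sigma^n(x),\,t+s-\sum_{k=0}^{n-1}\rho(\sigma^k(x))\bigr)$, where $0\le s<\rho(x)$ and $n\in\mathbb{Z}$ is the unique integer with $\sum_{k=0}^{n-1}\rho(\sigma^k(x))\le t+s<\sum_{k=0}^{n}\rho(\sigma^k(x))$ (with the convention $\sum_{k=0}^{n-1}a_k=-\sum_{k=n}^{-1}a_k$ for $n<0$). The entropy of a $\Phi$-invariant Borel probability measure is the entropy of the time-one map $\varphi_1$ with respect to that measure. A measure of maximal entropy for $(\Sigma_\rho,\Phi)$ is a $\Phi$-invariant Borel probability measure whose entropy equals the supremum of the entropies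 of all $\Phi$-invariant Borel probability measures. Ergodic means ergodic with respect to the flow $\Phi$. *)

theory Defs
  imports "HOL-Probability.Probability" "HOL-Library.Disjoint_Sets"
begin

section \<open>Topological preliminaries\<close>

definition quotient_topology :: "'a topology \<Rightarrow> ('a \<Rightarrow> 'b) \<Rightarrow> 'b topology" where
  "quotient_topology T f =
     topology (\<lambda>U. U \<subseteq> f ` topspace T \<and> openin T {x \<in> topspace T. f x \<in> U})"

lemma openin_quotient_topology:
  "openin (quotient_topology T f) U \<longleftrightarrow>
     U \<subseteq> f ` topspace T \<and> openin T {x \<in> topspace T. f x \<in> U}"
proof -
  have "istopology (\<lambda>U. U \<subseteq> f ` topspace T \<and> openin T {x \<in> topspace T. f x \<in> U})"
    unfolding istopology_def
  proof (intro conjI allI impI)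
    fix U V
    assume "U \<subseteq> f ` topspace T \<and> openin T {x \<in> topspace T. f x \<in> U}"
      and "V \<subseteq> f ` topspace T \<and> openin T {x \<in> topspace T. f x \<in> V}"
    moreover have "{x \<in> topspace T. f x \<in> U \<inter> V} =
        {x \<in> topspace T. f x \<in> U} \<inter> {x \<in> topspace T. f x \<in> V}" by auto
    ultimately show "openin T {x \<in> topspace T. f x \<in> U \<inter> V}"
      by (simp only: openin_Int)
  next
    fix \<K>
    assume "\<forall>K\<in>\<K>. K \<subseteq> f ` topspace T \<and> openin T {x \<in> topspace T. f x \<in> K}"
    moreover have "{x \<in> topspace T. f x \<in> \<Union>\<K>} = (\<Union>K\<in>\<K>. {x \<in> topspace T. f x \<in> K})" by auto
    ultimately show "openin T {x \<in> topspace T. f x \<in> \<Union>\<K>}"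
      by (simp only:) blast
  qed blast+
  then show ?thesis
    by (simp add: quotient_topology_def)
qed

lemma topspace_quotient_topology: "topspace (quotient_topology T f) = f ` topspace T"
proof
  have "{x \<in> topspace T. f x \<in> f ` topspace T} = topspace T" by auto
  then have "openin (quotient_topology T f) (f ` topspace T)"
    by (simp add: openin_quotient_topology)
  then show "f ` topspace T \<subseteq> topspace (quotient_topology T f)"
    by (rule openin_subset)
  show "topspace (quotient_topology T f) \<subseteq> f ` topspace T"
    using openin_topspace[of "quotient_topology T f"] by (simp only: openin_quotient_topology)
qed

lemma quotient_map_quotient_topology: "quotient_map T (quotient_topology T f) f"
  by (auto simp: quotient_map_def topspace_quotient_topology openin_quotient_topology)

definition borel_of :: "'a topology \<Rightarrow> 'a measure" where
  "borel_of T = sigma (topspace T) {U. openin T U}"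

definition measure_support :: "'a topology \<Rightarrow> 'a measure \<Rightarrow> 'a set" where
  "measure_support T M =
     {p \<in> topspace T. \<forall>U. openin T U \<longrightarrow> p \<in> U \<longrightarrow> emeasure M U > 0}"


section \<open>Kolmogorov--Sinai entropy\<close>

text \<open>Partitions are finite and measurable; entropies use the natural logarithm.\<close>

definition partition_entropy :: "'a measure \<Rightarrow> 'a set set \<Rightarrow> real" where
  "partition_entropy M P = - (\<Sum>B\<in>P. measure M B * ln (measure M B))"

definition pullback_partition :: "'a measure \<Rightarrow> ('a \<Rightarrow> 'a) \<Rightarrow> 'a set set \<Rightarrow> 'a set set" where
  "pullback_partition M f P = (\<lambda>B. f -` B \<inter> space M) ` P - {{}}"

definition iterated_partition ::
  "'a measure \<Rightarrow> ('a \<Rightarrow> 'a) \<Rightarrow> 'a set set \<Rightarrow> nat \<Rightarrow> 'a set set" where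
  "iterated_partition M f P n =
     common_refinement ((\<lambda>k. pullback_partition M (f ^^ k) P) ` {..<n})"

text \<open>For measure preserving \<open>f\<close> the limit below exists by subadditivity.\<close>

definition entropy_wrt_partition :: "'a measure \<Rightarrow> ('a \<Rightarrow> 'a) \<Rightarrow> 'a set set \<Rightarrow> real" where
  "entropy_wrt_partition M f P =
     lim (\<lambda>n. partition_entropy M (iterated_partition M f P n) / real n)"

definition ks_entropy :: "'a measure \<Rightarrow> ('a \<Rightarrow> 'a) \<Rightarrow> ereal" where
  "ks_entropy M f =
     (SUP P \<in> {P. finite P \<and> P \<subseteq> sets M \<and> partition_on (space M) P}.
        ereal (entropy_wrt_partition M f P))"


section \<open>Invariant measures of a flow\<close>

definition measure_preserving_map :: "'a measure \<Rightarrow> ('a \<Rightarrow> 'a) \<Rightarrow> bool" where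
  "measure_preserving_map M f \<longleftrightarrow> f \<in> measurable M M \<and> distr M M f = M"

definition flow_invariant_measure ::
  "'a topology \<Rightarrow> (real \<Rightarrow> 'a \<Rightarrow> 'a) \<Rightarrow> 'a measure \<Rightarrow> bool" where
  "flow_invariant_measure T \<phi> M \<longleftrightarrow>
     prob_space M \<and> space M = topspace T \<and> sets M = sets (borel_of T) \<and>
     (\<forall>t. measure_preserving_map M (\<phi> t))"

definition flow_ergodic :: "(real \<Rightarrow> 'a \<Rightarrow> 'a) \<Rightarrow> 'a measure \<Rightarrow> bool" where
  "flow_ergodic \<phi> M \<longleftrightarrow>
     (\<forall>B\<in>sets M. (\<forall>t. \<phi> t -` B \<inter> space M = B) \<longrightarrow> measure M B = 0 \<or> measure M B = 1)"

definition flow_entropy :: "(real \<Rightarrow> 'a \<Rightarrow> 'a) \<Rightarrow> 'a measure \<Rightarrow> ereal" where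
  "flow_entropy \<phi> M = ks_entropy M (\<phi> 1)"

definition measure_of_maximal_entropy ::
  "'a topology \<Rightarrow> (real \<Rightarrow> 'a \<Rightarrow> 'a) \<Rightarrow> 'a measure \<Rightarrow> bool" where
  "measure_of_maximal_entropy T \<phi> M \<longleftrightarrow>
     flow_invariant_measure T \<phi> M \<and>
     flow_entropy \<phi> M = (SUP N \<in> {N. flow_invariant_measure T \<phi> N}. flow_entropy \<phi> N)"


section \<open>The full shift\<close>

definition full_shift :: "'a set \<Rightarrow> (int \<Rightarrow> 'a) topology" where
  "full_shift A = product_topology (\<lambda>_. discrete_topology A) UNIV"

definition left_shift :: "(int \<Rightarrow> 'a) \<Rightarrow> int \<Rightarrow> 'a" where
  "left_shift x = (\<lambda>i. x (i + 1))"

text \<open>The integer iterates of \<^const>\<open>left_shift\<close>; see the lemmas that follow.\<close>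

definition shift_iter :: "int \<Rightarrow> (int \<Rightarrow> 'a) \<Rightarrow> int \<Rightarrow> 'a" where
  "shift_iter n x = (\<lambda>i. x (i + n))"

lemma topspace_full_shift: "topspace (full_shift A) = {x. \<forall>i. x i \<in> A}"
  by (auto simp: full_shift_def PiE_def)

lemma shift_iter_0: "shift_iter 0 x = x"
  by (simp add: shift_iter_def)

lemma shift_iter_1: "shift_iter 1 x = left_shift x"
  by (simp add: shift_iter_def left_shift_def)

lemma shift_iter_add: "shift_iter (m + n) x = shift_iter m (shift_iter n x)"
  by (simp add: shift_iter_def algebra_simps)

lemma shift_iter_of_nat: "shift_iter (int n) = left_shift ^^ n"
proof (induction n)
  case 0
  show ?case by (simp add: fun_eq_iff shift_iter_0)
next
  case (Suc n)
  show ?case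
  proof
    fix x :: "int \<Rightarrow> 'a"
    have "shift_iter (int (Suc n)) x = left_shift (shift_iter (int n) x)"
      using shift_iter_add[of 1 "int n" x] by (simp add: shift_iter_1)
    then show "shift_iter (int (Suc n)) x = (left_shift ^^ Suc n) x"
      using Suc by simp
  qed
qed

lemma shift_iter_in_full_shift:
  "x \<in> topspace (full_shift A) \<Longrightarrow> shift_iter n x \<in> topspace (full_shift A)"
  by (simp add: topspace_full_shift shift_iter_def)


section \<open>The suspension flow\<close>

definition birkhoff_sum :: "((int \<Rightarrow> 'a) \<Rightarrow> real) \<Rightarrow> int \<Rightarrow> (int \<Rightarrow> 'a) \<Rightarrow> real" where
  "birkhoff_sum \<rho> n x =
     (if n \<ge> 0 then \<Sum>k\<in>{0..<n}. \<rho> (shift_iter k x)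
      else - (\<Sum>k\<in>{n..<0}. \<rho> (shift_iter k x)))"

definition roof_region ::
  "'a set \<Rightarrow> ((int \<Rightarrow> 'a) \<Rightarrow> real) \<Rightarrow> ((int \<Rightarrow> 'a) \<times> real) set" where
  "roof_region A \<rho> = {(x, s). x \<in> topspace (full_shift A) \<and> 0 \<le> s \<and> s \<le> \<rho> x}"

definition roof_topology ::
  "'a set \<Rightarrow> ((int \<Rightarrow> 'a) \<Rightarrow> real) \<Rightarrow> ((int \<Rightarrow> 'a) \<times> real) topology" where
  "roof_topology A \<rho> =
     subtopology (prod_topology (full_shift A) euclideanreal) (roof_region A \<rho>)"

definition roof_glue ::
  "'a set \<Rightarrow> ((int \<Rightarrow> 'a) \<Rightarrow> real) \<Rightarrow> (int \<Rightarrow> 'a) \<times> real \<Rightarrow> (int \<Rightarrow> 'a) \<times> real \<Rightarrow> bool" where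
  "roof_glue A \<rho> p q \<longleftrightarrow> (\<exists>x\<in>topspace (full_shift A). p = (x, \<rho> x) \<and> q = (left_shift x, 0))"

definition susp_class ::
  "'a set \<Rightarrow> ((int \<Rightarrow> 'a) \<Rightarrow> real) \<Rightarrow> (int \<Rightarrow> 'a) \<times> real \<Rightarrow> ((int \<Rightarrow> 'a) \<times> real) set" where
  "susp_class A \<rho> p = {q \<in> roof_region A \<rho>. equivclp (roof_glue A \<rho>) p q}"

definition suspension ::
  "'a set \<Rightarrow> ((int \<Rightarrow> 'a) \<Rightarrow> real) \<Rightarrow> ((int \<Rightarrow> 'a) \<times> real) set topology" where
  "suspension A \<rho> = quotient_topology (roof_topology A \<rho>) (susp_class A \<rho>)"

text \<open>The description below is the defining formula of the flow read as a relation between a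
  point \<open>c\<close> and its image \<open>d\<close>; \<open>susp_flow_eq\<close> recovers the formula.\<close>

definition susp_flow ::
  "'a set \<Rightarrow> ((int \<Rightarrow> 'a) \<Rightarrow> real) \<Rightarrow> real \<Rightarrow>
     ((int \<Rightarrow> 'a) \<times> real) set \<Rightarrow> ((int \<Rightarrow> 'a) \<times> real) set" where
  "susp_flow A \<rho> t c =
     (THE d. \<exists>x s n. x \<in> topspace (full_shift A) \<and> 0 \<le> s \<and> s < \<rho> x \<and> c = susp_class A \<rho> (x, s) \<and>
        birkhoff_sum \<rho> n x \<le> t + s \<and> t + s < birkhoff_sum \<rho> (n + 1) x \<and>
        d = susp_class A \<rho> (shift_iter n x, t + s - birkhoff_sum \<rho> n x))"

lemma topspace_suspension:
  "topspace (suspension A \<rho>) = susp_class A \<rho> ` roof_region A \<rho>"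
  by (auto simp: suspension_def topspace_quotient_topology roof_topology_def roof_region_def)

lemma birkhoff_sum_add_one:
  "birkhoff_sum \<rho> (n + 1) x = birkhoff_sum \<rho> n x + \<rho> (shift_iter n x)"
proof (cases "n \<ge> 0")
  case True
  then have "{0..<n + 1} = insert n {0..<n}" by auto
  with True show ?thesis by (simp add: birkhoff_sum_def)
next
  case False
  then have "{n..<0} = insert n {n + 1..<0}" by auto
  with False show ?thesis by (cases "n = -1") (auto simp: birkhoff_sum_def)
qed

lemma birkhoff_sum_mono:
  assumes "\<And>y. y \<in> topspace (full_shift A) \<Longrightarrow> \<rho> y > 0" "x \<in> topspace (full_shift A)" "m \<le> n"
  shows "birkhoff_sum \<rho> m x \<le> birkhoff_sum \<rho> n x"
  using \<open>m \<le> n\<close>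
proof (induction n rule: int_ge_induct)
  case (step i)
  moreover have "\<rho> (shift_iter i x) > 0"
    using assms shift_iter_in_full_shift by blast
  ultimately show ?case by (simp add: birkhoff_sum_add_one)
qed simp

lemma susp_class_inj:
  assumes pos: "\<And>y. y \<in> topspace (full_shift A) \<Longrightarrow> \<rho> y > 0"
    and x: "x \<in> topspace (full_shift A)" "0 \<le> s" "s < \<rho> x"
    and y: "y \<in> topspace (full_shift A)" "0 \<le> r" "r < \<rho> y"
    and eq: "susp_class A \<rho> (x, s) = susp_class A \<rho> (y, r)"
  shows "x = y \<and> s = r"
proof -
  define c where "c = (\<lambda>(z, u). if u = \<rho> z then (left_shift z, 0) else (z, u))"
  have "equivclp (roof_glue A \<rho>) (x, s) (y, r)"
    using eq y by (auto simp: susp_class_def roof_region_def)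
  then have "c (x, s) = c (y, r)"
  proof (induction rule: equivclp_induct)
    case (step p q)
    have *: "c (z, \<rho> z) = c (left_shift z, 0)" if "z \<in> topspace (full_shift A)" for z
      using pos[OF shift_iter_in_full_shift[OF that, of 1]] by (simp add: c_def shift_iter_1)
    have "c p = c q"
      using step(2) * by (auto simp: roof_glue_def)
    with step show ?case by simp
  qed simp
  with x y show ?thesis by (simp add: c_def)
qed

lemma susp_flow_eq:
  assumes pos: "\<And>y. y \<in> topspace (full_shift A) \<Longrightarrow> \<rho> y > 0"
    and x: "x \<in> topspace (full_shift A)" "0 \<le> s" "s < \<rho> x"
    and n: "birkhoff_sum \<rho> n x \<le> t + s" "t + s < birkhoff_sum \<rho> (n + 1) x"
  shows "susp_flow A \<rho> t (susp_class A \<rho> (x, s)) =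
           susp_class A \<rho> (shift_iter n x, t + s - birkhoff_sum \<rho> n x)"
  unfolding susp_flow_def
proof (rule the_equality)
  fix d
  assume "\<exists>y r m. y \<in> topspace (full_shift A) \<and> 0 \<le> r \<and> r < \<rho> y \<and>
        susp_class A \<rho> (x, s) = susp_class A \<rho> (y, r) \<and>
        birkhoff_sum \<rho> m y \<le> t + r \<and> t + r < birkhoff_sum \<rho> (m + 1) y \<and>
        d = susp_class A \<rho> (shift_iter m y, t + r - birkhoff_sum \<rho> m y)"
  then obtain y r m where y: "y \<in> topspace (full_shift A)" "0 \<le> r" "r < \<rho> y"
    "susp_class A \<rho> (x, s) = susp_class A \<rho> (y, r)"
    and m: "birkhoff_sum \<rho> m y \<le> t + r" "t + r < birkhoff_sum \<rho> (m + 1) y"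
    and d: "d = susp_class A \<rho> (shift_iter m y, t + r - birkhoff_sum \<rho> m y)" by blast
  have xy: "x = y" "s = r" using susp_class_inj[OF pos x y] by auto
  have "m = n"
  proof (rule ccontr)
    assume "m \<noteq> n"
    then consider "m + 1 \<le> n" | "n + 1 \<le> m" by linarith
    then show False
      using birkhoff_sum_mono[of A \<rho> x "m + 1" n] birkhoff_sum_mono[of A \<rho> x "n + 1" m] pos x m n xy
      by cases force+
  qed
  with d xy show "d = susp_class A \<rho> (shift_iter n x, t + s - birkhoff_sum \<rho> n x)" by simp
qed (use x n in blast)

end

(* Take the Dyck shift X inside the full shift on four letters (two kinds of brackets) and the roof
   1 + excess, where excess vanishes exactly on X and, off X, decays slowly in the size of the
   smallest central window containing an illegally matched pair.

   Upper bound. There are at most (n + 1) 3^n legal words of length n. A word that is not legal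
   splits greedily into legal blocks of length L - 1 followed by one letter, and each block costs at
   least L * pen L extra flow time; since 3^(L * pen L) beats L^3, the number of words traversed in
   time n is still 3^n up to a polynomial factor. Over a time n the part of the flow time that a
   finite window does not see drifts monotonically and slowly, so it multiplies the number of orbit
   names by exp (e n) only. Hence every invariant measure has entropy at most ln 3.

   Two measures attain ln 3. In an i.i.d. uniform sequence over two opening brackets and one
   anonymous closing bracket, let every closing bracket take the kind of its partner; the image in X
   is a factor of a Bernoulli shift, hence ergodic, and reading it backwards gives the second one.
   They charge opening brackets with probability 2/3 and 1/3, and both have support X. *)
theory Submission
  imports Defs
begin

subsection \<open>Entropy\<close>

text \<open>The roof is under two opposing demands. Continuity forces the penalty of a large illegal
  window to tend to 0, yet a first illegal prefix of length L has about L 3^L candidates, and its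
  penalty must pay for the factor L and for summation over L. So L * pen L has to grow at least like
  log L; a decay no faster than 1 / sqrt L leaves ample room. The second obstacle is that flow
  heights are real numbers depending on the whole sequence, so finitely many letters never determine
  them exactly. This is why penalties are 24 divided by factorials: the values seen in the window
  \<open>win k\<close> are multiples of 1 / k!, and what is not seen adds at most 24 / (k + 1)! per
  return, a fraction 24 / (k + 1) of one grid cell. An arbitrary finite partition is reached from
  the resulting labels by approximation, whose error is paid for through Gibbs' inequality. Over X
  the roof is 1, so both maximal measures are images of Lebesgue measure on the circle times a
  Bernoulli measure, and questions about the flow become questions about the shift.\<close>

text \<open>Fekete's lemma; the limit is the infimum of the quotients.\<close>

lemma convergent_subadditive:
  fixes u :: "nat \<Rightarrow> real"
  assumes sub: "\<And>m n. 0 < m \<Longrightarrow> 0 < n \<Longrightarrow> u (m + n) \<le> u m + u n"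
    and nonneg: "\<And>n. 0 \<le> u n"
  shows "convergent (\<lambda>n. u n / real n)"
proof -
  define L where "L = (INF n\<in>{1..}. u n / real n)"
  have bdd: "bdd_below ((\<lambda>n. u n / real n) ` {1..})"
    by (rule bdd_belowI[of _ 0]) (auto simp: nonneg)
  have L: "L \<le> u n / real n" if "0 < n" for n
    unfolding L_def using that by (intro cINF_lower bdd) auto
  have mult: "u (q * p + r) \<le> real q * u p + u r" if "0 < p" "0 < r" for p q r
  proof (induction q)
    case (Suc q)
    have "u (Suc q * p + r) = u (p + (q * p + r))" by (simp add: algebra_simps)
    also have "\<dots> \<le> u p + u (q * p + r)" using that by (intro sub) auto
    finally show ?case using Suc by (simp add: algebra_simps)
  qed simp
  have "(\<lambda>n. u n / real n) \<longlonglongrightarrow> L"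
  proof (rule LIMSEQ_I)
    fix e :: real assume e: "0 < e"
    have "\<exists>p\<in>{1..}. u p / real p < L + e/2"
      unfolding L_def using e by (intro cINF_less_iff[THEN iffD1] bdd) (auto simp: L_def)
    then obtain p where p: "0 < p" "u p / real p < L + e/2" by (auto simp: Suc_le_eq)
    define C where "C = (\<Sum>r\<in>{1..p}. u r)"
    have C: "u r \<le> C" if "r \<in> {1..p}" for r
      unfolding C_def using that by (intro member_le_sum) (auto simp: nonneg)
    have C0: "0 \<le> C" unfolding C_def by (intro sum_nonneg) (auto simp: nonneg)
    obtain N where N: "real N > 2 * C / e" using reals_Archimedean2 by blast
    have "norm (u n / real n - L) < e" if n: "n \<ge> max N 1" for n
    proof -
      have n0: "0 < n" using n by auto
      \<comment> \<open>The remainder is taken in 1..p instead of 0..p - 1, because subadditivity is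
        assumed for positive arguments only.\<close>
      define q r where "q = (n - 1) div p" and "r = (n - 1) mod p + 1"
      have n_eq: "n = q * p + r" unfolding q_def r_def using n0 by (simp add: div_mult_mod_eq)
      have r: "r \<in> {1..p}" unfolding r_def using p mod_less_divisor[of p "n - 1"]
        by (simp del: mod_less_divisor add: Suc_le_eq)
      have "u n \<le> real q * u p + u r" unfolding n_eq by (rule mult) (use p r in auto)
      also have "\<dots> \<le> real q * u p + C" using C[OF r] by simp
      also have "real q * u p = (real q * real p) * (u p / real p)" using p by simp
      also have "\<dots> \<le> real n * (u p / real p)"
        using nonneg[of p] by (intro mult_right_mono) (simp_all add: n_eq)
      finally have "u n / real n \<le> u p / real p + C / real n"
        using n0 by (simp add: field_simps)
      moreover have "C / real n < e / 2"
      proof -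
        have "2 * C / e < real n" using N n by linarith
        then show ?thesis using n0 e by (simp add: field_simps)
      qed
      ultimately have "u n / real n < L + e" using p by linarith
      then show ?thesis using L[OF n0] by simp
    qed
    then show "\<exists>no. \<forall>n\<ge>no. norm (u n / real n - L) < e" by blast
  qed
  then show ?thesis by (rule convergentI)
qed

lemma measure_preserving_map_funpow:
  assumes "measure_preserving_map M f"
  shows "measure_preserving_map M (f ^^ n)"
proof (induction n)
  case 0
  show ?case by (simp add: measure_preserving_map_def id_def distr_id2)
next
  case (Suc n)
  then have "distr M M (f \<circ> (f ^^ n)) = M"
    using assms distr_distr[of f M M "f ^^ n" M] by (simp add: measure_preserving_map_def)
  moreover have "f \<circ> (f ^^ n) \<in> measurable M M"
    using Suc assms measurable_comp[of "f ^^ n" M M f M] by (simp add: measure_preserving_map_def)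
  ultimately show ?case unfolding measure_preserving_map_def funpow.simps by blast
qed

section \<open>Shannon entropy of finite-valued maps\<close>

definition fibre_prob :: "'a measure \<Rightarrow> ('a \<Rightarrow> 'b) \<Rightarrow> 'b \<Rightarrow> real" where
  "fibre_prob M g v = measure M (g -` {v} \<inter> space M)"

context prob_space
begin

lemma integral_finite_range:
  fixes h :: "'b \<Rightarrow> real"
  assumes g: "g \<in> measurable M (count_space UNIV)" and fin: "finite (g ` space M)"
  shows "integrable M (\<lambda>y. h (g y))"
    and "(\<integral>y. h (g y) \<partial>M) = (\<Sum>v\<in>g ` space M. fibre_prob M g v * h v)"
proof -
  have [measurable]: "g -` {v} \<inter> space M \<in> sets M" for v
    using g by (rule measurable_sets) simp
  let ?F = "\<lambda>y. \<Sum>v\<in>g ` space M. indicator (g -` {v} \<inter> space M) y * h v"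
  have eq: "h (g y) = ?F y" if "y \<in> space M" for y
  proof -
    have "?F y = (\<Sum>v\<in>g ` space M. if v = g y then h v else 0)"
      using that by (intro sum.cong) (auto simp: indicator_def)
    then show ?thesis using that fin by simp
  qed
  have int: "integrable M ?F"
    by (intro Bochner_Integration.integrable_sum integrable_mult_left)
      (auto simp: emeasure_eq_measure)
  show "integrable M (\<lambda>y. h (g y))"
    using int by (subst Bochner_Integration.integrable_cong[OF refl eq]) auto
  have "(\<integral>y. h (g y) \<partial>M) = (\<integral>y. ?F y \<partial>M)"
    by (intro Bochner_Integration.integral_cong refl eq)
  also have "\<dots> = (\<Sum>v\<in>g ` space M. (\<integral>y. indicator (g -` {v} \<inter> space M) y * h v \<partial>M))"
    by (intro Bochner_Integration.integral_sum integrable_mult_left) (auto simp: emeasure_eq_measure)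
  also have "\<dots> = (\<Sum>v\<in>g ` space M. fibre_prob M g v * h v)"
    by (intro sum.cong refl) (simp add: fibre_prob_def)
  finally show "(\<integral>y. h (g y) \<partial>M) = (\<Sum>v\<in>g ` space M. fibre_prob M g v * h v)" .
qed

lemma sum_fibre_prob:
  assumes "g \<in> measurable M (count_space UNIV)" "finite (g ` space M)"
  shows "(\<Sum>v\<in>g ` space M. fibre_prob M g v) = 1"
  using integral_finite_range(2)[OF assms, of "\<lambda>_. 1"] by (simp add: prob_space)

definition fibre_entropy :: "('a \<Rightarrow> 'b) \<Rightarrow> real" where
  "fibre_entropy g = - (\<Sum>v\<in>g ` space M. fibre_prob M g v * ln (fibre_prob M g v))"

text \<open>Nonnegativity of relative entropy: \<open>ln t \<le> t - 1\<close> at t = q / (Z p),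
  weighted with p and summed over the fibres. The weights \<open>q\<close> may be unnormalised; both
  entropy estimates below are choices of them.\<close>

lemma gibbs_inequality:
  assumes g: "g \<in> measurable M (count_space UNIV)" "finite (g ` space M)"
    and q: "\<And>v. v \<in> g ` space M \<Longrightarrow> 0 \<le> q v"
    and pos: "\<And>v. v \<in> g ` space M \<Longrightarrow> 0 < fibre_prob M g v \<Longrightarrow> 0 < q v"
    and Z: "(\<Sum>v\<in>g ` space M. q v) \<le> Z" "0 < Z"
  shows "fibre_entropy g \<le> ln Z - (\<integral>y. ln (q (g y)) \<partial>M)"
proof -
  let ?p = "fibre_prob M g"
  have "(\<Sum>v\<in>g ` space M. ?p v * ln (q v) - ?p v * ln Z - ?p v * ln (?p v))
      \<le> (\<Sum>v\<in>g ` space M. q v / Z - ?p v)"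
  proof (rule sum_mono)
    fix v assume v: "v \<in> g ` space M"
    show "?p v * ln (q v) - ?p v * ln Z - ?p v * ln (?p v) \<le> q v / Z - ?p v"
    proof (cases "?p v > 0")
      case True
      then have qv: "0 < q v" using pos v by blast
      have "?p v * ln (q v / (Z * ?p v)) \<le> ?p v * (q v / (Z * ?p v) - 1)"
        using True qv Z by (intro mult_left_mono ln_le_minus_one) auto
      moreover have "?p v * ln (q v / (Z * ?p v)) = ?p v * ln (q v) - ?p v * ln Z - ?p v * ln (?p v)"
        using True qv Z by (simp add: ln_div ln_mult algebra_simps)
      moreover have "?p v * (q v / (Z * ?p v) - 1) = q v / Z - ?p v"
        using True Z by (simp add: field_simps)
      ultimately show ?thesis by simp
    next
      case False
      then have "?p v = 0"
        using measure_nonneg[of M "g -` {v} \<inter> space M"] by (simp add: fibre_prob_def less_le)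
      then show ?thesis using q[OF v] Z by simp
    qed
  qed
  also have "\<dots> = (\<Sum>v\<in>g ` space M. q v) / Z - 1"
    using sum_fibre_prob[OF g] by (simp add: sum_subtractf sum_divide_distrib)
  also have "\<dots> \<le> 0" using Z by simp
  finally have "(\<Sum>v\<in>g ` space M. ?p v * ln (q v)) - ln Z + fibre_entropy g \<le> 0"
    using sum_fibre_prob[OF g]
    by (simp add: sum_subtractf fibre_entropy_def sum_distrib_right[symmetric])
  then show ?thesis
    using integral_finite_range(2)[OF g, of "\<lambda>v. ln (q v)"] by simp
qed

text \<open>The fibre of \<open>g\<close> over \<open>v\<close> lies in the fibre of
  \<open>g'\<close> over \<open>w\<close>. This supplies the positivity hypothesis of Gibbs'
  inequality for product weights.\<close>

lemma fibre_prob_pos: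
  assumes g: "g \<in> measurable M (count_space UNIV)"
    and v: "v \<in> g ` space M" "0 < fibre_prob M g v"
    and sub: "\<And>y. y \<in> space M \<Longrightarrow> g y = v \<Longrightarrow> g' y = w"
    and g': "g' \<in> measurable M (count_space UNIV)"
  shows "0 < fibre_prob M g' w"
proof -
  have "fibre_prob M g v \<le> fibre_prob M g' w"
    unfolding fibre_prob_def using sub measurable_sets[OF g']
    by (intro finite_measure_mono) auto
  with v show ?thesis by simp
qed

end

section \<open>Names of a partition under a measure-preserving map\<close>

locale partitioned_system = prob_space M for M :: "'a measure" +
  fixes f :: "'a \<Rightarrow> 'a" and P :: "'a set set"
  assumes preserving: "measure_preserving_map M f"
    and fin: "finite P" and sets_P: "P \<subseteq> sets M" and part: "partition_on (space M) P"
begin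

definition cell :: "'a \<Rightarrow> 'a set" where
  "cell y = (THE B. B \<in> P \<and> y \<in> B)"

definition name :: "nat \<Rightarrow> 'a \<Rightarrow> nat \<Rightarrow> 'a set" where
  "name n y = (\<lambda>j\<in>{..<n}. cell ((f ^^ j) y))"

lemma funpow_measurable [measurable]: "f ^^ n \<in> measurable M M"
  using measure_preserving_map_funpow[OF preserving] by (simp add: measure_preserving_map_def)

lemma funpow_space: "y \<in> space M \<Longrightarrow> (f ^^ n) y \<in> space M"
  using measurable_space[OF funpow_measurable] by blast

lemma cell_eq: "B \<in> P \<Longrightarrow> y \<in> B \<Longrightarrow> cell y = B"
  unfolding cell_def using part by (auto simp: partition_on_def disjoint_def intro!: the_equality)

lemma cell_in: "y \<in> space M \<Longrightarrow> cell y \<in> P" and in_cell: "y \<in> space M \<Longrightarrow> y \<in> cell y"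
proof -
  assume "y \<in> space M"
  then obtain B where "B \<in> P" "y \<in> B" using part by (auto simp: partition_on_def)
  then show "cell y \<in> P" "y \<in> cell y" using cell_eq by auto
qed

lemma cell_eq_iff: "y \<in> space M \<Longrightarrow> B \<in> P \<Longrightarrow> cell y = B \<longleftrightarrow> y \<in> B"
  using cell_eq in_cell by auto

lemma name_in: "y \<in> space M \<Longrightarrow> name n y \<in> {..<n} \<rightarrow>\<^sub>E P"
  by (rule PiE_I) (auto simp: name_def cell_in funpow_space)

lemma finite_names: "finite (name n ` space M)"
  by (rule finite_subset[of _ "{..<n} \<rightarrow>\<^sub>E P"]) (use name_in fin in \<open>blast intro: finite_PiE\<close>)+

lemma name_eq_iff:
  assumes "y \<in> space M" "v \<in> {..<n} \<rightarrow>\<^sub>E P"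
  shows "name n y = v \<longleftrightarrow> (\<forall>j<n. (f ^^ j) y \<in> v j)"
proof -
  have "name n y = v \<longleftrightarrow> (\<forall>j<n. cell ((f ^^ j) y) = v j)"
    using assms(2) by (auto simp: name_def fun_eq_iff restrict_def PiE_def extensional_def)
  also have "\<dots> \<longleftrightarrow> (\<forall>j<n. (f ^^ j) y \<in> v j)"
    using cell_eq_iff[OF funpow_space[OF assms(1)]] assms(2) by (auto simp: PiE_def Pi_def)
  finally show ?thesis .
qed

lemma name_measurable: "name n \<in> measurable M (count_space UNIV)"
proof -
  have "name n \<in> measurable M (count_space ({..<n} \<rightarrow>\<^sub>E P))"
  proof (intro measurable_count_space_eq2[THEN iffD2] conjI ballI)
    show "finite ({..<n} \<rightarrow>\<^sub>E P)" using fin by (auto intro!: finite_PiE)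
    show "name n \<in> space M \<rightarrow> {..<n} \<rightarrow>\<^sub>E P" using name_in by auto
    fix v assume v: "v \<in> {..<n} \<rightarrow>\<^sub>E P"
    have vj: "v j \<in> sets M" if "j < n" for j using v that sets_P by auto
    have "name n -` {v} \<inter> space M = {y \<in> space M. \<forall>j\<in>{..<n}. (f ^^ j) y \<in> v j}"
      using name_eq_iff[OF _ v] by auto
    also have "\<dots> \<in> sets M"
      by (intro sets.sets_Collect_finite_All' sets.sets_Collect_finite_All)
        (auto intro!: pred_sets2[OF vj] funpow_measurable simp: pred_def[symmetric])
    finally show "name n -` {v} \<inter> space M \<in> sets M" .
  qed
  then show ?thesis by (rule measurable_compose) simp
qed

text \<open>An atom of the join chooses one cell for each time, and such a choice is a name. For n =
  0 the empty intersection is the whole type instead of \<open>space M\<close>, hence the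
  restriction.\<close>

lemma iterated_partition_eq:
  assumes "0 < n"
  shows "iterated_partition M f P n = (\<lambda>v. name n -` {v} \<inter> space M) ` name n ` space M"
proof -
  let ?pb = "\<lambda>k. pullback_partition M (f ^^ k) P"
  have pb: "(f ^^ k) -` cell ((f ^^ k) y) \<inter> space M \<in> ?pb k" if "y \<in> space M" for k y
    using cell_in[OF funpow_space[OF that]] in_cell[OF funpow_space[OF that, of k]] that
    by (auto simp: pullback_partition_def)
  have pb_eq: "C = (f ^^ k) -` cell ((f ^^ k) y) \<inter> space M" if "C \<in> ?pb k" "y \<in> C" for C k y
    using that by (auto simp: pullback_partition_def cell_eq)
  have fib: "name n -` {name n y} \<inter> space M = (\<Inter>k\<in>{..<n}. (f ^^ k) -` cell ((f ^^ k) y) \<inter> space M)"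
    if "y \<in> space M" for y
    using name_eq_iff[OF _ name_in[OF that]] assms by (auto simp: name_def)
  have "B \<in> iterated_partition M f P n \<longleftrightarrow> (\<exists>y\<in>space M. B = name n -` {name n y} \<inter> space M)" for B
  proof
    assume "B \<in> iterated_partition M f P n"
    then obtain F where F: "F \<in> (\<Pi>\<^sub>E Q\<in>?pb ` {..<n}. Q)" "B = \<Inter> (F ` ?pb ` {..<n})" "B \<noteq> {}"
      by (auto simp: iterated_partition_def common_refinement_def)
    then obtain y where y: "y \<in> B" by blast
    have FC: "F (?pb k) = (f ^^ k) -` cell ((f ^^ k) y) \<inter> space M" if "k < n" for k
      using F y that by (intro pb_eq) auto
    have "B = (\<Inter>k\<in>{..<n}. (f ^^ k) -` cell ((f ^^ k) y) \<inter> space M)"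
      unfolding F(2) using FC by auto
    moreover have "y \<in> space M" using calculation y assms by (auto split: if_splits)
    ultimately show "\<exists>y\<in>space M. B = name n -` {name n y} \<inter> space M" using fib by auto
  next
    assume "\<exists>y\<in>space M. B = name n -` {name n y} \<inter> space M"
    then obtain y where y: "y \<in> space M" and B: "B = name n -` {name n y} \<inter> space M" by auto
    \<comment> \<open>Equal pullbacks at different times are a single member of the family; choosing
      the cell by the point \<open>y\<close> alone is consistent across them.\<close>
    define F where "F = (\<lambda>Q. THE C. C \<in> Q \<and> y \<in> C)"
    have F: "F (?pb k) = (f ^^ k) -` cell ((f ^^ k) y) \<inter> space M" for k
      unfolding F_def using pb[OF y] pb_eq in_cell[OF funpow_space[OF y]] y
      by (intro the_equality) auto
    have "F \<in> (\<Pi> Q\<in>?pb ` {..<n}. Q)" using F pb[OF y] by auto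
    moreover have "B = \<Inter> (F ` ?pb ` {..<n})" unfolding B fib[OF y] using F by auto
    ultimately show "B \<in> iterated_partition M f P n"
      using y B by (auto simp: iterated_partition_def common_refinement)
  qed
  then show ?thesis by auto
qed

lemma partition_entropy_eq:
  assumes "0 < n"
  shows "partition_entropy M (iterated_partition M f P n) = fibre_entropy (name n)"
proof -
  have "inj_on (\<lambda>v. name n -` {v} \<inter> space M) (name n ` space M)"
    by (rule inj_onI) blast
  then show ?thesis
    by (simp add: partition_entropy_def iterated_partition_eq[OF assms] fibre_entropy_def
        sum.reindex fibre_prob_def)
qed

lemma integral_funpow:
  fixes h :: "'b \<Rightarrow> real"
  assumes g: "g \<in> measurable M (count_space UNIV)"
  shows "(\<integral>y. h (g ((f ^^ n) y)) \<partial>M) = (\<integral>y. h (g y) \<partial>M)"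
proof -
  have "(\<integral>y. h (g y) \<partial>distr M M (f ^^ n)) = (\<integral>y. h (g ((f ^^ n) y)) \<partial>M)"
    by (rule integral_distr[OF funpow_measurable]) (use measurable_compose[OF g, of h borel] in simp)
  then show ?thesis
    using measure_preserving_map_funpow[OF preserving] by (simp add: measure_preserving_map_def)
qed

lemma fibre_entropy_nonneg:
  fixes g :: "'a \<Rightarrow> 'b"
  shows "0 \<le> fibre_entropy g"
proof -
  have "x * ln x \<le> 0" if "0 \<le> x" "x \<le> 1" for x :: real
    using that by (cases "x = 0") (auto simp: mult_le_0_iff)
  then show ?thesis
    unfolding fibre_entropy_def fibre_prob_def by (simp add: sum_nonpos)
qed

lemma name_take: "name m y = restrict (name (m + n) y) {..<m}"
  by (auto simp: name_def restrict_def fun_eq_iff)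

lemma name_drop: "name n ((f ^^ m) y) = (\<lambda>j\<in>{..<n}. name (m + n) y (m + j))"
  by (simp add: name_def restrict_def fun_eq_iff funpow_add add.commute[of m])

text \<open>Gibbs' inequality with the product of the two marginal laws as weights. Cutting a name
  in two is injective, so these weights sum to at most 1, and invariance turns the law of the second
  half into that of \<open>name n\<close>.\<close>

lemma fibre_entropy_subadditive:
  "fibre_entropy (name (m + n)) \<le> fibre_entropy (name m) + fibre_entropy (name n)"
proof -
  let ?l = "\<lambda>v. restrict v {..<m}" and ?r = "\<lambda>v. \<lambda>j\<in>{..<n}. v (m + j)"
  let ?pm = "fibre_prob M (name m)" and ?pn = "fibre_prob M (name n)"
  define q where "q v = ?pm (?l v) * ?pn (?r v)" for v
  have nm: "name n \<circ> (f ^^ m) \<in> measurable M (count_space UNIV)"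
    by (rule measurable_comp[OF funpow_measurable name_measurable])
  have inj: "inj_on (\<lambda>v. (?l v, ?r v)) (name (m + n) ` space M)"
  proof (rule inj_onI, clarsimp)
    fix y z assume yz: "y \<in> space M" "z \<in> space M"
      "restrict (name (m + n) y) {..<m} = restrict (name (m + n) z) {..<m}"
      "(\<lambda>j\<in>{..<n}. name (m + n) y (m + j)) = (\<lambda>j\<in>{..<n}. name (m + n) z (m + j))"
    show "name (m + n) y = name (m + n) z"
    proof
      fix j
      consider "j < m" | "m \<le> j" "j < m + n" | "j \<ge> m + n" by linarith
      then show "name (m + n) y j = name (m + n) z j"
      proof cases
        case 1 then show ?thesis using fun_cong[OF yz(3), of j] by simp
      next
        case 2
        then have "j - m < n" by simp
        with 2 show ?thesis using fun_cong[OF yz(4), of "j - m"] by simp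
      next
        case 3 then show ?thesis by (simp add: name_def)
      qed
    qed
  qed
  have pm_pos: "0 < ?pm (name m y)" and pn_pos: "0 < ?pn (name n ((f ^^ m) y))"
    if y: "y \<in> space M" "0 < fibre_prob M (name (m + n)) (name (m + n) y)" for y
  proof -
    show "0 < ?pm (name m y)"
      using name_take[of m _ n] y(1)
      by (intro fibre_prob_pos[OF name_measurable _ y(2) _ name_measurable]) auto
    have "0 < fibre_prob M (name n \<circ> (f ^^ m)) (name n ((f ^^ m) y))"
      by (rule fibre_prob_pos[OF name_measurable _ y(2)]) (use y name_drop nm in auto)
    moreover have "fibre_prob M (name n \<circ> (f ^^ m)) w = ?pn w" for w
    proof -
      have "measure M (name n -` {w} \<inter> space M) = measure (distr M M (f ^^ m)) (name n -` {w} \<inter> space M)"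
        using measure_preserving_map_funpow[OF preserving] by (simp add: measure_preserving_map_def)
      also have "\<dots> = measure M ((f ^^ m) -` (name n -` {w} \<inter> space M) \<inter> space M)"
        using measurable_sets[OF name_measurable] by (intro measure_distr funpow_measurable) auto
      also have "(f ^^ m) -` (name n -` {w} \<inter> space M) \<inter> space M = (name n \<circ> (f ^^ m)) -` {w} \<inter> space M"
        using funpow_space by auto
      finally show ?thesis by (simp add: fibre_prob_def)
    qed
    ultimately show "0 < ?pn (name n ((f ^^ m) y))" by simp
  qed
  have qy: "q (name (m + n) y) = ?pm (name m y) * ?pn (name n ((f ^^ m) y))" for y
    by (simp add: q_def name_take[of m y n, symmetric] name_drop[symmetric])
  have "(\<Sum>v\<in>name (m + n) ` space M. q v)
      = (\<Sum>(a, b)\<in>(\<lambda>v. (?l v, ?r v)) ` name (m + n) ` space M. ?pm a * ?pn b)"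
    by (simp add: sum.reindex[OF inj] q_def)
  also have "\<dots> \<le> (\<Sum>(a, b)\<in>name m ` space M \<times> name n ` space M. ?pm a * ?pn b)"
  proof (rule sum_mono2)
    show "(\<lambda>v. (?l v, ?r v)) ` name (m + n) ` space M \<subseteq> name m ` space M \<times> name n ` space M"
      by (auto simp: name_take[of m _ n, symmetric] name_drop[symmetric] funpow_space)
  qed (auto simp: finite_names fibre_prob_def)
  also have "\<dots> = 1"
    using sum_fibre_prob[OF name_measurable finite_names]
    by (simp add: sum.cartesian_product[symmetric] sum_distrib_left[symmetric])
  finally have "fibre_entropy (name (m + n)) \<le> ln 1 - (\<integral>y. ln (q (name (m + n) y)) \<partial>M)"
    by (intro gibbs_inequality name_measurable finite_names)
      (auto simp: qy pm_pos pn_pos, simp add: q_def fibre_prob_def)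
  also have "(\<integral>y. ln (q (name (m + n) y)) \<partial>M)
      = (\<integral>y. ln (?pm (name m y)) + ln (?pn (name n ((f ^^ m) y))) \<partial>M)"
  proof (rule integral_cong_AE)
    \<comment> \<open>Names of probability zero have to be discarded: the logarithm of the product
      splits only where both factors are positive.\<close>
    have "AE y in M. 0 < fibre_prob M (name (m + n)) (name (m + n) y)"
    proof -
      let ?N = "\<Union>v\<in>{v \<in> name (m + n) ` space M. fibre_prob M (name (m + n)) v = 0}.
        name (m + n) -` {v} \<inter> space M"
      have "?N \<in> null_sets M"
        using measurable_sets[OF name_measurable]
        by (intro null_sets_UN' ) (auto simp: fibre_prob_def emeasure_eq_measure finite_names
            intro!: countable_finite)
      then show ?thesis
        by (rule AE_I') (auto simp: fibre_prob_def zero_less_measure_iff measure_nonneg less_le)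
    qed
    then show "AE y in M. ln (q (name (m + n) y)) = ln (?pm (name m y)) + ln (?pn (name n ((f ^^ m) y)))"
    proof (rule AE_mp, intro AE_I2 impI)
      fix y assume "y \<in> space M" "0 < fibre_prob M (name (m + n)) (name (m + n) y)"
      from pm_pos[OF this] pn_pos[OF this]
      show "ln (q (name (m + n) y)) = ln (?pm (name m y)) + ln (?pn (name n ((f ^^ m) y)))"
        by (simp add: qy ln_mult)
    qed
    show "(\<lambda>y. ln (q (name (m + n) y))) \<in> borel_measurable M"
      by (rule measurable_compose[OF name_measurable]) simp
    show "(\<lambda>y. ln (?pm (name m y)) + ln (?pn (name n ((f ^^ m) y)))) \<in> borel_measurable M"
      by (intro borel_measurable_add measurable_compose[OF name_measurable]
          measurable_compose[OF funpow_measurable measurable_compose[OF name_measurable]]) auto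
  qed
  also have "\<dots> = (\<integral>y. ln (?pm (name m y)) \<partial>M) + (\<integral>y. ln (?pn (name n y)) \<partial>M)"
  proof -
    have "finite ((name n \<circ> (f ^^ m)) ` space M)"
      by (rule finite_subset[OF _ finite_names[of n]]) (auto simp: funpow_space)
    then have "integrable M (\<lambda>y. ln (?pn (name n ((f ^^ m) y))))"
      using integral_finite_range(1)[OF nm, of "\<lambda>v. ln (?pn v)"] by simp
    then show ?thesis
      using integral_finite_range(1)[OF name_measurable finite_names, of "\<lambda>v. ln (?pm v)"]
        integral_funpow[OF name_measurable, of "\<lambda>v. ln (?pn v)" n m]
      by (subst Bochner_Integration.integral_add) auto
  qed
  also have "\<dots> = - fibre_entropy (name m) - fibre_entropy (name n)"
    using integral_finite_range(2)[OF name_measurable finite_names, of "\<lambda>v. ln (?pm v)"]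
      integral_finite_range(2)[OF name_measurable finite_names, of "\<lambda>v. ln (?pn v)"]
    by (simp add: fibre_entropy_def)
  finally show ?thesis by simp
qed

text \<open>The entropy is defined by \<open>lim\<close>, which carries information only once
  convergence is known. At n = 0 both quotients are 0, so the missing identity of partitions there
  does no harm.\<close>

lemma entropy_tendsto:
  "(\<lambda>n. fibre_entropy (name n) / real n) \<longlonglongrightarrow> entropy_wrt_partition M f P"
proof -
  have "convergent (\<lambda>n. fibre_entropy (name n) / real n)"
    by (intro convergent_subadditive fibre_entropy_subadditive fibre_entropy_nonneg)
  then have "(\<lambda>n. fibre_entropy (name n) / real n) \<longlonglongrightarrow> lim (\<lambda>n. fibre_entropy (name n) / real n)"
    by (simp add: convergent_LIMSEQ_iff)
  moreover have "(\<lambda>n. fibre_entropy (name n) / real n)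
      = (\<lambda>n. partition_entropy M (iterated_partition M f P n) / real n)"
  proof
    fix n show "fibre_entropy (name n) / real n
      = partition_entropy M (iterated_partition M f P n) / real n"
      by (cases n) (simp_all add: partition_entropy_eq)
  qed
  ultimately show ?thesis by (simp add: entropy_wrt_partition_def)
qed

section \<open>Entropy bounded by the number of label names\<close>

definition label_names :: "('a \<Rightarrow> 'l) \<Rightarrow> nat \<Rightarrow> (nat \<Rightarrow> 'l) set" where
  "label_names lab n = (\<lambda>y. \<lambda>j\<in>{..<n}. lab ((f ^^ j) y)) ` space M"

text \<open>Gibbs' inequality for the weights that give a name the factor \<open>exp (- K)\<close> for each
  position where it differs from the name predicted from the labels \<open>lab\<close>.\<close>

lemma fibre_entropy_le_card:
  fixes lab :: "'a \<Rightarrow> 'l"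
  assumes E: "{y \<in> space M. cell y \<noteq> g (lab y)} \<in> sets M"
    and S: "finite (label_names lab n)"
    and K: "0 \<le> K"
  shows "fibre_entropy (name n) \<le> ln (card (label_names lab n)) + n * ln (1 + card P * exp (- K))
    + K * n * prob {y \<in> space M. cell y \<noteq> g (lab y)}"
proof -
  let ?S = "label_names lab n" and ?E = "{y \<in> space M. cell y \<noteq> g (lab y)}"
  define c where "c w j b = (if b = g (w j) then 1 else exp (- K))" for w :: "nat \<Rightarrow> 'l" and j :: nat and b
  define q where "q v = (\<Sum>w\<in>?S. \<Prod>j<n. c w j (v j))" for v
  have c0: "0 < c w j b" for w j b by (simp add: c_def)
  have ne: "?S \<noteq> {}" using not_empty by (auto simp: label_names_def)
  have q0: "0 < q v" for v unfolding q_def using S ne c0 by (intro sum_pos prod_pos) auto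
  let ?Z = "card ?S * (1 + card P * exp (- K)) ^ n"
  have "(\<Sum>v\<in>name n ` space M. q v) \<le> (\<Sum>v\<in>{..<n} \<rightarrow>\<^sub>E P. q v)"
    using fin q0 by (intro sum_mono2 finite_PiE image_subsetI name_in) (auto simp: less_imp_le)
  also have "\<dots> = (\<Sum>w\<in>?S. \<Sum>v\<in>{..<n} \<rightarrow>\<^sub>E P. \<Prod>j<n. c w j (v j))"
    unfolding q_def by (rule sum.swap)
  also have "\<dots> = (\<Sum>w\<in>?S. \<Prod>j<n. \<Sum>b\<in>P. c w j b)"
    using fin by (simp add: prod.distrib prod_sum_PiE)
  also have "\<dots> \<le> (\<Sum>w\<in>?S. \<Prod>j<n. 1 + card P * exp (- K))"
  proof (intro sum_mono prod_mono conjI)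
    fix w j
    have "(\<Sum>b\<in>P. c w j b) \<le> (\<Sum>b\<in>P. (if b = g (w j) then 1 else 0) + exp (- K))"
      by (intro sum_mono) (auto simp: c_def)
    also have "\<dots> \<le> 1 + card P * exp (- K)" using fin by (simp add: sum.distrib)
    finally show "(\<Sum>b\<in>P. c w j b) \<le> 1 + card P * exp (- K)" .
  qed (auto intro!: sum_nonneg less_imp_le[OF c0])
  finally have Z: "(\<Sum>v\<in>name n ` space M. q v) \<le> ?Z" by simp
  have P1: "0 < 1 + card P * exp (- K)" by (simp add: add_pos_nonneg)
  have Z0: "0 < ?Z" using S ne P1 by (simp add: card_gt_0_iff)
  have "fibre_entropy (name n) \<le> ln ?Z - (\<integral>y. ln (q (name n y)) \<partial>M)"
    by (intro gibbs_inequality name_measurable finite_names Z Z0) (auto simp: q0 less_imp_le)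
  moreover have "(\<integral>y. ln (q (name n y)) \<partial>M) \<ge> (\<integral>y. - K * (\<Sum>j<n. indicator ?E ((f ^^ j) y)) \<partial>M)"
  proof (rule integral_mono)
    show "integrable M (\<lambda>y. ln (q (name n y)))"
      by (rule integral_finite_range(1)[OF name_measurable finite_names])
    show "integrable M (\<lambda>y. - K * (\<Sum>j<n. indicator ?E ((f ^^ j) y)))"
      using E by (intro integrable_mult_right Bochner_Integration.integrable_sum)
       (auto intro!: integrable_const_bound[of _ 1])
    fix y assume y: "y \<in> space M"
    let ?w = "\<lambda>j\<in>{..<n}. lab ((f ^^ j) y)"
    have "exp (- K * (\<Sum>j<n. indicator ?E ((f ^^ j) y))) = (\<Prod>j<n. exp (- K * indicator ?E ((f ^^ j) y)))"
      by (simp add: exp_sum sum_distrib_left)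
    also have "\<dots> = (\<Prod>j<n. c ?w j (name n y j))"
      using funpow_space[OF y] by (intro prod.cong) (auto simp: c_def name_def indicator_def)
    \<comment> \<open>The label name of \<open>y\<close> itself is one of the summands of
      \<open>q\<close>.\<close>
    also have "\<dots> \<le> q (name n y)"
      unfolding q_def using S y
      by (intro member_le_sum[of ?w ?S "\<lambda>w. \<Prod>j<n. c w j (name n y j)"])
        (auto intro!: prod_nonneg less_imp_le[OF c0] simp: label_names_def)
    finally show "- K * (\<Sum>j<n. indicator ?E ((f ^^ j) y)) \<le> ln (q (name n y))"
      using q0 by (simp add: ln_ge_iff)
  qed
  moreover have "(\<integral>y. - K * (\<Sum>j<n. indicator ?E ((f ^^ j) y)) \<partial>M) = - (K * n * prob ?E)"
  proof -
    have *: "(\<integral>y. indicator ?E ((f ^^ j) y) \<partial>M) = prob ?E" for j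
    proof -
      have "(\<integral>y. indicator ?E y \<partial>distr M M (f ^^ j)) = (\<integral>y. indicator ?E ((f ^^ j) y) \<partial>M :: real)"
        by (rule integral_distr) (use E in measurable)
      then show ?thesis
        using measure_preserving_map_funpow[OF preserving] sets.sets_into_space[OF E]
        by (simp add: measure_preserving_map_def Int_absorb2)
    qed
    have "(\<integral>y. (\<Sum>j<n. indicator ?E ((f ^^ j) y)) \<partial>M) = (\<Sum>j<n. prob ?E)"
      using E by (subst Bochner_Integration.integral_sum)
        (auto simp: * intro!: integrable_const_bound[of _ 1])
    then show ?thesis by simp
  qed
  moreover have "ln ?Z = ln (card ?S) + n * ln (1 + card P * exp (- K))"
    using S ne P1 by (simp add: ln_mult card_gt_0_iff ln_realpow)
  ultimately show ?thesis by linarith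
qed

text \<open>Reduces an upper bound to finding labels that predict the partition well and have few
  names. The order of choices matters: first \<open>K\<close>, so that the total weight per position
  is near 1, and only then the error probability, which enters multiplied by
  \<open>K\<close>.\<close>

lemma entropy_le:
  fixes h :: real
  assumes "\<And>e::real. 0 < e \<Longrightarrow> \<exists>(lab :: 'a \<Rightarrow> 'l) g. {y \<in> space M. cell y \<noteq> g (lab y)} \<in> sets M \<and>
     prob {y \<in> space M. cell y \<noteq> g (lab y)} < e \<and>
     (\<forall>\<^sub>F n in sequentially. finite (label_names lab n) \<and>
       ln (card (label_names lab n)) \<le> n * (h + e))"
  shows "entropy_wrt_partition M f P \<le> h"
proof (rule field_le_epsilon)
  fix e :: real assume e: "0 < e"
  have "((\<lambda>K::real. ln (1 + card P * exp (- K))) \<longlongrightarrow> ln (1 + real (card P) * 0)) at_top"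
    by (intro tendsto_ln tendsto_add tendsto_mult tendsto_const
        filterlim_compose[OF exp_at_bot filterlim_uminus_at_bot_at_top]) simp
  then have "\<forall>\<^sub>F K in at_top. ln (1 + card P * exp (- K)) < e / 3"
    using e by (intro order_tendstoD(2)[where y = "ln (1 + real (card P) * 0)"]) auto
  then have "\<forall>\<^sub>F K in at_top. 0 < K \<and> ln (1 + card P * exp (- K)) < e / 3"
    using eventually_gt_at_top[of 0] by eventually_elim auto
  then obtain K :: real where K: "0 < K" "ln (1 + card P * exp (- K)) < e / 3"
    using eventually_happens'[OF trivial_limit_at_top_linorder] by blast
  define e' where "e' = min (e / 3) (e / (3 * K))"
  have e': "0 < e'" using e K by (simp add: e'_def)
  obtain lab :: "'a \<Rightarrow> 'l" and g where lab: "{y \<in> space M. cell y \<noteq> g (lab y)} \<in> sets M"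
     "prob {y \<in> space M. cell y \<noteq> g (lab y)} < e'"
     "\<forall>\<^sub>F n in sequentially. finite (label_names lab n) \<and> ln (card (label_names lab n)) \<le> n * (h + e')"
    using assms[OF e'] by blast
  have "\<forall>\<^sub>F n in sequentially. fibre_entropy (name n) / real n \<le> h + e"
    using lab(3) eventually_gt_at_top[of 0]
  proof eventually_elim
    case (elim n)
    have "fibre_entropy (name n) \<le> n * (h + e') + n * (e / 3) + n * (K * e')"
    proof -
      have "K * real n * prob {y \<in> space M. cell y \<noteq> g (lab y)} \<le> K * real n * e'"
        using K lab(2) by (intro mult_left_mono) auto
      moreover have "real n * ln (1 + card P * exp (- K)) \<le> n * (e / 3)"
        using K by (intro mult_left_mono) auto
      moreover have "ln (card (label_names lab n)) \<le> n * (h + e')" using elim by blast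
      ultimately show ?thesis
        using fibre_entropy_le_card[of g lab n K, OF lab(1) conjunct1[OF elim(1)]] K
          mult.assoc[of K "real n" e'] mult.left_commute[of "real n" K e'] by linarith
    qed
    also have "\<dots> = n * (h + e' + e / 3 + K * e')" by (simp add: algebra_simps)
    also have "\<dots> \<le> n * (h + e)"
    proof (intro mult_left_mono)
      have "K * e' \<le> K * (e / (3 * K))" using K by (intro mult_left_mono) (auto simp: e'_def)
      then have "K * e' \<le> e / 3" using K by simp
      moreover have "e' \<le> e / 3" by (simp add: e'_def)
      ultimately show "h + e' + e / 3 + K * e' \<le> h + e" by linarith
    qed simp
    finally show ?case using elim by (simp add: field_simps)
  qed
  then show "entropy_wrt_partition M f P \<le> h + e"
    by (rule tendsto_upperbound[OF entropy_tendsto]) simp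
qed

text \<open>Every name of positive probability carries the same information n h. The value 0 is
  allowed for names that only a null set realises.\<close>

lemma entropy_eq_uniform:
  assumes "\<And>n y. y \<in> space M \<Longrightarrow> fibre_prob M (name n) (name n y) \<in> {0, exp (- (n * h))}"
  shows "entropy_wrt_partition M f P = h"
proof -
  have "fibre_entropy (name n) = n * h" for n
  proof -
    have "fibre_entropy (name n) = (\<Sum>v\<in>name n ` space M. fibre_prob M (name n) v * (n * h))"
      unfolding fibre_entropy_def sum_negf[symmetric]
      using assms[of _ n] by (intro sum.cong) force+
    then show ?thesis
      using sum_fibre_prob[OF name_measurable finite_names] by (simp add: sum_distrib_right[symmetric])
  qed
  then have "\<forall>\<^sub>F n in sequentially. fibre_entropy (name n) / real n = h"
    by (intro eventually_sequentiallyI[of 1]) auto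
  then have "(\<lambda>n. fibre_entropy (name n) / real n) \<longlonglongrightarrow> h"
    by (rule tendsto_eventually)
  with entropy_tendsto show ?thesis by (rule LIMSEQ_unique)
qed

end

subsection \<open>Suspension flows as measurable systems\<close>

text \<open>Identifies the abstract product of discrete spaces with a subspace of the function type,
  so that continuity and Borel sets of the type classes become available.\<close>

lemma full_shift_eq:
  fixes A :: "'a::discrete_topology set"
  shows "full_shift A = top_of_set {x. \<forall>i. x i \<in> A}"
proof -
  have "discrete_topology A = top_of_set A"
    unfolding topology_eq by (auto simp: openin_open discrete_topology_class.open_discrete)
  then have "full_shift A = product_topology (\<lambda>_. top_of_set A) UNIV"
    by (simp add: full_shift_def)
  also have "\<dots> = subtopology (product_topology (\<lambda>_. euclidean) UNIV) (UNIV \<rightarrow>\<^sub>E A)"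
    by (simp add: subtopology_product_topology)
  also have "UNIV \<rightarrow>\<^sub>E A = {x. \<forall>i. x i \<in> A}" by auto
  finally show ?thesis by (simp add: euclidean_product_topology)
qed

lemma sets_borel_of: "sets (borel_of T) = sigma_sets (topspace T) {U. openin T U}"
  and space_borel_of: "space (borel_of T) = topspace T"
  unfolding borel_of_def by (auto intro!: sets_measure_of space_measure_of dest: openin_subset)

lemma openin_sets_borel_of: "openin T U \<Longrightarrow> U \<in> sets (borel_of T)"
  by (simp add: sets_borel_of sigma_sets.Basic)

lemma birkhoff_sum_add:
  "birkhoff_sum \<rho> (n + m) x = birkhoff_sum \<rho> n x + birkhoff_sum \<rho> m (shift_iter n x)"
proof (induction m rule: int_induct[of _ 0])
  case base
  show ?case by (simp add: birkhoff_sum_def)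
next
  case (step1 i)
  then show ?case
    using birkhoff_sum_add_one[of \<rho> "n + i" x] birkhoff_sum_add_one[of \<rho> i "shift_iter n x"]
    by (simp add: shift_iter_add[symmetric] add_ac)
next
  case (step2 i)
  then show ?case
    using birkhoff_sum_add_one[of \<rho> "n + i - 1" x] birkhoff_sum_add_one[of \<rho> "i - 1" "shift_iter n x"]
    by (simp add: shift_iter_add[symmetric] algebra_simps)
qed

lemma birkhoff_sum_0 [simp]: "birkhoff_sum \<rho> 0 x = 0"
  by (simp add: birkhoff_sum_def)

lemma birkhoff_sum_1 [simp]: "birkhoff_sum \<rho> 1 x = \<rho> x"
  using birkhoff_sum_add_one[of \<rho> 0 x] by (simp add: shift_iter_0)

lemma continuous_on_shift_iter: "continuous_on S (shift_iter n :: (int \<Rightarrow> 'a::topological_space) \<Rightarrow> _)"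
  unfolding shift_iter_def
  by (intro continuous_on_coordinatewise_then_product)
    (rule continuous_on_subset[OF continuous_on_product_coordinates subset_UNIV])

section \<open>Fundamental domain of a suspension whose roof is at least 1\<close>

locale susp =
  fixes A :: "nat set" and \<rho> :: "(int \<Rightarrow> nat) \<Rightarrow> real"
  assumes finite_A: "finite A" and cont: "continuous_on UNIV \<rho>" and ge1: "\<And>x. 1 \<le> \<rho> x"
begin

abbreviation "\<Omega> \<equiv> {x :: int \<Rightarrow> nat. \<forall>i. x i \<in> A}"
abbreviation "cls \<equiv> susp_class A \<rho>"
abbreviation "\<phi> \<equiv> susp_flow A \<rho>"
abbreviation "T \<equiv> suspension A \<rho>"
abbreviation "R \<equiv> roof_region A \<rho>"
abbreviation "B \<equiv> birkhoff_sum \<rho>"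

text \<open>Cutting off the roof leaves exactly one representative of every class
  (\<open>cls_inj\<close>, \<open>topspace_T\<close>), so the quotient can be handled through
  subsets of a product space.\<close>

definition D :: "((int \<Rightarrow> nat) \<times> real) set" where
  "D = {(x, s). x \<in> \<Omega> \<and> 0 \<le> s \<and> s < \<rho> x}"

lemma pos: "0 < \<rho> x"
  using ge1[of x] by simp

lemma D_subset: "D \<subseteq> R"
  by (auto simp: D_def roof_region_def topspace_full_shift)

lemma R_def': "R = {(x, s). x \<in> \<Omega> \<and> 0 \<le> s \<and> s \<le> \<rho> x}"
  by (auto simp: roof_region_def topspace_full_shift)

lemma cls_inj: "p \<in> D \<Longrightarrow> q \<in> D \<Longrightarrow> cls p = cls q \<Longrightarrow> p = q"
proof -
  assume pq: "p \<in> D" "q \<in> D" "cls p = cls q"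
  obtain x s y r where [simp]: "p = (x, s)" "q = (y, r)" by (cases p, cases q)
  have "x = y \<and> s = r"
    by (rule susp_class_inj[where A = A and \<rho> = \<rho>]) (use pq pos in \<open>auto simp: D_def topspace_full_shift\<close>)
  then show "p = q" by simp
qed

lemma inj_on_cls: "inj_on cls D"
  by (rule inj_onI) (rule cls_inj)

lemma shift_Omega: "x \<in> \<Omega> \<Longrightarrow> shift_iter n x \<in> \<Omega>"
  by (simp add: shift_iter_def)

lemma cls_top: "x \<in> \<Omega> \<Longrightarrow> cls (x, \<rho> x) = cls (left_shift x, 0)"
proof -
  assume "x \<in> \<Omega>"
  then have g: "roof_glue A \<rho> (x, \<rho> x) (left_shift x, 0)"
    by (auto simp: roof_glue_def topspace_full_shift)
  have "equivclp (roof_glue A \<rho>) (x, \<rho> x) q \<longleftrightarrow> equivclp (roof_glue A \<rho>) (left_shift x, 0) q" for q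
    using r_into_equivclp[of "roof_glue A \<rho>", OF g] equivclp_sym equivclp_trans by metis
  then show ?thesis by (simp add: susp_class_def)
qed

lemma topspace_T: "topspace T = cls ` D"
proof -
  have "cls p \<in> cls ` D" if "p \<in> R" for p
  proof (cases p)
    case (Pair x s)
    show ?thesis
    proof (cases "s = \<rho> x")
      case True
      moreover have "(left_shift x, 0) \<in> D"
        using that Pair pos by (auto simp: D_def R_def' left_shift_def)
      ultimately show ?thesis using cls_top[of x] that Pair by (auto simp: R_def')
    qed (use that Pair in \<open>auto simp: D_def R_def'\<close>)
  qed
  then show ?thesis using D_subset by (auto simp: topspace_suspension)
qed

lemma cls_in: "p \<in> D \<Longrightarrow> cls p \<in> topspace T"
  by (simp add: topspace_T)

lemma roof_topology_eq: "roof_topology A \<rho> = top_of_set R"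
proof -
  have "prod_topology (full_shift A) euclideanreal = top_of_set (\<Omega> \<times> UNIV)"
    by (simp add: full_shift_eq prod_topology_subtopology)
  then show ?thesis
    by (simp add: roof_topology_def subtopology_subtopology) (auto simp: R_def' intro!: arg_cong[of _ _ top_of_set])
qed

lemma openin_T: "openin T U \<longleftrightarrow> U \<subseteq> cls ` D \<and> (\<exists>W. open W \<and> {p \<in> R. cls p \<in> U} = R \<inter> W)"
proof -
  have "cls ` D = cls ` R"
    using topspace_T by (simp add: topspace_suspension)
  then show ?thesis
    by (auto simp: suspension_def openin_quotient_topology roof_topology_eq openin_open)
qed

lemma open_sub_D:
  assumes "openin T U" obtains W where "open W" "{p \<in> D. cls p \<in> U} = D \<inter> W"
  using assms D_subset unfolding openin_T by blast

lemma cont_fst: "continuous_on S (\<lambda>p. \<rho> (fst p))"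
  by (rule continuous_on_compose2[OF cont continuous_on_fst[OF continuous_on_id]]) auto

lemma rho_measurable [measurable]: "\<rho> \<in> borel_measurable borel"
  using cont by (rule borel_measurable_continuous_onI)

lemma fst_shift_measurable [measurable]: "(\<lambda>p. shift_iter n (fst p)) \<in> borel \<rightarrow>\<^sub>M (borel :: (int \<Rightarrow> nat) measure)"
  by (rule borel_measurable_continuous_onI)
    (rule continuous_on_compose2[OF continuous_on_shift_iter[of UNIV] continuous_on_fst[OF continuous_on_id]], auto)

lemma B_measurable [measurable]: "(\<lambda>p. B n (fst p)) \<in> borel_measurable (borel :: ((int \<Rightarrow> nat) \<times> real) measure)"
  unfolding birkhoff_sum_def by measurable

lemma snd_measurable [measurable]: "(snd :: (int \<Rightarrow> nat) \<times> real \<Rightarrow> real) \<in> borel_measurable borel"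
  by (rule borel_measurable_continuous_onI) (rule continuous_on_snd[OF continuous_on_id])

lemma closed_Omega: "closed \<Omega>"
proof -
  have "\<Omega> = (\<Inter>i. (\<lambda>x. x i) -` A)" by auto
  moreover have "closed ((\<lambda>x :: int \<Rightarrow> nat. x i) -` A)" for i
  proof (rule closed_vimage)
    show "closed A" using finite_A by (rule finite_imp_closed)
  qed simp
  ultimately show ?thesis by auto
qed

lemma D_sets [measurable]: "D \<in> sets borel"
proof -
  have "D = (\<Omega> \<times> {0..}) \<inter> {p. snd p < \<rho> (fst p)}" by (auto simp: D_def)
  moreover have "closed (\<Omega> \<times> {0::real..})" by (intro closed_Times closed_Omega) auto
  moreover have "open {p :: (int \<Rightarrow> nat) \<times> real. snd p < \<rho> (fst p)}"
    by (intro open_Collect_less cont_fst continuous_intros)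
  ultimately show ?thesis by (simp add: borel_closed borel_open)
qed

text \<open>Away from the zero section the quotient map is open. The zero section itself is cut
  out by the open sets \<open>E\<close> of points whose nearest return to the base lies in \<open>V\<close>.\<close>

lemma cls_image_sets:
  assumes "G \<in> sets borel"
  shows "cls ` (G \<inter> D) \<in> sets (borel_of T)"
proof -
  \<comment> \<open>Points strictly between base and roof are glued to nothing, so such a set is its
    own saturation and its image is open.\<close>
  have pos_part: "cls ` (W \<inter> D \<inter> {p. 0 < snd p}) \<in> sets (borel_of T)" if "open W" for W
  proof (intro openin_sets_borel_of, unfold openin_T, intro conjI exI)
    show "open (W \<inter> {p. 0 < snd p} \<inter> {p. snd p < \<rho> (fst p)})"
      using that by (intro open_Int open_Collect_less cont_fst continuous_intros)
    show "{p \<in> R. cls p \<in> cls ` (W \<inter> D \<inter> {p. 0 < snd p})}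
        = R \<inter> (W \<inter> {p. 0 < snd p} \<inter> {p. snd p < \<rho> (fst p)})"
    proof (intro set_eqI iffI)
      fix p assume "p \<in> {p \<in> R. cls p \<in> cls ` (W \<inter> D \<inter> {p. 0 < snd p})}"
      then obtain q where q: "p \<in> R" "q \<in> W" "q \<in> D" "0 < snd q" "cls p = cls q" by auto
      obtain x s where p: "p = (x, s)" by force
      show "p \<in> R \<inter> (W \<inter> {p. 0 < snd p} \<inter> {p. snd p < \<rho> (fst p)})"
      proof (cases "s = \<rho> x")
        case True
        moreover have "(left_shift x, 0) \<in> D"
          using q(1) p pos by (auto simp: D_def R_def' left_shift_def)
        ultimately have "(left_shift x, 0) = q"
          using q p cls_top[of x] by (intro cls_inj) (auto simp: R_def')
        with q show ?thesis by auto
      next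
        case False
        then have "p \<in> D" using q(1) p by (auto simp: D_def R_def')
        with q have "p = q" by (intro cls_inj)
        with q show ?thesis by (auto simp: D_def)
      qed
    next
      fix p assume "p \<in> R \<inter> (W \<inter> {p. 0 < snd p} \<inter> {p. snd p < \<rho> (fst p)})"
      then show "p \<in> {p \<in> R. cls p \<in> cls ` (W \<inter> D \<inter> {p. 0 < snd p})}"
        by (auto simp: D_def R_def')
    qed
  qed auto
  have zero_part: "cls ` ((V \<times> {0}) \<inter> D) \<in> sets (borel_of T)" if V: "open V" for V
  proof -
    define E where "E = {p \<in> D. fst p \<in> V \<and> snd p < \<rho> (fst p) / 2 \<or>
      left_shift (fst p) \<in> V \<and> snd p > \<rho> (fst p) / 2}"
    have "openin T (cls ` E)"
    proof (unfold openin_T, intro conjI exI)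
      let ?W = "{p. fst p \<in> V} \<inter> {p. snd p < \<rho> (fst p) / 2} \<union>
          {p. shift_iter 1 (fst p) \<in> V} \<inter> {p. \<rho> (fst p) / 2 < snd p}"
      have "open {p :: (int \<Rightarrow> nat) \<times> real. fst p \<in> V}"
        using open_vimage[OF V, of fst] by (simp add: vimage_def continuous_on_fst continuous_on_id)
      moreover have "open {p :: (int \<Rightarrow> nat) \<times> real. shift_iter 1 (fst p) \<in> V}"
        using open_vimage[OF V, of "\<lambda>p. shift_iter 1 (fst p)"]
          continuous_on_compose2[OF continuous_on_shift_iter[of UNIV 1] continuous_on_fst[OF continuous_on_id],
            of "UNIV :: ((int \<Rightarrow> nat) \<times> real) set"]
        by (simp add: vimage_def)
      ultimately show "open ?W"
        by (intro open_Un open_Int open_Collect_less cont_fst continuous_intros) auto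
      show "{p \<in> R. cls p \<in> cls ` E} = R \<inter> ?W"
      proof (intro set_eqI iffI)
        fix p assume "p \<in> {p \<in> R. cls p \<in> cls ` E}"
        then obtain q where q: "p \<in> R" "q \<in> E" "cls p = cls q" by auto
        obtain x s where p: "p = (x, s)" by force
        show "p \<in> R \<inter> ?W"
        proof (cases "s = \<rho> x")
          case True
          have "(left_shift x, 0) \<in> D"
            using q(1) p pos by (auto simp: D_def R_def' left_shift_def)
          then have "(left_shift x, 0) = q"
            using q p cls_top[of x] True by (intro cls_inj) (auto simp: R_def' E_def)
          then have "left_shift x \<in> V" using q(2) pos[of "left_shift x"] by (auto simp: E_def)
          with True q p pos[of x] show ?thesis by (auto simp: shift_iter_1)
        next
          case False
          then have "p \<in> D" using q(1) p by (auto simp: D_def R_def')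
          with q have "p = q" by (intro cls_inj) (auto simp: E_def)
          with q show ?thesis by (auto simp: E_def shift_iter_1)
        qed
      next
        fix p assume p: "p \<in> R \<inter> ?W"
        obtain x s where xs: "p = (x, s)" by force
        have "cls p \<in> cls ` E"
        proof (cases "s = \<rho> x")
          case True
          then have "(left_shift x, 0) \<in> E"
            using p xs pos[of x] pos[of "left_shift x"]
            by (auto simp: E_def D_def R_def' left_shift_def shift_iter_def)
          then show ?thesis using cls_top[of x] p xs True by (auto simp: R_def')
        next
          case False
          then have "p \<in> E" using p xs by (auto simp: E_def D_def R_def' shift_iter_1)
          then show ?thesis by auto
        qed
        with p show "p \<in> {p \<in> R. cls p \<in> cls ` E}" by auto
      qed
    qed (auto simp: E_def)
    then have "cls ` E \<in> sets (borel_of T)" by (rule openin_sets_borel_of)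
    \<comment> \<open>The points of \<open>E\<close> in the upper half have positive height, so
      removing all positive heights leaves exactly the zero section over \<open>V\<close>.\<close>
    moreover have "cls ` ((V \<times> {0}) \<inter> D) = cls ` E - cls ` (UNIV \<inter> D \<inter> {p. 0 < snd p})"
    proof -
      have "(V \<times> {0}) \<inter> D = E - (UNIV \<inter> D \<inter> {p. 0 < snd p})"
        using pos by (auto simp: E_def D_def)
      then show ?thesis
        by (simp only:) (rule inj_on_image_set_diff[OF inj_on_cls], auto simp: E_def)
    qed
    ultimately show ?thesis using pos_part[of UNIV] by auto
  qed
  \<comment> \<open>As \<open>cls\<close> is injective on \<open>D\<close>, images commute with
    complements and countable unions, and induction over the Borel sets applies.\<close>
  have "G \<in> sigma_sets UNIV {S. open S}" using assms by (simp add: borel_def)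
  then show ?thesis
  proof induction
    case (Basic W)
    then have W: "open W" by simp
    have "open {x. (x, 0::real) \<in> W}"
      using open_vimage[OF W, of "\<lambda>x. (x, 0)"] by (simp add: vimage_def continuous_on_Pair continuous_on_id continuous_on_const)
    from zero_part[OF this] pos_part[OF W]
    have "cls ` (({x. (x, 0) \<in> W} \<times> {0}) \<inter> D) \<union> cls ` (W \<inter> D \<inter> {p. 0 < snd p}) \<in> sets (borel_of T)"
      by (rule sets.Un)
    also have "cls ` (({x. (x, 0) \<in> W} \<times> {0}) \<inter> D) \<union> cls ` (W \<inter> D \<inter> {p. 0 < snd p}) = cls ` (W \<inter> D)"
    proof -
      have "({x. (x, 0) \<in> W} \<times> {0}) \<inter> D \<union> W \<inter> D \<inter> {p. 0 < snd p} = W \<inter> D"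
        by (auto simp: D_def less_le)
      then show ?thesis by (simp only: image_Un[symmetric])
    qed
    finally show ?case .
  next
    case Empty
    show ?case by simp
  next
    case (Compl a)
    have "cls ` ((UNIV - a) \<inter> D) = space (borel_of T) - cls ` (a \<inter> D)"
    proof -
      have "(UNIV - a) \<inter> D = D - a \<inter> D" by auto
      then show ?thesis
        by (simp only: space_borel_of topspace_T)
          (rule inj_on_image_set_diff[OF inj_on_cls], auto)
    qed
    with Compl show ?case by (simp only: sets.compl_sets)
  next
    case (Union a)
    have "cls ` ((\<Union>i. a i) \<inter> D) = (\<Union>i. cls ` (a i \<inter> D))" by auto
    with Union show ?case by auto
  qed
qed

lemma cls_vimage_sets:
  assumes "S \<in> sets (borel_of T)"
  shows "{p \<in> D. cls p \<in> S} \<in> sets borel"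
proof -
  have "S \<in> sigma_sets (cls ` D) {U. openin T U}" using assms by (simp add: sets_borel_of topspace_T)
  then show ?thesis
  proof induction
    case (Basic U)
    then obtain W where "open W" "{p \<in> D. cls p \<in> U} = D \<inter> W" using open_sub_D by blast
    then show ?case by (simp add: borel_open)
  next
    case (Compl a)
    have "{p \<in> D. cls p \<in> cls ` D - a} = D - {p \<in> D. cls p \<in> a}" by auto
    with Compl show ?case by auto
  next
    case (Union a)
    have "{p \<in> D. cls p \<in> (\<Union>i. a i)} = (\<Union>i. {p \<in> D. cls p \<in> a i})" by auto
    with Union show ?case by auto
  qed simp
qed

text \<open>A Borel inverse of the quotient map. Invariant measures are pushed through it to the
  product space, where cylinders and intervals generate the Borel sets.\<close>

definition rep :: "((int \<Rightarrow> nat) \<times> real) set \<Rightarrow> (int \<Rightarrow> nat) \<times> real" where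
  "rep = inv_into D cls"

lemma rep_cls [simp]: "p \<in> D \<Longrightarrow> rep (cls p) = p"
  unfolding rep_def by (rule inv_into_f_f[OF inj_on_cls])

lemma rep_measurable: "rep \<in> borel_of T \<rightarrow>\<^sub>M borel"
proof (rule measurableI)
  fix G :: "((int \<Rightarrow> nat) \<times> real) set" assume "G \<in> sets borel"
  moreover have "rep -` G \<inter> space (borel_of T) = cls ` (G \<inter> D)"
    by (auto simp: space_borel_of topspace_T)
  ultimately show "rep -` G \<inter> space (borel_of T) \<in> sets (borel_of T)" by (simp add: cls_image_sets)
qed auto

lemma cls_measurable: "cls \<in> restrict_space borel D \<rightarrow>\<^sub>M borel_of T"
proof (rule measurableI)
  fix S assume "S \<in> sets (borel_of T)"
  moreover have "cls -` S \<inter> space (restrict_space borel D) = {p \<in> D. cls p \<in> S}"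
    by (auto simp: space_restrict_space)
  ultimately show "cls -` S \<inter> space (restrict_space borel D) \<in> sets (restrict_space borel D)"
    by (auto simp: sets_restrict_space_iff cls_vimage_sets)
qed (auto simp: space_restrict_space space_borel_of topspace_T)

lemma B_diff: "n \<le> m \<Longrightarrow> B n x + (m - n) \<le> B m x"
proof (induction m rule: int_ge_induct)
  case (step i)
  then show ?case using ge1[of "shift_iter i x"] by (simp add: birkhoff_sum_add_one)
qed simp

text \<open>If no index fitted, \<open>B n x \<le> t\<close> would pass from n to n + 1 forever,
  against the growth of Birkhoff sums by at least 1 per step.\<close>

lemma ex_index: "\<exists>n. B n x \<le> t \<and> t < B (n + 1) x"
proof (rule ccontr)
  assume "\<not> ?thesis"
  then have idx: "B n x \<le> t \<Longrightarrow> B (n + 1) x \<le> t" for n by force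
  \<comment> \<open>For nonpositive n the sum \<open>B n x\<close> is at most n, so any such n below
    t is a valid start.\<close>
  define n0 where "n0 = min 0 \<lfloor>t\<rfloor>"
  have base: "B n0 x \<le> t" using B_diff[of n0 0 x] by (auto simp: n0_def min_def split: if_splits) linarith+
  have *: "B n x \<le> t" if "n0 \<le> n" for n
    using that
  proof (induction n rule: int_ge_induct)
    case (step i)
    from step.IH show ?case by (rule idx)
  qed (rule base)
  have "max 0 (\<lfloor>t\<rfloor> + 1) \<le> B (max 0 (\<lfloor>t\<rfloor> + 1)) x"
    using B_diff[of 0 "max 0 (\<lfloor>t\<rfloor> + 1)" x] by simp
  also have "\<dots> \<le> t" by (rule *) (auto simp: n0_def)
  finally show False by linarith
qed

lemma B_mono: "n \<le> m \<Longrightarrow> B n x \<le> B m x"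
  using B_diff[of n m x] by linarith

lemma index_unique:
  assumes "B n x \<le> t" "t < B (n + 1) x" "B m x \<le> t" "t < B (m + 1) x"
  shows "n = m"
  using assms B_mono[of "n + 1" m x] B_mono[of "m + 1" n x] by (cases n m rule: linorder_cases) auto

lemma flow_cls:
  assumes "(x, s) \<in> D" "B n x \<le> t + s" "t + s < B (n + 1) x"
  shows "\<phi> t (cls (x, s)) = cls (shift_iter n x, t + s - B n x)"
    and "(shift_iter n x, t + s - B n x) \<in> D"
proof -
  show "\<phi> t (cls (x, s)) = cls (shift_iter n x, t + s - B n x)"
    using assms by (intro susp_flow_eq) (auto simp: pos D_def topspace_full_shift)
  show "(shift_iter n x, t + s - B n x) \<in> D"
    using assms shift_Omega[of x n] by (auto simp: D_def birkhoff_sum_add_one)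
qed

lemma flow_topspace: "y \<in> topspace T \<Longrightarrow> \<phi> t y \<in> topspace T"
proof -
  assume "y \<in> topspace T"
  then obtain x s where xs: "(x, s) \<in> D" "y = cls (x, s)" by (auto simp: topspace_T)
  obtain n where "B n x \<le> t + s" "t + s < B (n + 1) x" using ex_index by blast
  with flow_cls[OF xs(1) this] xs show ?thesis by (simp add: cls_in)
qed

text \<open>Where the number n of returns is fixed, the flow is a shift and a translation. There are
  countably many n, and \<open>cls_image_sets\<close> carries the union back to the
  quotient.\<close>

lemma flow_measurable: "\<phi> t \<in> borel_of T \<rightarrow>\<^sub>M borel_of T"
proof (rule measurableI)
  fix S assume S: "S \<in> sets (borel_of T)"
  define G where "G = {p \<in> D. cls p \<in> S}"
  have [measurable]: "G \<in> sets borel" unfolding G_def by (rule cls_vimage_sets[OF S])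
  define H where "H = (\<Union>n. {p :: (int \<Rightarrow> nat) \<times> real. B n (fst p) \<le> t + snd p \<and> t + snd p < B (n + 1) (fst p) \<and>
    (shift_iter n (fst p), t + snd p - B n (fst p)) \<in> G})"
  have pair: "(\<lambda>p. (shift_iter n (fst p), t + snd p - B n (fst p))) \<in> borel \<rightarrow>\<^sub>M borel" for n :: int
    unfolding borel_prod[symmetric, where ?'b = real] by (rule measurable_Pair) (auto simp: borel_prod)
  have "H \<in> sets borel"
    unfolding H_def
  proof (intro sets.countable_UN'')
    fix n :: int
    have [measurable]: "{p. (shift_iter n (fst p), t + snd p - B n (fst p)) \<in> G} \<in> sets borel"
      using measurable_sets[OF pair[of n], of G] by (simp add: vimage_def)
    show "{p. B n (fst p) \<le> t + snd p \<and> t + snd p < B (n + 1) (fst p) \<and>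
      (shift_iter n (fst p), t + snd p - B n (fst p)) \<in> G} \<in> sets borel"
      by measurable
  qed auto
  then have "cls ` (H \<inter> D) \<in> sets (borel_of T)" by (rule cls_image_sets)
  also have "cls ` (H \<inter> D) = \<phi> t -` S \<inter> space (borel_of T)"
  proof (intro set_eqI iffI)
    fix y assume "y \<in> cls ` (H \<inter> D)"
    then obtain x s n where "(x, s) \<in> D" "y = cls (x, s)" "B n x \<le> t + s" "t + s < B (n + 1) x"
      "(shift_iter n x, t + s - B n x) \<in> G" by (auto simp: H_def)
    then show "y \<in> \<phi> t -` S \<inter> space (borel_of T)"
      using flow_cls(1)[of x s n t] by (auto simp: G_def space_borel_of cls_in)
  next
    fix y assume y: "y \<in> \<phi> t -` S \<inter> space (borel_of T)"
    then obtain x s where xs: "(x, s) \<in> D" "y = cls (x, s)" by (auto simp: space_borel_of topspace_T)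
    obtain n where "B n x \<le> t + s" "t + s < B (n + 1) x" using ex_index by blast
    with flow_cls[OF xs(1) this] xs y have "(x, s) \<in> H" by (auto simp: H_def G_def)
    with xs show "y \<in> cls ` (H \<inter> D)" by auto
  qed
  finally show "\<phi> t -` S \<inter> space (borel_of T) \<in> sets (borel_of T)" .
qed (simp add: space_borel_of flow_topspace)

text \<open>Birkhoff sums are additive along the orbit, so the returns made during j unit steps can
  be counted at once from the starting point.\<close>

lemma flow_1_funpow:
  assumes "(x, s) \<in> D" "B n x \<le> j + s" "j + s < B (n + 1) x"
  shows "(\<phi> 1 ^^ j) (cls (x, s)) = cls (shift_iter n x, j + s - B n x)"
  using assms(2,3)
proof (induction j arbitrary: n)
  case 0
  have "n = 0" by (rule index_unique[of n x s]) (use 0 assms(1) in \<open>auto simp: D_def\<close>)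
  then show ?case by (simp add: shift_iter_0)
next
  case (Suc j)
  obtain m where m: "B m x \<le> j + s" "j + s < B (m + 1) x" using ex_index by blast
  define x' where "x' = shift_iter m x"
  define r where "r = j + s - B m x"
  have *: "(\<phi> 1 ^^ j) (cls (x, s)) = cls (x', r)"
    unfolding x'_def r_def by (rule Suc.IH) (use m in auto)
  have D: "(x', r) \<in> D"
    unfolding x'_def r_def by (rule flow_cls(2)) (use m assms(1) in auto)
  have B: "B k x = B m x + B (k - m) x'" for k
    using birkhoff_sum_add[of \<rho> m "k - m" x] by (simp add: x'_def)
  have "\<phi> 1 (cls (x', r)) = cls (shift_iter (n - m) x', 1 + r - B (n - m) x')"
    by (rule flow_cls(1)[OF D]) (use Suc.prems B[of n] B[of "n + 1"] in \<open>auto simp: r_def algebra_simps\<close>)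
  moreover have "shift_iter (n - m) x' = shift_iter n x"
    by (simp add: x'_def shift_iter_add[symmetric])
  ultimately show ?case using * B[of n] by (simp add: r_def algebra_simps)
qed

end

subsection \<open>The Dyck shift\<close>

text \<open>The letters 0, 1 are two kinds of opening brackets, closed by 2 and 3 respectively.\<close>

abbreviation \<Sigma>\<^sub>4 :: "(int \<Rightarrow> nat) set" where
  "\<Sigma>\<^sub>4 \<equiv> {x. \<forall>i. x i \<in> {0,1,2,3}}"

lemma Sigma4D: "x \<in> \<Sigma>\<^sub>4 \<Longrightarrow> x i \<in> {0,1,2,3}"
  unfolding mem_Collect_eq by (rule spec)

definition step :: "nat \<Rightarrow> int" where
  "step v = (if v < 2 then 1 else - 1)"

definition ht :: "(int \<Rightarrow> nat) \<Rightarrow> int \<Rightarrow> int \<Rightarrow> int" where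
  "ht x i j = (\<Sum>k\<in>{i..<j}. step (x k))"

text \<open>The partner of an opening bracket is the first place where the height falls back to its
  value before it. Only steps enter, never kinds, so recolouring brackets keeps the
  matching.\<close>

definition matched :: "(int \<Rightarrow> nat) \<Rightarrow> int \<Rightarrow> int \<Rightarrow> bool" where
  "matched x p q \<longleftrightarrow> p < q \<and> ht x p (q + 1) = 0 \<and> (\<forall>r. p < r \<and> r \<le> q \<longrightarrow> 0 < ht x p r)"

definition legal :: "(int \<Rightarrow> nat) \<Rightarrow> int \<Rightarrow> int \<Rightarrow> bool" where
  "legal x i j \<longleftrightarrow> (\<forall>p q. i \<le> p \<and> q < j \<and> matched x p q \<longrightarrow> x q = x p + 2)"

definition dyck :: "(int \<Rightarrow> nat) set" where
  "dyck = {x \<in> \<Sigma>\<^sub>4. \<forall>p q. matched x p q \<longrightarrow> x q = x p + 2}"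

lemma ht_add: "i \<le> j \<Longrightarrow> j \<le> k \<Longrightarrow> ht x i k = ht x i j + ht x j k"
proof -
  assume "i \<le> j" "j \<le> k"
  then have "{i..<k} = {i..<j} \<union> {j..<k}" by auto
  then show ?thesis unfolding ht_def by (simp only:) (rule sum.union_disjoint, auto)
qed

lemma ht_self [simp]: "ht x i i = 0"
  by (simp add: ht_def)

lemma ht_one [simp]: "ht x i (i + 1) = step (x i)"
proof -
  have "{i..<i + 1} = {i}" by auto
  then show ?thesis by (simp add: ht_def)
qed

lemma step_cases: "step v = 1 \<or> step v = - 1"
  by (simp add: step_def)

lemma ht_cong: "(\<And>k. i \<le> k \<Longrightarrow> k < j \<Longrightarrow> step (x k) = step (y k)) \<Longrightarrow> ht x i j = ht y i j"
  unfolding ht_def by (intro sum.cong) auto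

lemma matched_cong:
  assumes "\<And>k. p \<le> k \<Longrightarrow> k \<le> q \<Longrightarrow> step (x k) = step (y k)"
  shows "matched x p q \<longleftrightarrow> matched y p q"
proof -
  have "ht x p r = ht y p r" if "r \<le> q + 1" for r
    using that assms by (intro ht_cong) auto
  then show ?thesis by (auto simp: matched_def)
qed

lemma ht_shift: "ht (shift_iter t x) i j = ht x (i + t) (j + t)"
proof -
  have "bij_betw (\<lambda>k. k + t) {i..<j} {i + t..<j + t}"
    by (rule bij_betwI[of _ _ _ "\<lambda>k. k - t"]) auto
  then show ?thesis
    unfolding ht_def shift_iter_def by (rule sum.reindex_bij_betw)
qed

lemma matched_shift: "matched (shift_iter t x) p q \<longleftrightarrow> matched x (p + t) (q + t)"
proof -
  have "(\<forall>r. p < r \<and> r \<le> q \<longrightarrow> 0 < ht x (p + t) (r + t)) \<longleftrightarrow>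
      (\<forall>r. p + t < r \<and> r \<le> q + t \<longrightarrow> 0 < ht x (p + t) r)" (is "?l \<longleftrightarrow> ?r")
  proof
    assume l: ?l
    show ?r
    proof (intro allI impI)
      fix r assume "p + t < r \<and> r \<le> q + t"
      then show "0 < ht x (p + t) r" using l[rule_format, of "r - t"] by simp
    qed
  qed auto
  then show ?thesis by (simp add: matched_def ht_shift add_ac)
qed

lemma legal_shift: "legal (shift_iter t x) i j \<longleftrightarrow> legal x (i + t) (j + t)"
proof -
  have "legal (shift_iter t x) i j \<longleftrightarrow>
      (\<forall>p q. i \<le> p \<and> q < j \<and> matched x (p + t) (q + t) \<longrightarrow> x (q + t) = x (p + t) + 2)"
    unfolding legal_def matched_shift by (simp only: shift_iter_def)
  also have "\<dots> \<longleftrightarrow> legal x (i + t) (j + t)" (is "?l \<longleftrightarrow> _")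
    unfolding legal_def
  proof
    assume l: ?l
    show "\<forall>p q. i + t \<le> p \<and> q < j + t \<and> matched x p q \<longrightarrow> x q = x p + 2"
    proof (intro allI impI)
      fix p q assume "i + t \<le> p \<and> q < j + t \<and> matched x p q"
      then show "x q = x p + 2" using l[rule_format, of "p - t" "q - t"] by simp
    qed
  next
    assume r: "\<forall>p q. i + t \<le> p \<and> q < j + t \<and> matched x p q \<longrightarrow> x q = x p + 2"
    show ?l
    proof (intro allI impI)
      fix p q assume "i \<le> p \<and> q < j \<and> matched x (p + t) (q + t)"
      then show "x (q + t) = x (p + t) + 2" using r[rule_format, of "p + t" "q + t"] by simp
    qed
  qed
  finally show ?thesis .
qed

lemma legal_cong:
  assumes "\<And>k. i \<le> k \<Longrightarrow> k < j \<Longrightarrow> x k = y k"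
  shows "legal x i j \<longleftrightarrow> legal y i j"
proof -
  have "matched x p q \<longleftrightarrow> matched y p q" if "i \<le> p" "q < j" for p q
    using that assms by (intro matched_cong) auto
  moreover have "p < q" if "matched z p q" for z p q using that by (simp add: matched_def)
  ultimately have "i \<le> p \<and> q < j \<and> matched x p q \<longrightarrow> (x q = x p + 2 \<longleftrightarrow> y q = y p + 2) \<and> matched y p q"
    "i \<le> p \<and> q < j \<and> matched y p q \<longrightarrow> matched x p q" for p q
    using assms[of p] assms[of q] by (metis less_trans less_le_trans order.strict_implies_order le_less_trans)+
  then show ?thesis unfolding legal_def by blast
qed

lemma legal_mono: "legal x i j \<Longrightarrow> i \<le> i' \<Longrightarrow> j' \<le> j \<Longrightarrow> legal x i' j'"
  unfolding legal_def by (metis order_trans less_le_trans)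

text \<open>Heights change by 1, so at the first place where the height is at most 0 it equals
  0.\<close>

lemma ex_match_right:
  assumes "step (x p) = 1" "p < k" "ht x p k \<le> 0"
  shows "\<exists>q<k. matched x p q"
proof -
  define P where "P n \<longleftrightarrow> ht x p (p + 1 + int n) \<le> 0" for n :: nat
  have ex: "P (nat (k - p - 1))" using assms by (simp add: P_def)
  define n where "n = (LEAST n. P n)"
  have n: "P n" "\<And>m. m < n \<Longrightarrow> \<not> P m" "n \<le> nat (k - p - 1)"
    unfolding n_def by (rule LeastI[of P, OF ex], erule not_less_Least, rule Least_le[of P, OF ex])
  have n0: "n \<noteq> 0" using n(1) assms(1) by (cases n) (auto simp: P_def)
  have r: "0 < ht x p r" if "p < r" "r \<le> p + int n" for r
  proof -
    have "nat (r - p - 1) < n" using that by linarith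
    then show ?thesis using n(2)[of "nat (r - p - 1)"] that by (simp add: P_def)
  qed
  have "ht x p (p + int n + 1) = ht x p (p + int n) + step (x (p + int n))"
    using ht_add[of p "p + int n" "p + int n + 1" x] by simp
  then have "ht x p (p + int n + 1) = 0"
    using r[of "p + int n"] n0 n(1) step_cases[of "x (p + int n)"] by (auto simp: P_def add_ac)
  then have "matched x p (p + int n)" using n0 r by (simp add: matched_def)
  moreover have "p + int n < k" using n(3) assms(2) by linarith
  ultimately show ?thesis by blast
qed

lemma ex_match_left:
  assumes "step (x q) = - 1" "k \<le> q" "0 \<le> ht x k (q + 1)"
  shows "\<exists>p\<ge>k. matched x p q"
proof -
  define P where "P n \<longleftrightarrow> 0 \<le> ht x (q - int n) (q + 1)" for n :: nat
  have ex: "P (nat (q - k))" using assms by (simp add: P_def)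
  define n where "n = (LEAST n. P n)"
  have n: "P n" "\<And>m. m < n \<Longrightarrow> \<not> P m" "n \<le> nat (q - k)"
    unfolding n_def by (rule LeastI[of P, OF ex], erule not_less_Least, rule Least_le[of P, OF ex])
  have n0: "n \<noteq> 0" using n(1) assms(1) by (cases n) (auto simp: P_def)
  define p where "p = q - int n"
  have r: "ht x r (q + 1) < 0" if "p < r" "r \<le> q" for r
  proof -
    have "nat (q - r) < n" using that by (simp add: p_def)
    then show ?thesis using n(2)[of "nat (q - r)"] that by (simp add: P_def)
  qed
  have "ht x p (q + 1) = step (x p) + ht x (p + 1) (q + 1)"
    using ht_add[of p "p + 1" "q + 1" x] n0 by (simp add: p_def)
  then have z: "ht x p (q + 1) = 0"
    using r[of "p + 1"] n0 n(1) step_cases[of "x p"] by (auto simp: P_def p_def)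
  have "0 < ht x p s" if "p < s" "s \<le> q" for s
    using ht_add[of p s "q + 1" x] r[of s] z that by simp
  then have "matched x p q" using n0 z by (simp add: matched_def p_def)
  moreover have "k \<le> p" using n(3) assms(2) by (simp add: p_def)
  ultimately show ?thesis by blast
qed

lemma matched_step: "matched x p q \<Longrightarrow> step (x p) = 1" "matched x p q \<Longrightarrow> step (x q) = - 1"
proof -
  assume m: "matched x p q"
  have "0 < ht x p (p + 1)" using m by (simp add: matched_def del: ht_one)
  then show "step (x p) = 1" using step_cases[of "x p"] by simp
  have "ht x p (q + 1) = ht x p q + step (x q)" using m ht_add[of p q "q + 1" x] by (simp add: matched_def)
  moreover have "0 < ht x p q" "ht x p (q + 1) = 0" using m by (auto simp: matched_def)
  ultimately show "step (x q) = - 1" using step_cases[of "x q"] by simp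
qed

text \<open>Two openings with the same partner would have height difference 0, while the height
  above the earlier one has to stay positive up to the partner.\<close>

lemma matched_unique: "matched x p q \<Longrightarrow> matched x p' q \<Longrightarrow> p = p'"
proof (rule ccontr)
  have *: False if "matched x p q" "matched x p' q" "p < p'" for p p'
    using that ht_add[of p p' "q + 1" x] by (auto simp: matched_def)
  assume "matched x p q" "matched x p' q" "p \<noteq> p'"
  then show False using *[of p p'] *[of p' p] by linarith
qed

section \<open>Counting legal words\<close>

definition wd :: "(int \<Rightarrow> nat) \<Rightarrow> int \<Rightarrow> nat \<Rightarrow> nat list" where
  "wd x i n = map (\<lambda>j. x (i + int j)) [0..<n]"

lemma length_wd [simp]: "length (wd x i n) = n"
  by (simp add: wd_def)

lemma nth_wd [simp]: "j < n \<Longrightarrow> wd x i n ! j = x (i + int j)"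
  by (simp add: wd_def)

lemma wd_eq_iff: "wd x i n = wd y i n \<longleftrightarrow> (\<forall>k. i \<le> k \<and> k < i + int n \<longrightarrow> x k = y k)"
proof
  assume eq: "wd x i n = wd y i n"
  show "\<forall>k. i \<le> k \<and> k < i + int n \<longrightarrow> x k = y k"
  proof (intro allI impI)
    fix k assume "i \<le> k \<and> k < i + int n"
    then show "x k = y k"
      using arg_cong[OF eq, of "\<lambda>l. l ! nat (k - i)"] nth_wd[of "nat (k - i)" n] by (simp add: nat_less_iff)
  qed
qed (auto simp: wd_def)

lemma wd_append: "wd x i (m + n) = wd x i m @ wd x (i + int m) n"
  by (rule nth_equalityI) (auto simp: nth_append)

lemma wd_in: "x \<in> \<Sigma>\<^sub>4 \<Longrightarrow> wd x i n \<in> {l. set l \<subseteq> {0,1,2,3} \<and> length l = n}"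
proof -
  assume x: "x \<in> \<Sigma>\<^sub>4"
  have "set (wd x i n) \<subseteq> {0,1,2,3}"
    unfolding wd_def set_map by (rule image_subsetI) (rule Sigma4D[OF x])
  then show ?thesis by simp
qed

definition legal_words :: "nat \<Rightarrow> nat list set" where
  "legal_words n = {wd x 0 n | x. x \<in> \<Sigma>\<^sub>4 \<and> legal x 0 (int n)}"

text \<open>On \<open>S\<close> the map \<open>f\<close> factors through \<open>g\<close>. In this
  way codes bound the number of legal words and of label names.\<close>

lemma card_image_le_of_determines:
  assumes "finite (g ` S)" "\<And>x y. x \<in> S \<Longrightarrow> y \<in> S \<Longrightarrow> g x = g y \<Longrightarrow> f x = f y"
  shows "finite (f ` S)" "card (f ` S) \<le> card (g ` S)"
proof -
  have "f ` S \<subseteq> (\<lambda>c. f (SOME x. x \<in> S \<and> g x = c)) ` g ` S"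
  proof
    fix y assume "y \<in> f ` S"
    then obtain x where x: "x \<in> S" "y = f x" by auto
    let ?z = "SOME z. z \<in> S \<and> g z = g x"
    have "?z \<in> S \<and> g ?z = g x" by (rule someI[of _ x]) (use x in auto)
    then have "f ?z = f x" using assms(2) x by blast
    with x show "y \<in> (\<lambda>c. f (SOME x. x \<in> S \<and> g x = c)) ` g ` S" by (intro image_eqI[of _ _ "g x"]) auto
  qed
  from this assms(1) show "finite (f ` S)"
    by (rule finite_subset[OF _ finite_imageI])
  from assms(1) \<open>f ` S \<subseteq> _\<close> show "card (f ` S) \<le> card (g ` S)"
    by (rule surj_card_le)
qed

text \<open>A legal word is cut where its height is minimal. Every opening bracket to the left of the
  cut and every closing bracket to the right of it has its partner on the same side, so its kind
  can be dropped.\<close>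

lemma card_legal_words: "finite (legal_words n)" "card (legal_words n) \<le> (n + 1) * 3 ^ n"
proof -
  define S where "S = {x \<in> \<Sigma>\<^sub>4. legal x 0 (int n)}"
  define k where "k x = arg_min (\<lambda>k. ht x 0 (int k)) (\<lambda>k. k \<le> n)" for x
  have k: "k x \<le> n" "\<And>j. j \<le> n \<Longrightarrow> ht x 0 (int (k x)) \<le> ht x 0 (int j)" for x
  proof -
    obtain k0 where k0: "k0 \<in> {..n}" "\<And>j. j \<in> {..n} \<Longrightarrow> ht x 0 (int k0) \<le> ht x 0 (int j)"
      using ex_is_arg_min_if_finite[of "{..n}" "\<lambda>k. ht x 0 (int k)"]
      by (auto simp: is_arg_min_def not_less)
    have "is_arg_min (\<lambda>k. ht x 0 (int k)) (\<lambda>k. k \<le> n) (k x)"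
      unfolding k_def arg_min_def
      by (rule someI[of _ k0]) (use k0 in \<open>auto simp: is_arg_min_def not_less\<close>)
    then show "k x \<le> n" "\<And>j. j \<le> n \<Longrightarrow> ht x 0 (int (k x)) \<le> ht x 0 (int j)"
      by (auto simp: is_arg_min_def not_less)
  qed
  \<comment> \<open>Truncated subtraction sends 0 and 1 to 0 and so forgets the kind of openings;
    \<open>min 2\<close> forgets the kind of closings. Either way three symbols remain, and the
    factor n + 1 in the count is the choice of the cut.\<close>
  define col where "col x j = (if j < k x then x (int j) - 1 else min 2 (x (int j)))" for x j
  define g where "g x = (k x, map (col x) [0..<n])" for x
  have col_lt: "col x j \<in> {0,1,2}" if "x \<in> \<Sigma>\<^sub>4" for x j
  proof -
    have "x (int j) \<in> {0,1,2,3}" using that by blast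
    then show ?thesis by (auto simp: col_def)
  qed
  have "g ` S \<subseteq> {..n} \<times> {l. set l \<subseteq> {0,1,2} \<and> length l = n}"
  proof
    fix c assume "c \<in> g ` S"
    then obtain x where x: "x \<in> S" "c = g x" by auto
    then have "x \<in> \<Sigma>\<^sub>4" by (simp add: S_def)
    then have "set (map (col x) [0..<n]) \<subseteq> {0,1,2}"
      unfolding set_map by (intro image_subsetI col_lt)
    with k(1) x show "c \<in> {..n} \<times> {l. set l \<subseteq> {0,1,2} \<and> length l = n}" by (simp add: g_def)
  qed
  then have gS: "finite (g ` S)" "card (g ` S) \<le> (n + 1) * 3 ^ n"
    using finite_subset[of "g ` S"] card_mono[of "{..n} \<times> {l. set l \<subseteq> {0,1,2} \<and> length l = n}" "g ` S"]
      card_lists_length_eq[of "{0,1,2::nat}" n] finite_lists_length_eq[of "{0,1,2::nat}" n]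
    by (auto simp: card_cartesian_product numeral_3_eq_3)
  have det: "wd x 0 n = wd y 0 n" if xy: "x \<in> S" "y \<in> S" "g x = g y" for x y
  proof -
    define m where "m = int (k x)"
    have km: "m \<le> int n" "0 \<le> m" and ky: "int (k y) = m"
      using k(1)[of x] xy(3) by (auto simp: g_def m_def)
    have col: "col x j = col y j" if "j < n" for j
      using that xy(3) by (auto simp: g_def)
    have vals: "x i \<in> {0,1,2,3}" "y i \<in> {0,1,2,3}" for i
      using xy unfolding S_def by blast+
    have left: "x i - 1 = y i - 1" if "0 \<le> i" "i < m" for i
      using col[of "nat i"] that km ky by (auto simp: col_def m_def nat_less_iff)
    have right: "min 2 (x i) = min 2 (y i)" if "m \<le> i" "i < int n" for i
      using col[of "nat i"] that km ky by (auto simp: col_def m_def nat_less_iff le_nat_iff not_less[symmetric])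
    have st: "step (x i) = step (y i)" if "0 \<le> i" "i < int n" for i
    proof (cases "i < m")
      case True
      with left[of i] that vals[of i] show ?thesis by (auto simp: step_def)
    next
      case False
      with right[of i] that vals[of i] show ?thesis by (auto simp: step_def)
    qed
    have mat: "matched x p q \<longleftrightarrow> matched y p q" if "0 \<le> p" "q < int n" for p q
      using that by (intro matched_cong st) auto
    have leg: "x q = x p + 2" "y q = y p + 2" if "0 \<le> p" "q < int n" "matched x p q" for p q
      using that xy mat[of p q] by (auto simp: S_def legal_def)
    have "x i = y i" if i: "0 \<le> i" "i < int n" for i
    proof (cases "i < m")
      case True
      show ?thesis
      proof (cases "step (x i) = 1")
        case open_i: True
        have "nat i \<le> n" using i(2) by linarith
        \<comment> \<open>The cut is no higher than position i, so an opening bracket at i has to be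
          closed before the cut.\<close>
        from k(2)[OF this, of x] have "ht x 0 m \<le> ht x 0 i" unfolding m_def int_nat_eq using i(1) by simp
        then have "ht x i m \<le> 0" using ht_add[of 0 i m x] i(1) True by linarith
        from ex_match_right[where x = x, OF open_i True this]
        obtain q where q: "q < m" "matched x i q" by auto
        then have "i < q" by (simp add: matched_def)
        have qn: "q < int n" using q(1) km(1) by linarith
        have "x q = x i + 2" "y q = y i + 2" using leg[OF i(1) qn q(2)] .
        moreover have "x q - 1 = y q - 1" using left[of q] i(1) \<open>i < q\<close> q(1) by linarith
        ultimately show ?thesis by linarith
      next
        case False
        then have "2 \<le> x i" "2 \<le> y i" using st[OF i] by (auto simp: step_def split: if_splits)
        moreover have "x i - 1 = y i - 1" using left[OF i(1) True] .
        ultimately show ?thesis by linarith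
      qed
    next
      case False
      show ?thesis
      proof (cases "step (x i) = 1")
        case True
        then have "x i < 2" "y i < 2" using st[OF i] by (auto simp: step_def split: if_splits)
        moreover have "min 2 (x i) = min 2 (y i)" using right[of i] False i(2) by linarith
        ultimately show ?thesis by linarith
      next
        case close_i: False
        have "nat (i + 1) \<le> n" using i(2) by linarith
        from k(2)[OF this, of x] have "ht x 0 m \<le> ht x 0 (i + 1)"
          unfolding m_def int_nat_eq using i(1) by simp
        then have "0 \<le> ht x m (i + 1)" using ht_add[of 0 m "i + 1" x] False km by linarith
        moreover have "step (x i) = - 1" "m \<le> i" using close_i step_cases[of "x i"] False by auto
        ultimately obtain p where p: "m \<le> p" "matched x p i"
          using ex_match_left[where x = x and k = m and q = i] by auto
        then have pi: "p < i" by (simp add: matched_def)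
        have p0: "0 \<le> p" using p(1) km(2) by linarith
        have "step (x p) = 1" "step (y p) = 1"
          using matched_step(1)[OF p(2)] matched_step(1)[of y p i] mat[OF p0 i(2)] p(2) by blast+
        then have "x p < 2" "y p < 2" by (auto simp: step_def split: if_splits)
        moreover have "min 2 (x p) = min 2 (y p)" using right[of p] p(1) pi i(2) by linarith
        ultimately have "x p = y p" by linarith
        then show ?thesis using leg[OF p0 i(2) p(2)] by simp
      qed
    qed
    then show ?thesis unfolding wd_eq_iff add_0 by (intro allI impI) (elim conjE)
  qed
  have eq: "legal_words n = (\<lambda>x. wd x 0 n) ` S" unfolding legal_words_def S_def by blast
  note le = card_image_le_of_determines[of g S "\<lambda>x. wd x 0 n", OF gS(1) det]
  show "finite (legal_words n)" unfolding eq by (rule le(1))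
  show "card (legal_words n) \<le> (n + 1) * 3 ^ n"
    unfolding eq by (rule order_trans[OF le(2) gS(2)])
qed

subsection \<open>The roof function\<close>

text \<open>The factorial of \<open>kap d\<close> is the largest factorial not exceeding sqrt (d +
  1).\<close>

definition kap :: "nat \<Rightarrow> nat" where
  "kap d = Max {k. fact k ^ 2 \<le> d + 1}"

text \<open>The constant makes L * pen L at least 12 sqrt L: a factor 2 is lost in sqrt (L + 1)
  \<le> 2 sqrt L, and 12 is the exponent that \<open>exp_penalty\<close> uses. Factorials serve as
  denominators because they divide one another.\<close>

definition pen :: "nat \<Rightarrow> real" where
  "pen d = 24 / fact (kap d)"

lemma kap_set: "finite {k. fact k ^ 2 \<le> d + (1::nat)}" "0 \<in> {k. fact k ^ 2 \<le> d + (1::nat)}"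
proof -
  have sub: "k \<in> {..d + 1}" if "fact k ^ 2 \<le> d + (1::nat)" for k
  proof -
    have "k \<le> fact k" by (rule fact_ge_self)
    also have "\<dots> \<le> (fact k ^ 2 :: nat)" by (rule self_le_power) (simp_all add: fact_ge_1)
    finally have "k \<le> d + 1" using that by (rule order_trans)
    then show ?thesis unfolding atMost_iff .
  qed
  show "finite {k. fact k ^ 2 \<le> d + (1::nat)}"
  proof (rule finite_subset)
    show "{k. fact k ^ 2 \<le> d + (1::nat)} \<subseteq> {..d + 1}" by (rule subsetI) (rule sub, erule CollectD)
  qed (rule finite_atMost)
qed simp

lemma fact_kap: "fact (kap d) ^ 2 \<le> d + (1::nat)"
  using Max_in[OF kap_set(1)] kap_set(2) unfolding kap_def by blast

lemma kap_ge: "fact k ^ 2 \<le> d + (1::nat) \<Longrightarrow> k \<le> kap d"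
  unfolding kap_def by (intro Max_ge kap_set(1)) simp

lemma kap_mono: "d \<le> d' \<Longrightarrow> kap d \<le> kap d'"
  using fact_kap[of d] by (intro kap_ge) linarith

lemma pen_pos: "0 < pen d"
  by (simp add: pen_def)

lemma pen_le: "pen d \<le> 24"
  by (simp add: pen_def field_simps fact_ge_1)

lemma pen_antimono: "d \<le> d' \<Longrightarrow> pen d' \<le> pen d"
  unfolding pen_def by (intro divide_left_mono fact_mono kap_mono) auto

text \<open>Here \<open>kap d \<le> k\<close>, and \<open>fact (kap d)\<close> divides
  \<open>fact k\<close>. Together with \<open>pen_small\<close>: a penalty is either on the grid of
  width 1 / k! or at most 24 / (k + 1) grid cells.\<close>

lemma pen_grid:
  assumes "d + 1 < (fact (k + 1))\<^sup>2"
  shows "\<exists>z::int. pen d = z / fact k"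
proof -
  have "kap d < k + 1"
  proof (rule ccontr)
    assume "\<not> kap d < k + 1"
    then have "(fact (k + 1) :: nat) \<le> fact (kap d)" by (intro fact_mono) auto
    then have "(fact (k + 1) :: nat) ^ 2 \<le> fact (kap d) ^ 2" by (rule power_mono) simp
    with fact_kap[of d] assms show False by linarith
  qed
  then have "(fact (kap d) :: nat) dvd fact k" by (intro fact_dvd) simp
  then obtain c :: nat where "fact k = fact (kap d) * c" by (elim dvdE)
  then have c: "(fact k :: real) = fact (kap d) * c" by (metis of_nat_fact of_nat_mult)
  have "pen d = of_int (24 * int c) / fact k"
    using fact_nonzero[of k, where ?'a = real] unfolding pen_def c by (simp add: field_simps)
  then show ?thesis by blast
qed

lemma pen_small:
  assumes "(fact (k + 1))\<^sup>2 \<le> d + 1"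
  shows "pen d \<le> 24 / fact (k + 1)"
  unfolding pen_def using kap_ge[OF assms] by (intro divide_left_mono fact_mono) auto

text \<open>Of the three powers of L, one absorbs the polynomial factor in the count of legal words
  and two make the sum over L converge, see \<open>card_cheap_words\<close>. With y = sqrt L the
  exponent is at least 12 y, and 3^(2 y) dominates 2 y.\<close>

lemma exp_penalty:
  assumes L: "1 \<le> L"
  shows "64 * real L ^ 3 \<le> 3 powr (L * pen L)"
proof -
  define y where "y = sqrt L"
  have y: "1 \<le> y" using L by (simp add: y_def)
  have sq: "y\<^sup>2 = L" by (simp add: y_def)
  have ln3: "1 \<le> ln (3::real)"
    using exp_le by (subst ln_ge_iff) auto
  have "1 + y \<le> 1 + y * ln 3" using y ln3 by simp
  also have "\<dots> \<le> exp (y * ln 3)" by (rule exp_ge_add_one_self)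
  also have "\<dots> = 3 powr y" by (simp add: powr_def)
  finally have "(1 + y) ^ 2 \<le> (3 powr y) ^ 2" using y by (intro power_mono) auto
  moreover have "2 * y \<le> (1 + y) ^ 2" using zero_le_power2[of y] unfolding power2_sum by simp
  ultimately have "2 * y \<le> (3 powr y) ^ 2" by linarith
  then have "(2 * y) ^ 6 \<le> ((3 powr y) ^ 2) ^ 6" using y by (intro power_mono) auto
  also have "\<dots> = (3 powr y) ^ 12" by (simp only: power_mult[symmetric]) simp
  also have "\<dots> = (3 powr y) powr 12" by (rule powr_numeral[symmetric]) simp
  also have "\<dots> = 3 powr (12 * y)" by (simp only: powr_powr mult.commute)
  also have "\<dots> \<le> 3 powr (L * pen L)"
  proof (intro powr_mono)
    have "real ((fact (kap L))\<^sup>2) \<le> real (L + 1)" using fact_kap[of L] by (simp only: of_nat_le_iff)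
    then have "(fact (kap L))\<^sup>2 \<le> real L + 1" by simp
    also have "\<dots> \<le> (2 * y)\<^sup>2" unfolding power_mult_distrib sq using L by simp
    finally have "fact (kap L) \<le> 2 * y" by (rule power2_le_imp_le) (use y in simp)
    then have "24 / (2 * y) \<le> pen L" unfolding pen_def by (intro divide_left_mono) (use y in auto)
    then have "L * (24 / (2 * y)) \<le> L * pen L" by (intro mult_left_mono) auto
    moreover have "L * (24 / (2 * y)) = 12 * y"
      unfolding sq[symmetric] power2_eq_square using y by simp
    ultimately show "12 * y \<le> L * pen L" by simp
  qed simp
  also have "(2 * y) ^ 6 = 64 * (y\<^sup>2) ^ 3"
    by (simp only: power_mult_distrib power_mult[symmetric]) simp
  finally show ?thesis by (simp add: sq)
qed

text \<open>\<open>defect m\<close> is the part of the roof that is visible in the window \<open>[- m, m]\<close>.\<close>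

definition defect :: "nat \<Rightarrow> (int \<Rightarrow> nat) \<Rightarrow> real" where
  "defect m x = (if \<exists>n\<le>m. \<not> legal x (- int n) (int n + 1)
     then pen (LEAST n. \<not> legal x (- int n) (int n + 1)) else 0)"

definition excess :: "(int \<Rightarrow> nat) \<Rightarrow> real" where
  "excess x = (if \<exists>n. \<not> legal x (- int n) (int n + 1)
     then pen (LEAST n. \<not> legal x (- int n) (int n + 1)) else 0)"

definition roof :: "(int \<Rightarrow> nat) \<Rightarrow> real" where
  "roof x = 1 + excess x"

lemma excess_ge0: "0 \<le> excess x" and excess_le: "excess x \<le> 24"
  using less_imp_le[OF pen_pos] pen_le by (auto simp: excess_def)

lemma excess_dyck: "x \<in> dyck \<Longrightarrow> excess x = 0"
proof -
  assume "x \<in> dyck"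
  then have "legal x i j" for i j unfolding dyck_def legal_def by blast
  then show ?thesis unfolding excess_def by simp
qed

lemma excess_ge:
  assumes "\<not> legal x i j" "- int d \<le> i" "j \<le> int d + 1"
  shows "pen d \<le> excess x"
proof -
  have *: "\<not> legal x (- int d) (int d + 1)" using assms legal_mono by blast
  then have "(LEAST n. \<not> legal x (- int n) (int n + 1)) \<le> d" by (rule Least_le)
  then have "pen d \<le> pen (LEAST n. \<not> legal x (- int n) (int n + 1))" by (rule pen_antimono)
  also have "\<dots> = excess x" unfolding excess_def using * by (intro if_P[symmetric] exI)
  finally show ?thesis .
qed

lemma legal_window_cong:
  assumes "\<And>i. - int m \<le> i \<Longrightarrow> i \<le> int m \<Longrightarrow> x i = y i" "n \<le> m"
  shows "legal x (- int n) (int n + 1) \<longleftrightarrow> legal y (- int n) (int n + 1)"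
  using assms by (intro legal_cong) auto

lemma defect_cong:
  assumes "\<And>i. - int m \<le> i \<Longrightarrow> i \<le> int m \<Longrightarrow> x i = y i"
  shows "defect m x = defect m y"
proof (cases "\<exists>n\<le>m. \<not> legal x (- int n) (int n + 1)")
  case True
  then obtain n0 where n0: "n0 \<le> m" "\<not> legal x (- int n0) (int n0 + 1)" by blast
  let ?l = "\<lambda>z. LEAST n. \<not> legal z (- int n) (int n + 1)"
  have eq: "legal x (- int n) (int n + 1) \<longleftrightarrow> legal y (- int n) (int n + 1)" if "n \<le> m" for n
    using assms that by (rule legal_window_cong)
  have n0': "\<not> legal y (- int n0) (int n0 + 1)" using n0 eq by blast
  have "?l x \<le> n0" "?l y \<le> n0" using n0(2) n0' by (auto intro: Least_le)
  have "\<not> legal x (- int (?l x)) (int (?l x) + 1)" by (rule LeastI) (rule n0(2))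
  then have "?l y \<le> ?l x" using eq[of "?l x"] \<open>?l x \<le> n0\<close> n0(1) by (intro Least_le) simp
  moreover have "\<not> legal y (- int (?l y)) (int (?l y) + 1)" by (rule LeastI) (rule n0')
  then have "?l x \<le> ?l y" using eq[of "?l y"] \<open>?l y \<le> n0\<close> n0(1) by (intro Least_le) simp
  ultimately have l: "?l x = ?l y" by (rule order_antisym[rotated])
  have F: "(\<exists>n\<le>m. \<not> legal y (- int n) (int n + 1))" using n0(1) n0' by blast
  show ?thesis unfolding defect_def if_P[OF True] if_P[OF F] l ..
next
  case False
  have eq: "legal x (- int n) (int n + 1) \<longleftrightarrow> legal y (- int n) (int n + 1)" if "n \<le> m" for n
    using assms that by (rule legal_window_cong)
  have F: "\<not> (\<exists>n\<le>m. \<not> legal y (- int n) (int n + 1))" using False eq by blast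
  show ?thesis unfolding defect_def if_not_P[OF False] if_not_P[OF F] ..
qed

text \<open>The two functions differ only when the smallest illegal window has radius above
  \<open>m\<close>; then the whole excess is hidden, and it is small.\<close>

lemma excess_diff:
  shows "0 \<le> excess x - defect m x" "excess x - defect m x \<le> pen (Suc m)"
proof -
  let ?l = "LEAST n. \<not> legal x (- int n) (int n + 1)"
  consider "\<exists>n\<le>m. \<not> legal x (- int n) (int n + 1)"
    | "\<not> (\<exists>n\<le>m. \<not> legal x (- int n) (int n + 1))" "\<exists>n. \<not> legal x (- int n) (int n + 1)"
    | "\<not> (\<exists>n. \<not> legal x (- int n) (int n + 1))" by blast
  then have "0 \<le> excess x - defect m x \<and> excess x - defect m x \<le> pen (Suc m)"
  proof cases
    case 1
    then have "\<exists>n. \<not> legal x (- int n) (int n + 1)" by blast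
    then have "excess x = defect m x" unfolding excess_def defect_def if_P[OF 1] by (rule if_P)
    then show ?thesis using pen_pos[of "Suc m"] by simp
  next
    case 2
    have "\<not> legal x (- int ?l) (int ?l + 1)" using 2(2) by (rule LeastI_ex)
    then have "\<not> ?l \<le> m" using 2(1) by blast
    then have "Suc m \<le> ?l" by (simp only: not_less_eq_eq)
    then have "pen ?l \<le> pen (Suc m)" by (rule pen_antimono)
    moreover have "excess x = pen ?l" unfolding excess_def if_P[OF 2(2)] ..
    moreover have "defect m x = 0" unfolding defect_def if_not_P[OF 2(1)] ..
    ultimately show ?thesis using pen_pos[of ?l] by simp
  next
    case 3
    have "excess x = 0" unfolding excess_def if_not_P[OF 3] ..
    moreover have "\<not> (\<exists>n\<le>m. \<not> legal x (- int n) (int n + 1))" using 3 by blast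
    then have "defect m x = 0" unfolding defect_def by (rule if_not_P)
    ultimately show ?thesis using pen_pos[of "Suc m"] by simp
  qed
  then show "0 \<le> excess x - defect m x" "excess x - defect m x \<le> pen (Suc m)" by (rule conjunct1, rule conjunct2)
qed

lemma defect_grid: "\<exists>z::int. defect ((fact (k + 1))\<^sup>2 - 2) x = z / fact k"
proof (cases "\<exists>n\<le>(fact (k + 1))\<^sup>2 - 2. \<not> legal x (- int n) (int n + 1)")
  case False
  have "defect ((fact (k + 1))\<^sup>2 - 2) x = of_int 0 / fact k"
    unfolding defect_def if_not_P[OF False] by simp
  then show ?thesis by blast
next
  case True
  then obtain n where n: "n \<le> (fact (k + 1))\<^sup>2 - 2" "\<not> legal x (- int n) (int n + 1)" by blast
  let ?l = "LEAST n. \<not> legal x (- int n) (int n + 1)"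
  have l: "?l \<le> (fact (k + 1))\<^sup>2 - 2" using Least_le[of "\<lambda>n. \<not> legal x (- int n) (int n + 1)", OF n(2)] n(1) by linarith
  have eq: "defect ((fact (k + 1))\<^sup>2 - 2) x = pen ?l" unfolding defect_def if_P[OF True] ..
  show ?thesis
  proof (cases "?l + 1 < (fact (k + 1))\<^sup>2")
    case True
    then show ?thesis unfolding eq by (rule pen_grid)
  next
    case False
    \<comment> \<open>Only k = 0 is left, where truncated subtraction gives radius 0; a single
      letter contains no matched pair and is legal.\<close>
    with l have l0: "?l = 0" by arith
    have "\<not> legal x (- int ?l) (int ?l + 1)" by (rule LeastI) (rule n(2))
    moreover have "legal x (- int 0) (int 0 + 1)" by (simp add: legal_def matched_def)
    ultimately show ?thesis unfolding l0 by (rule notE)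
  qed
qed

lemma continuous_on_window:
  fixes g :: "(int \<Rightarrow> 'a::discrete_topology) \<Rightarrow> real"
  assumes "\<And>x y. (\<And>i. - int m \<le> i \<Longrightarrow> i \<le> int m \<Longrightarrow> x i = y i) \<Longrightarrow> g x = g y"
  shows "continuous_on UNIV g"
proof -
  have "open (g -` S)" for S
  proof (subst open_subopen, intro ballI)
    fix x assume x: "x \<in> g -` S"
    let ?U = "\<Inter>i\<in>{- int m..int m}. (\<lambda>y. y i) -` {x i}"
    have "open ?U"
      by (intro open_INT ballI open_vimage discrete_topology_class.open_discrete) auto
    moreover have "?U \<subseteq> g -` S"
    proof
      fix y assume "y \<in> ?U"
      then have "g y = g x" by (intro assms) auto
      with x show "y \<in> g -` S" by simp
    qed
    ultimately show "\<exists>T. open T \<and> x \<in> T \<and> T \<subseteq> g -` S" by (intro exI[of _ ?U]) auto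
  qed
  then show ?thesis by (auto simp: continuous_on_open_vimage)
qed

lemma pen_tendsto: "(\<lambda>d. pen (Suc d)) \<longlonglongrightarrow> 0"
proof (rule LIMSEQ_I)
  fix e :: real assume e: "0 < e"
  obtain k :: nat where k: "24 / e < k" using reals_Archimedean2 by blast
  have "norm (pen (Suc d) - 0) < e" if "d \<ge> (fact (k + 1))\<^sup>2" for d
  proof -
    have "pen (Suc d) \<le> 24 / fact (k + 1)" using that by (intro pen_small) simp
    also have "\<dots> < e"
    proof -
      have "real k \<le> fact (k + 1)" using fact_ge_self[of "k + 1"]
        by (metis of_nat_fact of_nat_le_iff add_leD1)
      with k have "24 / e < fact (k + 1)" by linarith
      then have "24 < fact (k + 1) * e" by (simp only: pos_divide_less_eq[OF e])
      then show ?thesis by (simp only: pos_divide_less_eq[OF fact_gt_zero] mult.commute)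
    qed
    finally show ?thesis using pen_pos[of "Suc d"] by simp
  qed
  then show "\<exists>no. \<forall>d\<ge>no. norm (pen (Suc d) - 0) < e" by blast
qed

text \<open>Uniform limit of the functions \<open>defect m\<close>, which are locally
  constant.\<close>

lemma continuous_excess: "continuous_on UNIV excess"
proof (rule uniform_limit_theorem)
  show "\<forall>\<^sub>F m in sequentially. continuous_on UNIV (defect m)"
    by (intro always_eventually allI continuous_on_window defect_cong)
  show "uniform_limit UNIV defect excess sequentially"
  proof (rule uniform_limitI)
    fix e :: real assume "0 < e"
    with pen_tendsto have "\<forall>\<^sub>F m in sequentially. pen (Suc m) < e" by (rule order_tendstoD)
    then show "\<forall>\<^sub>F m in sequentially. \<forall>x\<in>UNIV. dist (defect m x) (excess x) < e"
    proof eventually_elim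
      case (elim m)
      have "dist (defect m x) (excess x) < e" for x
        using excess_diff[of x m] elim by (simp add: dist_real_def)
      then show ?case by blast
    qed
  qed
qed simp

section \<open>Words of bounded cost\<close>

definition cost :: "nat \<Rightarrow> (int \<Rightarrow> nat) \<Rightarrow> real" where
  "cost n x = (\<Sum>j<n. excess (shift_iter (int j) x))"

lemma cost_ge0: "0 \<le> cost n x"
  unfolding cost_def by (intro sum_nonneg excess_ge0)

lemma cost_add: "cost (m + n) x = cost m x + cost n (shift_iter (int m) x)"
proof (induction n)
  case (Suc n)
  then show ?case by (simp add: cost_def shift_iter_add[symmetric] add.commute)
qed (simp add: cost_def)

text \<open>The cost depends on the whole sequence, so a word counts as cheap as soon as one of its
  extensions is.\<close>

definition cheap_words :: "nat \<Rightarrow> real \<Rightarrow> nat list set" where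
  "cheap_words n c = {wd x 0 n | x. x \<in> \<Sigma>\<^sub>4 \<and> cost n x \<le> c}"

lemma finite_cheap_words: "finite (cheap_words n c)"
  by (rule finite_subset[of _ "{l. set l \<subseteq> {0,1,2,3} \<and> length l = n}"])
    (use wd_in in \<open>auto simp only: cheap_words_def\<close>, simp add: finite_lists_length_eq)

text \<open>The first illegal prefix consists of a legal word and one more letter; each of its letters
  is charged.\<close>

lemma cheap_words_subset:
  "cheap_words n c \<subseteq> legal_words n \<union>
     (\<Union>L\<in>{2..n}. (\<lambda>(u, v, z). u @ v # z) `
        (legal_words (L - 1) \<times> {0,1,2,3} \<times> cheap_words (n - L) (c - L * pen L)))"
proof
  fix w assume "w \<in> cheap_words n c"
  then obtain x where x: "x \<in> \<Sigma>\<^sub>4" "cost n x \<le> c" "w = wd x 0 n" by (auto simp: cheap_words_def)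
  show "w \<in> legal_words n \<union>
     (\<Union>L\<in>{2..n}. (\<lambda>(u, v, z). u @ v # z) `
        (legal_words (L - 1) \<times> {0,1,2,3} \<times> cheap_words (n - L) (c - L * pen L)))"
  proof (cases "legal x 0 (int n)")
    case True
    then show ?thesis using x by (auto simp: legal_words_def)
  next
    case False
    define L where "L = (LEAST l. \<not> legal x 0 (int l))"
    have L: "\<not> legal x 0 (int L)" "L \<le> n"
      unfolding L_def by (rule LeastI[of _ n], rule False, rule Least_le, rule False)
    have L': "legal x 0 (int l)" if "l < L" for l
      using not_less_Least[OF that[unfolded L_def]] by (rule notnotD)
    have "2 \<le> L"
    proof (rule ccontr)
      assume "\<not> 2 \<le> L"
      then have "legal x 0 (int L)" unfolding legal_def matched_def by linarith
      with L(1) show False by (rule notE)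
    qed
    let ?u = "wd x 0 (L - 1)" and ?v = "x (int (L - 1))" and ?z = "wd (shift_iter (int L) x) 0 (n - L)"
    have "wd x 0 n = wd x 0 (L - 1 + 1) @ wd x (0 + int L) (n - L)"
      using wd_append[of x 0 L "n - L"] L(2) \<open>2 \<le> L\<close> by simp
    also have "\<dots> = ?u @ ?v # ?z"
      unfolding wd_append by (simp add: wd_def shift_iter_def add_ac)
    finally have w: "w = ?u @ ?v # ?z" using x by simp
    have u: "?u \<in> legal_words (L - 1)" using x L'[of "L - 1"] \<open>2 \<le> L\<close> by (auto simp: legal_words_def)
    have v: "?v \<in> {0,1,2,3}" using x by blast
    \<comment> \<open>From position j the illegal prefix occupies the places -j to L - j - 1, all
      within radius L.\<close>
    have "L * pen L = (\<Sum>j<L. pen L)" by simp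
    also have "\<dots> \<le> cost L x"
      unfolding cost_def
    proof (rule sum_mono)
      fix j assume "j \<in> {..<L}"
      then show "pen L \<le> excess (shift_iter (int j) x)"
        using L(1) by (intro excess_ge[of _ "- int j" "int L - int j"]) (auto simp: legal_shift)
    qed
    finally have "cost (n - L) (shift_iter (int L) x) \<le> c - L * pen L"
      using cost_add[of L "n - L" x] L(2) x(2) by simp
    then have z: "?z \<in> cheap_words (n - L) (c - L * pen L)"
      using x(1) by (auto simp: cheap_words_def shift_iter_def)
    have "w \<in> (\<lambda>(u, v, z). u @ v # z) `
        (legal_words (L - 1) \<times> {0,1,2,3} \<times> cheap_words (n - L) (c - L * pen L))"
      using u v z w by (intro image_eqI[of _ _ "(?u, ?v, ?z)"]) auto
    moreover have "L \<in> {2..n}" using L(2) \<open>2 \<le> L\<close> by simp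
    ultimately show ?thesis by (intro UnI2 UN_I)
  qed
qed

text \<open>Telescoping with 1 / (n + 1)^2 \<le> 1 / n - 1 / (n + 1).\<close>

lemma sum_inverse_squares_le: "(\<Sum>L\<in>{2..n}. 1 / real L ^ 2) \<le> 1"
proof -
  have "(\<Sum>L\<in>{2..n}. 1 / real L ^ 2) \<le> 1 - 1 / real n" if "1 \<le> n" for n
    using that
  proof (induction n rule: nat_induct_at_least)
    case (Suc n)
    have "1 / real (Suc n) ^ 2 \<le> 1 / real n - 1 / real (Suc n)"
      using Suc(1) by (simp add: divide_simps power2_eq_square)
    with Suc show ?case by simp
  qed simp
  from this[of n] show ?thesis by (cases "1 \<le> n") (auto intro: order_trans)
qed

text \<open>Strong induction with the budget \<open>c\<close> free, since a block lowers it by L *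
  pen L. Legal words take at most half of the bound; words starting with a block of length L take at
  most the fraction 1 / (48 L^2), by \<open>exp_penalty\<close>, and these fractions sum to at most
  1 / 48.\<close>

lemma card_cheap_words: "card (cheap_words n c) \<le> 2 * (real n + 1) * 3 powr (real n + c)"
proof (induction n arbitrary: c rule: less_induct)
  case (less n)
  show ?case
  \<comment> \<open>A block may overdraw the budget; then no words remain.\<close>
  proof (cases "0 \<le> c")
    case False
    then have "cheap_words n c = {}"
      unfolding cheap_words_def using cost_ge0[of n] order_trans by blast
    then show ?thesis by simp
  next
    case True
    let ?F = "\<lambda>L. (\<lambda>(u, v, z). u @ v # z) `
        (legal_words (L - 1) \<times> {0,1,2,3} \<times> cheap_words (n - L) (c - L * pen L))"
    let ?b = "2 * (real n + 1) * 3 powr (real n + c)"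
    have F: "real (card (?F L)) \<le> ?b / 48 * (1 / real L ^ 2)" if L: "L \<in> {2..n}" for L
    proof -
      have L1: "L - 1 + 1 = L" using L by simp
      have "card (?F L) \<le> card (legal_words (L - 1) \<times> {0,1,2,3::nat} \<times> cheap_words (n - L) (c - L * pen L))"
        by (intro card_image_le finite_cartesian_product card_legal_words finite_cheap_words) auto
      also have "\<dots> = card (legal_words (L - 1)) * (4 * card (cheap_words (n - L) (c - L * pen L)))"
        by (simp add: card_cartesian_product)
      also have "\<dots> \<le> (L * 3 ^ (L - 1)) * (4 * card (cheap_words (n - L) (c - L * pen L)))"
        using card_legal_words(2)[of "L - 1"] L1 by (intro mult_right_mono) (simp_all only: L1 zero_le)
      finally have "real (card (?F L)) \<le> real ((L * 3 ^ (L - 1)) * (4 * card (cheap_words (n - L) (c - L * pen L))))"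
        by (simp only: of_nat_le_iff)
      also have "\<dots> = (4 * real L * 3 ^ (L - 1)) * real (card (cheap_words (n - L) (c - L * pen L)))" by simp
      also have "\<dots> \<le> (4 * real L * 3 ^ (L - 1)) *
          (2 * (real (n - L) + 1) * 3 powr (real (n - L) + (c - L * pen L)))"
        using L by (intro mult_left_mono less) auto
      also have "\<dots> \<le> (4 * real L * 3 ^ (L - 1)) * (2 * (real n + 1) * 3 powr (real (n - L) + (c - L * pen L)))"
        by (intro mult_left_mono mult_right_mono) auto
      \<comment> \<open>The block length cancels: 3^(L - 1) from the legal word and 3^(n - L) from
        the rest leave 3^n / 3, and 4 counts the last letter of the block.\<close>
      also have "\<dots> = ?b * (4 / 3) * L / 3 powr (L * pen L)"
      proof -
        have "(3::real) ^ (L - 1) = 3 powr L / 3"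
          using L by (cases L) (auto simp: powr_realpow powr_add)
        moreover have "3 powr (real (n - L) + (c - L * pen L)) = 3 powr (n + c) / 3 powr L / 3 powr (L * pen L)"
          using L by (simp add: powr_diff[symmetric] of_nat_diff algebra_simps)
        ultimately show ?thesis by (simp only:) simp
      qed
      also have "\<dots> \<le> ?b * (4 / 3) * L / (64 * real L ^ 3)"
        using exp_penalty[of L] L by (intro divide_left_mono) auto
      also have "\<dots> = ?b / 48 * (1 / real L ^ 2)"
        using L by (simp add: field_simps power2_eq_square power3_eq_cube)
      finally show ?thesis .
    qed
    have "card (cheap_words n c) \<le> card (legal_words n \<union> (\<Union>L\<in>{2..n}. ?F L))"
      by (intro card_mono cheap_words_subset finite_UnI finite_UN_I finite_imageI
          finite_cartesian_product card_legal_words finite_cheap_words) auto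
    also have "\<dots> \<le> card (legal_words n) + card (\<Union>L\<in>{2..n}. ?F L)" by (rule card_Un_le)
    also have "\<dots> \<le> (n + 1) * 3 ^ n + (\<Sum>L\<in>{2..n}. card (?F L))"
      by (intro add_mono card_legal_words card_UN_le) auto
    finally have "real (card (cheap_words n c)) \<le> real ((n + 1) * 3 ^ n + (\<Sum>L\<in>{2..n}. card (?F L)))"
      by (simp only: of_nat_le_iff)
    also have "\<dots> = (real n + 1) * 3 powr n + (\<Sum>L\<in>{2..n}. real (card (?F L)))"
      by (simp add: powr_realpow distrib_right)
    also have "\<dots> \<le> (real n + 1) * 3 powr (real n + c) + (\<Sum>L\<in>{2..n}. ?b / 48 * (1 / real L ^ 2))"
      using True by (intro add_mono mult_left_mono powr_mono sum_mono F) auto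
    also have "(\<Sum>L\<in>{2..n}. ?b / 48 * (1 / real L ^ 2)) = ?b / 48 * (\<Sum>L\<in>{2..n}. 1 / real L ^ 2)"
      by (simp only: sum_distrib_left)
    also have "\<dots> \<le> ?b / 48 * 1"
      by (intro mult_left_mono sum_inverse_squares_le) auto
    also have "(real n + 1) * 3 powr (real n + c) + ?b / 48 * 1 \<le> ?b"
    proof -
      have "0 \<le> (real n + 1) * 3 powr (real n + c)" by simp
      then show ?thesis by linarith
    qed
    finally show ?thesis by simp
  qed
qed

subsection \<open>Approximation of measurable sets by label classes\<close>

text \<open>The sets approximable by unions of label classes form a sigma-algebra, and a generator
  is the increasing union of the classes it contains. As labels refine, an approximation at one
  level survives at all later ones, which lets finitely many sets share a level.\<close>

lemma label_approximation:
  fixes L :: "nat \<Rightarrow> 'a \<Rightarrow> 'l"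
  assumes "finite_measure M"
    and L: "\<And>k. L k \<in> measurable M (count_space UNIV)"
    and refine: "\<And>k p q. L (Suc k) p = L (Suc k) q \<Longrightarrow> L k p = L k q"
    and gen: "sets M = sigma_sets (space M) G"
    and G: "\<And>W p. W \<in> G \<Longrightarrow> p \<in> W \<Longrightarrow> \<exists>k. {q \<in> space M. L k q = L k p} \<subseteq> W"
    and B: "B \<in> sets M" and e: "0 < e"
  shows "\<exists>k0. \<forall>k\<ge>k0. \<exists>S. measure M ((B - L k -` S) \<union> (L k -` S \<inter> space M - B)) < e"
proof -
  interpret finite_measure M by fact
  let ?A = "\<lambda>k S. L k -` S \<inter> space M"
  have A [measurable]: "?A k S \<in> sets M" for k S
    using L by (rule measurable_sets) simp
  have ref: "L k p = L k q" if "L k' p = L k' q" "k \<le> k'" for k k' p q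
    using that(2,1) by (induction k' rule: dec_induct) (auto dest: refine)
  have lift: "\<exists>S'. ?A k' S' = ?A k S" if "k \<le> k'" for k k' S
  proof -
    have "?A k' (L k' ` ?A k S) = ?A k S"
    proof (intro equalityI subsetI)
      fix p assume "p \<in> ?A k' (L k' ` ?A k S)"
      then obtain q where "q \<in> ?A k S" "L k' p = L k' q" "p \<in> space M" by blast
      with ref[of k' p q k] that show "p \<in> ?A k S" by simp
    qed auto
    then show ?thesis ..
  qed
  define d where "d B k S = measure M ((B - ?A k S) \<union> (?A k S - B))" for B k S
  have d_lift: "\<exists>S'. d B k' S' = d B k S" if "k \<le> k'" for B k k' S
    using lift[OF that, of S] unfolding d_def by metis
  have ex: "\<exists>k S. d B k S < e" if "B \<in> sigma_sets (space M) G" "0 < e" for B e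
    using that
  proof (induction arbitrary: e rule: sigma_sets.induct)
    case (Basic W)
    have W: "W \<in> sets M" using Basic gen by auto
    note [measurable] = W
    define C where "C k = {p \<in> space M. {q \<in> space M. L k q = L k p} \<subseteq> W}" for k
    have C_eq: "C k = ?A k (L k ` C k)" for k
      unfolding C_def by auto
    have C_sets [measurable]: "C k \<in> sets M" for k
      by (subst C_eq) (rule A)
    have "(\<Union>k. C k) = W"
      using G[OF Basic(1)] sets.sets_into_space[OF W] unfolding C_def by blast
    moreover have "incseq C"
      using refine unfolding C_def by (intro incseq_SucI) blast
    ultimately have "(\<lambda>k. measure M (C k)) \<longlonglongrightarrow> measure M W"
      using finite_Lim_measure_incseq[of C] C_sets by (simp add: image_subset_iff)
    then have "\<forall>\<^sub>F k in sequentially. measure M W - e < measure M (C k)"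
      using Basic(2) by (intro order_tendstoD(1)) auto
    then obtain k where k: "measure M W - e < measure M (C k)"
      by (auto simp: eventually_sequentially)
    have "C k \<subseteq> W" unfolding C_def by auto
    then have "measure M (W - C k) < e" using k finite_measure_Diff[OF W C_sets[of k]] by simp
    moreover have "(W - C k) \<union> (C k - W) = W - C k" using \<open>C k \<subseteq> W\<close> by auto
    ultimately have "d W k (L k ` C k) < e" unfolding d_def C_eq[symmetric] by simp
    then show ?case by blast
  next
    case Empty
    then have "d {} 0 {} < e" by (simp add: d_def)
    then show ?case by blast
  next
    case (Compl a)
    then obtain k S where "d a k S < e" by blast
    moreover have "(space M - a - ?A k (- S)) \<union> (?A k (- S) - (space M - a)) = (a - ?A k S) \<union> (?A k S - a)"
      using sets.sets_into_space[of a M] Compl(1) gen by auto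
    ultimately have "d (space M - a) k (- S) < e" by (simp add: d_def)
    then show ?case by blast
  next
    case (Union a)
    have a [measurable]: "a i \<in> sets M" for i using Union(1) gen by simp
    have "(\<lambda>n. measure M (\<Union>i<n. a i)) \<longlonglongrightarrow> measure M (\<Union>n. \<Union>i<n. a i)"
      by (intro finite_Lim_measure_incseq) (auto intro!: incseq_SucI simp: lessThan_Suc)
    moreover have U: "(\<Union>n. \<Union>i<n. a i) = (\<Union>i. a i)" by blast
    ultimately have "\<forall>\<^sub>F n in sequentially. measure M (\<Union>i. a i) - e / 2 < measure M (\<Union>i<n. a i)"
      using Union(3) by (intro order_tendstoD(1)) auto
    then obtain n where n: "measure M (\<Union>i. a i) - e / 2 < measure M (\<Union>i<n. a i)"
      by (auto simp: eventually_sequentially)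
    \<comment> \<open>One half of e went to the tail of the union; the other half is shared by the
      first n sets.\<close>
    have e': "0 < e / (2 * (n + 1))" using Union(3) by simp
    obtain kk SS where k: "d (a i) (kk i) (SS i) < e / (2 * (n + 1))" for i
      using Union(2)[OF e'] by metis
    define K where "K = Max (kk ` {..<n} \<union> {0})"
    have "kk i \<le> K" if "i < n" for i unfolding K_def using that by (intro Max_ge) auto
    then have "\<forall>i\<in>{..<n}. \<exists>S. d (a i) K S = d (a i) (kk i) (SS i)" using d_lift by simp
    then obtain S where S: "\<And>i. i \<in> {..<n} \<Longrightarrow> d (a i) K (S i) = d (a i) (kk i) (SS i)" by metis
    let ?S = "\<Union>i<n. S i"
    let ?E = "\<lambda>i. (a i - ?A K (S i)) \<union> (?A K (S i) - a i)"
    have "d (\<Union>i. a i) K ?S \<le> measure M (((\<Union>i. a i) - (\<Union>i<n. a i)) \<union> (\<Union>i<n. ?E i))"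
      unfolding d_def
    proof (rule finite_measure_mono)
      show "sym_diff (\<Union>i. a i) (?A K ?S) \<subseteq> ((\<Union>i. a i) - (\<Union>i<n. a i)) \<union> (\<Union>i<n. ?E i)" by blast
    qed auto
    also have "\<dots> \<le> measure M ((\<Union>i. a i) - (\<Union>i<n. a i)) + measure M (\<Union>i<n. ?E i)"
      by (intro measure_Un_le) auto
    also have "measure M ((\<Union>i. a i) - (\<Union>i<n. a i)) < e / 2"
    proof -
      have "measure M ((\<Union>i. a i) - (\<Union>i<n. a i)) = measure M (\<Union>i. a i) - measure M (\<Union>i<n. a i)"
        by (intro finite_measure_Diff) auto
      with n show ?thesis by linarith
    qed
    also have "measure M (\<Union>i<n. ?E i) \<le> (\<Sum>i<n. measure M (?E i))"
      by (intro finite_measure_subadditive_finite) auto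
    also have "\<dots> \<le> (\<Sum>i<n. e / (2 * (n + 1)))"
      using S k by (intro sum_mono) (simp add: d_def less_imp_le)
    also have "\<dots> \<le> e / 2" using Union(3) by (simp add: field_simps)
    finally have "d (\<Union>i. a i) K ?S < e" by simp
    then show ?case by blast
  qed
  obtain k0 S0 where k0: "d B k0 S0 < e" using ex[of B e] B gen e by auto
  have "\<exists>S. measure M ((B - L k -` S) \<union> (L k -` S \<inter> space M - B)) < e" if k: "k \<ge> k0" for k
  proof -
    obtain S where "d B k S = d B k0 S0" using d_lift[OF k] by blast
    moreover have "(B - ?A k S) \<union> (?A k S - B) = (B - L k -` S) \<union> (L k -` S \<inter> space M - B)"
      using sets.sets_into_space[OF B] by blast
    ultimately show ?thesis using k0 unfolding d_def by metis
  qed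
  then show ?thesis by blast
qed

lemma open_contains_cylinder:
  fixes W :: "(int \<Rightarrow> 'a::topological_space) set"
  assumes "open W" "x \<in> W"
  shows "\<exists>n::nat. \<forall>y. (\<forall>i. - int n \<le> i \<and> i \<le> int n \<longrightarrow> y i = x i) \<longrightarrow> y \<in> W"
proof -
  have "openin (product_topology (\<lambda>_. euclidean) UNIV) W"
    using assms(1) by (simp add: euclidean_product_topology)
  from product_topology_open_contains_basis[OF this assms(2)]
  obtain X where X: "x \<in> (\<Pi>\<^sub>E i\<in>UNIV. X i)" "finite {i. X i \<noteq> UNIV}" "(\<Pi>\<^sub>E i\<in>UNIV. X i) \<subseteq> W" by auto
  define n where "n = Max (insert 0 ((\<lambda>i. nat \<bar>i\<bar>) ` {i. X i \<noteq> UNIV}))"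
  have n: "nat \<bar>i\<bar> \<le> n" if "X i \<noteq> UNIV" for i
    unfolding n_def using X(2) that by (intro Max_ge) auto
  have "y \<in> W" if "\<forall>i. - int n \<le> i \<and> i \<le> int n \<longrightarrow> y i = x i" for y
  proof -
    have "y i \<in> X i" for i
    proof (cases "X i = UNIV")
      case False
      from n[OF this] have "- int n \<le> i \<and> i \<le> int n" by linarith
      with that have "y i = x i" by blast
      with X(1) show ?thesis by auto
    qed simp
    with X(3) show ?thesis by auto
  qed
  then show ?thesis by blast
qed

text \<open>The window \<open>win k\<close> is the largest on which \<open>defect\<close> takes values in the grid of width
  \<open>1 / fact k\<close>.\<close>

definition win :: "nat \<Rightarrow> nat" where
  "win k = (fact (k + 1))\<^sup>2 - 2"

text \<open>The height is recorded by its cell in the same grid of width 1 / k! on which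
  \<open>defect (win k)\<close> takes its values.\<close>

definition label :: "nat \<Rightarrow> (int \<Rightarrow> nat) \<times> real \<Rightarrow> nat list \<times> int" where
  "label k p = (wd (fst p) (- int (win k)) (2 * win k + 1), \<lfloor>snd p * fact k\<rfloor>)"

lemma win_mono: "win k \<le> win (Suc k)"
proof -
  have "(fact (k + 1) :: nat) \<le> fact (Suc k + 1)" by (rule fact_mono) simp
  then have "(fact (k + 1) :: nat)\<^sup>2 \<le> (fact (Suc k + 1))\<^sup>2" by (rule power_mono) simp
  then show ?thesis unfolding win_def by (rule diff_le_mono)
qed

lemma win_ge: "int k - 1 \<le> int (win k)"
proof -
  have "k + 1 \<le> fact (k + 1)" by (rule fact_ge_self)
  moreover have "(fact (k + 1) :: nat) \<le> (fact (k + 1))\<^sup>2" by (rule self_le_power[OF fact_ge_1]) simp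
  ultimately show ?thesis unfolding win_def by linarith
qed

lemma label_eq_iff: "label k p = label k q \<longleftrightarrow>
   (\<forall>i. - int (win k) \<le> i \<and> i \<le> int (win k) \<longrightarrow> fst p i = fst q i) \<and> \<lfloor>snd p * fact k\<rfloor> = \<lfloor>snd q * fact k\<rfloor>"
proof -
  have "i < - int (win k) + int (2 * win k + 1) \<longleftrightarrow> i \<le> int (win k)" for i by linarith
  then show ?thesis unfolding label_def prod.inject wd_eq_iff by simp
qed

text \<open>The height grids are nested because k! divides (k + 1)!; the coarse cell is an integer
  quotient of the fine one.\<close>

lemma label_refine: "label (Suc k) p = label (Suc k) q \<Longrightarrow> label k p = label k q"
proof -
  assume eq: "label (Suc k) p = label (Suc k) q"
  have "\<lfloor>s * fact k\<rfloor> = \<lfloor>s * fact (Suc k)\<rfloor> div int (Suc k)" for s :: real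
  proof -
    have "s * fact k = s * fact (Suc k) / real_of_int (int (Suc k))" by (simp add: field_simps)
    then show ?thesis using floor_divide_real_eq_div[of "int (Suc k)" "s * fact (Suc k)"] by simp
  qed
  then show ?thesis using eq win_mono[of k] unfolding label_eq_iff by fastforce
qed

lemma open_coord: "open {x :: int \<Rightarrow> 'a::discrete_topology. x i \<in> V}"
  using open_vimage[OF discrete_topology_class.open_discrete[of V], of "\<lambda>x. x i"]
  by (simp add: vimage_def)

lemma label_measurable: "label k \<in> borel \<rightarrow>\<^sub>M count_space UNIV"
proof (subst measurable_count_space_eq_countable, simp, intro conjI ballI)
  fix l :: "nat list \<times> int"
  have [measurable]: "(snd :: (int \<Rightarrow> nat) \<times> real \<Rightarrow> real) \<in> borel_measurable borel"
    by (rule borel_measurable_continuous_onI) (rule continuous_on_snd[OF continuous_on_id])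
  have c: "{p \<in> space borel. fst p (- int (win k) + int j) = fst l ! j} \<in> sets (borel :: ((int \<Rightarrow> nat) \<times> real) measure)" for j
    using borel_open[OF open_vimage_fst[OF open_coord[of "- int (win k) + int j" "{fst l ! j}"]]]
    by (simp add: vimage_def)
  have "label k -` {l} \<inter> space borel = (if length (fst l) = 2 * win k + 1 then
      {p \<in> space borel. (\<forall>j\<in>{..<2 * win k + 1}. fst p (- int (win k) + int j) = fst l ! j) \<and>
        \<lfloor>snd p * fact k\<rfloor> = snd l} else {})"
    by (cases l) (auto simp: label_def list_eq_iff_nth_eq)
  also have "\<dots> \<in> sets borel"
  proof -
    have "{p \<in> space (borel :: ((int \<Rightarrow> nat) \<times> real) measure). (\<forall>j\<in>{..<2 * win k + 1}. fst p (- int (win k) + int j) = fst l ! j) \<and>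
        \<lfloor>snd p * fact k\<rfloor> = snd l} \<in> sets borel"
    proof (rule sets.sets_Collect_conj)
      show "{p \<in> space (borel :: ((int \<Rightarrow> nat) \<times> real) measure). \<forall>j\<in>{..<2 * win k + 1}. fst p (- int (win k) + int j) = fst l ! j} \<in> sets borel"
        by (rule sets.sets_Collect_finite_All) (rule c, simp)
      show "{p \<in> space (borel :: ((int \<Rightarrow> nat) \<times> real) measure). \<lfloor>snd p * fact k\<rfloor> = snd l} \<in> sets borel"
        unfolding floor_eq_iff by measurable
    qed
    then show ?thesis by simp
  qed
  finally show "label k -` {l} \<inter> space borel \<in> sets borel" .
qed auto

text \<open>Label classes shrink to points: the windows exhaust the integers, and the height is
  known up to 1 / k!.\<close>

lemma label_class_subset_open:
  assumes "open W" "p \<in> W"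
  shows "\<exists>k. {q \<in> space borel. label k q = label k p} \<subseteq> W"
proof -
  obtain x s where p: "p = (x, s)" by force
  obtain U V where UV: "open U" "open V" "p \<in> U \<times> V" "U \<times> V \<subseteq> W"
    using open_prod_elim[OF assms] by blast
  obtain n :: nat where n: "\<And>y. \<forall>i. - int n \<le> i \<and> i \<le> int n \<longrightarrow> y i = x i \<Longrightarrow> y \<in> U"
    using open_contains_cylinder[OF UV(1), of x] UV(3) p by auto
  obtain e where e: "0 < e" "\<And>r. \<bar>r - s\<bar> < e \<Longrightarrow> r \<in> V"
    using UV(2,3) p unfolding open_dist by (auto simp: dist_real_def)
  obtain k0 :: nat where k0: "1 / e < k0" using reals_Archimedean2 by blast
  define k where "k = max k0 (n + 1)"
  have "q \<in> W" if q: "label k q = label k p" for q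
  proof -
    have "int n \<le> int (win k)" using win_ge[of k] by (simp add: k_def)
    then have "fst q \<in> U" using q[unfolded label_eq_iff] p by (intro n) auto
    moreover have "snd q \<in> V"
    proof (rule e(2))
      have fl: "\<lfloor>snd q * fact k\<rfloor> = \<lfloor>s * fact k\<rfloor>" using q[unfolded label_eq_iff] p by simp
      have "\<bar>snd q * fact k - s * fact k\<bar> < 1" using fl by linarith
      then have "\<bar>snd q - s\<bar> * fact k < 1" by (simp add: abs_mult[symmetric] left_diff_distrib[symmetric] abs_mult_pos)
      moreover have "1 / e < fact k"
      proof -
        have "real k \<le> fact k" using fact_ge_self[of k] by (metis of_nat_fact of_nat_le_iff)
        then show ?thesis using k0 by (simp add: k_def)
      qed
      then have "1 < e * fact k" using e(1) by (simp add: divide_less_eq mult.commute)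
      ultimately have "\<bar>snd q - s\<bar> * fact k < e * fact k" by linarith
      then show "\<bar>snd q - s\<bar> < e" by simp
    qed
    ultimately show ?thesis using UV(4) by (cases q) auto
  qed
  then show ?thesis by blast
qed

lemma label_approximates_borel:
  assumes "finite_measure M" "sets M = sets (borel :: ((int \<Rightarrow> nat) \<times> real) measure)" "B \<in> sets M" "0 < e"
  shows "\<exists>k0. \<forall>k\<ge>k0. \<exists>S. measure M ((B - label k -` S) \<union> (label k -` S \<inter> space M - B)) < e"
proof (rule label_approximation[OF assms(1) _ _ _ _ assms(3,4)])
  have sp: "space M = UNIV" using sets_eq_imp_space_eq[OF assms(2)] by simp
  show "label k \<in> M \<rightarrow>\<^sub>M count_space UNIV" for k
    using label_measurable measurable_cong_sets[OF assms(2) refl] by blast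
  show "sets M = sigma_sets (space M) {W. open W}" unfolding assms(2) sp by (simp add: borel_def)
  show "\<exists>k. {q \<in> space M. label k q = label k p} \<subseteq> W" if "W \<in> {W. open W}" "p \<in> W" for W p
    using label_class_subset_open[of W p] that sp by simp
qed (rule label_refine)

subsection \<open>The upper bound for the entropy\<close>

definition small_sum_lists :: "nat \<Rightarrow> nat \<Rightarrow> nat list set" where
  "small_sum_lists n D = {l. length l = n \<and> sum_list l \<le> D}"

text \<open>Generating function bound: each list counted contributes at least z^D to the sum of
  z^(sum of the list) over all lists of length n, which is (1 / (1 - z))^n. Later z is small and D a
  small fraction of n, so the count is exp (e n).\<close>

lemma card_small_sum_lists:
  fixes z :: real
  assumes z: "0 < z" "z < 1"
  shows "finite (small_sum_lists n D) \<and> card (small_sum_lists n D) \<le> (1 / z) ^ D * (1 / (1 - z)) ^ n"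
proof (induction n arbitrary: D)
  case 0
  have "small_sum_lists 0 D = {[]}" by (auto simp: small_sum_lists_def)
  moreover have "1 \<le> (1 / z) ^ D" using z by (intro one_le_power) simp
  ultimately show ?case by simp
next
  case (Suc n)
  have eq: "small_sum_lists (Suc n) D = (\<Union>e\<in>{..D}. (#) e ` small_sum_lists n (D - e))"
  proof (intro equalityI subsetI)
    fix l assume "l \<in> small_sum_lists (Suc n) D"
    then show "l \<in> (\<Union>e\<in>{..D}. (#) e ` small_sum_lists n (D - e))"
      by (cases l) (auto simp: small_sum_lists_def intro!: UN_I image_eqI)
  qed (auto simp: small_sum_lists_def)
  have "finite (small_sum_lists (Suc n) D)" unfolding eq using Suc by auto
  have "card (small_sum_lists (Suc n) D) \<le> (\<Sum>e\<in>{..D}. card ((#) e ` small_sum_lists n (D - e)))"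
    unfolding eq by (rule card_UN_le) simp
  also have "\<dots> = (\<Sum>e\<in>{..D}. card (small_sum_lists n (D - e)))"
    by (simp add: card_image)
  finally have "real (card (small_sum_lists (Suc n) D)) \<le> (\<Sum>e\<in>{..D}. real (card (small_sum_lists n (D - e))))"
    by (simp only: of_nat_le_iff of_nat_sum[symmetric])
  also have "\<dots> \<le> (\<Sum>e\<in>{..D}. (1 / z) ^ (D - e) * (1 / (1 - z)) ^ n)"
    using Suc by (intro sum_mono) blast
  also have "\<dots> = (\<Sum>e\<in>{..D}. (1 / z) ^ D * (1 / (1 - z)) ^ n * z ^ e)"
  proof (intro sum.cong refl)
    fix e assume "e \<in> {..D}"
    then have "(1 / z) ^ D = (1 / z) ^ (D - e) * (1 / z) ^ e" by (simp add: power_add[symmetric])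
    then show "(1 / z) ^ (D - e) * (1 / (1 - z)) ^ n = (1 / z) ^ D * (1 / (1 - z)) ^ n * z ^ e"
      using z by (simp add: power_divide)
  qed
  also have "\<dots> = (1 / z) ^ D * (1 / (1 - z)) ^ n * (\<Sum>e\<in>{..D}. z ^ e)"
    by (simp only: sum_distrib_left)
  also have "\<dots> \<le> (1 / z) ^ D * (1 / (1 - z)) ^ n * (1 / (1 - z))"
  proof (rule mult_left_mono)
    show "(\<Sum>e\<in>{..D}. z ^ e) \<le> 1 / (1 - z)"
      using z by (simp add: sum_gp0 divide_right_mono)
  qed (use z in auto)
  finally show ?case using \<open>finite (small_sum_lists (Suc n) D)\<close> by (simp add: mult_ac)
qed

lemma birkhoff_roof: "birkhoff_sum roof (int t) x = t + cost t x"
proof (induction t)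
  case (Suc t)
  have "birkhoff_sum roof (int (Suc t)) x = birkhoff_sum roof (int t + 1) x" by (simp add: add.commute)
  also have "\<dots> = t + cost t x + roof (shift_iter (int t) x)" unfolding birkhoff_sum_add_one Suc ..
  finally show ?case by (simp add: roof_def[of "shift_iter (int t) x"] cost_def)
qed (simp add: cost_def)

definition alph :: "nat set" where
  "alph = {0,1,2,3}"

interpretation dyck: susp alph roof
proof
  show "continuous_on UNIV roof"
    unfolding roof_def by (intro continuous_on_add continuous_on_const continuous_excess)
  show "1 \<le> roof x" for x using excess_ge0[of x] by (simp add: roof_def)
qed (simp add: alph_def)

lemma alph_iff: "(\<forall>i. x i \<in> alph) \<longleftrightarrow> x \<in> \<Sigma>\<^sub>4"
  unfolding alph_def mem_Collect_eq ..

lemma roof_le: "roof x \<le> 25"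
  using excess_le[of x] by (simp add: roof_def)

section \<open>Visible and hidden flow time\<close>

text \<open>The cost of t returns is split into \<open>seen\<close>, which finitely many letters
  determine and which is a multiple of 1 / k!, and the nonnegative \<open>drift\<close>, which
  depends on the whole sequence.\<close>

definition seen :: "nat \<Rightarrow> nat \<Rightarrow> (int \<Rightarrow> nat) \<Rightarrow> real" where
  "seen k t x = (\<Sum>l<t. defect (win k) (shift_iter (int l) x))"

definition drift :: "nat \<Rightarrow> nat \<Rightarrow> (int \<Rightarrow> nat) \<Rightarrow> real" where
  "drift k t x = (\<Sum>l<t. excess (shift_iter (int l) x) - defect (win k) (shift_iter (int l) x))"

lemma cost_eq: "cost t x = seen k t x + drift k t x"
  by (simp add: cost_def seen_def drift_def sum_subtractf)

lemma seen_cong: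
  assumes "\<And>i. - int (win k) \<le> i \<Longrightarrow> i < int t + int (win k) \<Longrightarrow> x i = y i"
  shows "seen k t x = seen k t y"
  unfolding seen_def
proof (intro sum.cong refl defect_cong)
  fix l i assume "l \<in> {..<t}" "- int (win k) \<le> i" "i \<le> int (win k)"
  then show "shift_iter (int l) x i = shift_iter (int l) y i"
    unfolding shift_iter_def by (intro assms) auto
qed

lemma seen_grid: "\<exists>z::int. seen k t x * fact k = z"
proof (induction t)
  case (Suc t)
  then obtain z :: int where z: "seen k t x * fact k = z" by blast
  obtain z' :: int where z': "defect (win k) (shift_iter (int t) x) = z' / fact k"
    using defect_grid[of k] unfolding win_def by blast
  have "seen k (Suc t) x * fact k = seen k t x * fact k + defect (win k) (shift_iter (int t) x) * fact k"
    by (simp add: seen_def distrib_right)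
  also have "\<dots> = of_int (z + z')" unfolding z z' by simp
  finally show ?case by blast
qed (auto simp: seen_def intro: exI[of _ 0])

lemma drift_step: "drift k t x \<le> drift k (Suc t) x"
  using excess_diff(1) by (simp add: drift_def)

text \<open>Each return hides at most 24 / (k + 1)!, and a grid cell has width 1 / k!.\<close>

lemma drift_le: "drift k t x * fact k \<le> t * (24 / (real k + 1))"
proof -
  have "drift k t x \<le> (\<Sum>l<t. 24 / fact (k + 1))"
    unfolding drift_def
  proof (intro sum_mono order_trans[OF excess_diff(2)] pen_small)
    show "(fact (k + 1))\<^sup>2 \<le> Suc (win k) + 1" unfolding win_def by linarith
  qed
  also have "\<dots> = t * (24 / ((real k + 1) * fact k))" by (simp add: distrib_right add.commute)
  finally have "drift k t x \<le> t * (24 / ((real k + 1) * fact k))" .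
  then have "drift k t x * fact k \<le> t * (24 / ((real k + 1) * fact k)) * fact k" by (rule mult_right_mono) simp
  also have "\<dots> = t * (24 / (real k + 1))" by (simp add: divide_simps)
  finally show ?thesis .
qed

definition level :: "nat \<Rightarrow> nat \<Rightarrow> (int \<Rightarrow> nat) \<times> real \<Rightarrow> int" where
  "level k i p = \<lfloor>(snd p - drift k i (fst p)) * fact k\<rfloor>"

text \<open>Subtracting a growing drift makes \<open>level\<close> nonincreasing. Its history is
  therefore encoded by its start and by natural numbers whose sum is at most the total drift in grid
  cells, plus 1 for rounding.\<close>

definition drops :: "nat \<Rightarrow> nat \<Rightarrow> (int \<Rightarrow> nat) \<times> real \<Rightarrow> nat list" where
  "drops k t p = map (\<lambda>i. nat (level k i p - level k (Suc i) p)) [0..<t]"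

lemma level_step: "level k (Suc i) p \<le> level k i p"
  unfolding level_def using drift_step[of k i "fst p"] by (intro floor_mono mult_right_mono) auto

lemma sum_drops: "int (sum_list (drops k t p)) = level k 0 p - level k t p"
proof (induction t)
  case (Suc t)
  then show ?case using level_step[of k t p] by (simp add: drops_def)
qed (simp add: drops_def)

lemma drops_small: "drops k t p \<in> small_sum_lists t (nat \<lfloor>t * (24 / (real k + 1))\<rfloor> + 1)"
proof -
  have "level k 0 p - level k t p \<le> \<lfloor>drift k t (fst p) * fact k\<rfloor> + 1"
  proof -
    have "(snd p - drift k 0 (fst p)) * fact k = (snd p - drift k t (fst p)) * fact k + drift k t (fst p) * fact k"
      by (simp add: drift_def algebra_simps)
    then show ?thesis unfolding level_def by linarith
  qed
  also have "\<dots> \<le> \<lfloor>t * (24 / (real k + 1))\<rfloor> + 1" by (intro add_mono floor_mono drift_le order_refl)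
  finally have "int (sum_list (drops k t p)) \<le> \<lfloor>t * (24 / (real k + 1))\<rfloor> + 1" unfolding sum_drops .
  then show ?thesis by (simp add: small_sum_lists_def drops_def)
qed

lemma level_determined:
  assumes "level k 0 p = level k 0 q" "drops k t p = drops k t q" "i \<le> t"
  shows "level k i p = level k i q"
  using assms(3)
proof (induction i)
  case (Suc i)
  have "drops k t p ! i = drops k t q ! i" using assms(2) by simp
  then have "nat (level k i p - level k (Suc i) p) = nat (level k i q - level k (Suc i) q)"
    using Suc(2) by (simp add: drops_def)
  then show ?case using Suc level_step[of k i p] level_step[of k i q] by linarith
qed (simp add: assms(1))

text \<open>The scaled quantity is the scaled \<open>s - drift\<close> plus an integer that the
  letters determine, and the floor commutes with integer translations.\<close>

lemma floor_birkhoff: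
  assumes eq: "\<And>i. - int (win k) \<le> i \<Longrightarrow> i < int t + int (win k) \<Longrightarrow> x i = x' i"
    and lev: "level k t (x, s) = level k t (x', s')"
  shows "\<lfloor>(real j + s - birkhoff_sum roof (int t) x) * fact k\<rfloor> =
         \<lfloor>(real j + s' - birkhoff_sum roof (int t) x') * fact k\<rfloor>"
proof -
  obtain z :: int where z: "seen k t x * fact k = z" using seen_grid by blast
  then have z': "seen k t x' * fact k = z" using seen_cong[OF eq] by simp
  define w where "w = (int j - int t) * fact k - z"
  have *: "(real j + s - birkhoff_sum roof (int t) y) * fact k = (s - drift k t y) * fact k + of_int w"
    if "seen k t y * fact k = z" for y s
    unfolding birkhoff_roof cost_eq[of t y k] w_def using that by (simp add: algebra_simps)
  show ?thesis using lev unfolding *[OF z] *[OF z'] level_def by simp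
qed

definition crossings :: "nat \<Rightarrow> (int \<Rightarrow> nat) \<times> real \<Rightarrow> nat" where
  "crossings n p = (SOME t. birkhoff_sum roof (int t) (fst p) \<le> n + snd p \<and>
     n + snd p < birkhoff_sum roof (int t + 1) (fst p))"

lemma crossings:
  assumes "(x, s) \<in> dyck.D"
  shows "birkhoff_sum roof (int (crossings n (x, s))) x \<le> n + s"
    and "n + s < birkhoff_sum roof (int (crossings n (x, s)) + 1) x"
proof -
  obtain i where i: "birkhoff_sum roof i x \<le> n + s" "n + s < birkhoff_sum roof (i + 1) x"
    using dyck.ex_index by blast
  have "0 \<le> i"
  proof (rule ccontr)
    assume "\<not> 0 \<le> i"
    then have "birkhoff_sum roof (i + 1) x \<le> birkhoff_sum roof 0 x" by (intro dyck.B_mono) simp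
    moreover have "0 \<le> s" using assms by (simp add: dyck.D_def)
    ultimately show False using i by simp
  qed
  then have "birkhoff_sum roof (int (nat i)) x \<le> n + s \<and> n + s < birkhoff_sum roof (int (nat i) + 1) x"
    using i by simp
  then have "birkhoff_sum roof (int (crossings n (x, s))) x \<le> n + s \<and>
      n + s < birkhoff_sum roof (int (crossings n (x, s)) + 1) x"
    unfolding crossings_def fst_conv snd_conv by (rule someI)
  then show "birkhoff_sum roof (int (crossings n (x, s))) x \<le> n + s"
    "n + s < birkhoff_sum roof (int (crossings n (x, s)) + 1) x" by blast+
qed

text \<open>Only the middle word is counted through its cost; the margins contribute a constant
  factor for fixed k. The right margin has one letter more because the window around position t
  contains t itself.\<close>

definition code :: "nat \<Rightarrow> nat \<Rightarrow> (int \<Rightarrow> nat) \<times> real \<Rightarrow>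
    nat \<times> nat list \<times> nat list \<times> nat list \<times> int \<times> nat list" where
  "code k n p = (let t = crossings n p; x = fst p in
     (t, wd x (- int (win k)) (win k), wd x 0 t, wd x (int t) (win k + 1), level k 0 p, drops k t p))"

lemma label_flow:
  assumes "(x, s) \<in> dyck.D"
  shows "dyck.rep ((dyck.\<phi> 1 ^^ j) (dyck.cls (x, s))) =
    (shift_iter (int (crossings j (x, s))) x, j + s - birkhoff_sum roof (int (crossings j (x, s))) x)"
proof -
  note c = crossings[OF assms, of j]
  have "(dyck.\<phi> 1 ^^ j) (dyck.cls (x, s)) = dyck.cls (shift_iter (int (crossings j (x, s))) x,
      j + s - birkhoff_sum roof (int (crossings j (x, s))) x)"
    by (rule dyck.flow_1_funpow[OF assms c])
  then show ?thesis using dyck.flow_cls(2)[OF assms c] by simp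
qed

text \<open>The drift enters the labels only through \<open>level\<close>: all other contributions to the flow time
  are multiples of the grid width that can be read off from the word.\<close>

lemma code_determines_labels:
  assumes p: "(x, s) \<in> dyck.D" and p': "(x', s') \<in> dyck.D"
    and eq: "code k n (x, s) = code k n (x', s')" and j: "j < n"
  shows "label k (dyck.rep ((dyck.\<phi> 1 ^^ j) (dyck.cls (x, s)))) =
         label k (dyck.rep ((dyck.\<phi> 1 ^^ j) (dyck.cls (x', s'))))"
proof -
  define T where "T = crossings n (x, s)"
  define t where "t = crossings j (x, s)"
  have T': "crossings n (x', s') = T" using eq by (simp add: code_def Let_def T_def)
  have words: "wd x (- int (win k)) (win k) = wd x' (- int (win k)) (win k)" "wd x 0 T = wd x' 0 T"
    "wd x (int T) (win k + 1) = wd x' (int T) (win k + 1)"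
    and lev0: "level k 0 (x, s) = level k 0 (x', s')" "drops k T (x, s) = drops k T (x', s')"
    using eq T' by (simp_all add: code_def Let_def T_def)
  have x: "x i = x' i" if "- int (win k) \<le> i" "i \<le> int T + int (win k)" for i
  proof -
    consider "i < 0" | "0 \<le> i" "i < int T" | "int T \<le> i" by linarith
    then show ?thesis
    proof cases
      case 1 then show ?thesis using words(1)[unfolded wd_eq_iff, rule_format, of i] that by linarith
    next
      case 2 then show ?thesis using words(2)[unfolded wd_eq_iff, rule_format, of i] by linarith
    next
      case 3 then show ?thesis using words(3)[unfolded wd_eq_iff, rule_format, of i] that by linarith
    qed
  qed
  let ?q = "\<lambda>x s i. (real j + s - birkhoff_sum roof (int i) x) * fact k"
  have q: "\<lfloor>?q x s i\<rfloor> = \<lfloor>?q x' s' i\<rfloor>" if "i \<le> T" for i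
    using that by (intro floor_birkhoff level_determined[OF lev0] x) auto
  note ct = crossings[OF p, of j, folded t_def]
  note cT = crossings[OF p, of n, folded T_def] crossings[OF p', of n, unfolded T']
  have tT: "t \<le> T"
  proof (rule ccontr)
    assume "\<not> t \<le> T"
    then have "birkhoff_sum roof (int T + 1) x \<le> birkhoff_sum roof (int t) x" by (intro dyck.B_mono) simp
    then show False using ct(1) cT(2) j by simp
  qed
  \<comment> \<open>The grid cell of a real number still shows its sign, and the signs of j + s
    minus the Birkhoff sums determine the number of returns up to time j.\<close>
  have sgn: "0 \<le> \<lfloor>y * fact k\<rfloor> \<longleftrightarrow> 0 \<le> y" for y :: real
    using mult_le_cancel_right_pos[of "fact k" 0 y] by simp
  have "0 \<le> real j + s' - birkhoff_sum roof (int t) x'"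
    using q[OF tT] sgn[of "real j + s - birkhoff_sum roof (int t) x"]
      sgn[of "real j + s' - birkhoff_sum roof (int t) x'"] ct(1) by simp
  moreover have "j + s' < birkhoff_sum roof (int t + 1) x'"
  \<comment> \<open>The code says nothing about levels beyond \<open>T\<close>; for t = T the bound
    follows from j < n and the choice of \<open>T\<close>.\<close>
  proof (cases "t = T")
    case True
    then show ?thesis using cT(4) j by simp
  next
    case False
    then have "\<lfloor>?q x s (Suc t)\<rfloor> = \<lfloor>?q x' s' (Suc t)\<rfloor>" using tT by (intro q) simp
    then show ?thesis
      using sgn[of "real j + s - birkhoff_sum roof (int (Suc t)) x"]
        sgn[of "real j + s' - birkhoff_sum roof (int (Suc t)) x'"] ct(2)
      by (simp add: add.commute)
  qed
  ultimately have "int (crossings j (x', s')) = int t"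
    using crossings[OF p', of j] by (intro dyck.index_unique[of _ x' "j + s'"]) auto
  then have t': "crossings j (x', s') = t" by simp
  show ?thesis
    unfolding label_flow[OF p] label_flow[OF p'] t' t_def[symmetric] label_eq_iff fst_conv snd_conv
  proof (intro conjI allI impI q tT)
    fix i assume "- int (win k) \<le> i \<and> i \<le> int (win k)"
    then show "shift_iter (int t) x i = shift_iter (int t) x' i"
      unfolding shift_iter_def using tT by (intro x) auto
  qed
qed

definition all_words :: "nat \<Rightarrow> nat list set" where
  "all_words n = {l. set l \<subseteq> {0,1,2,3} \<and> length l = n}"

lemma all_words: "finite (all_words n)" "card (all_words n) = 4 ^ n"
proof -
  have "finite {0,1,2,3::nat}" "card {0,1,2,3::nat} = 4" by simp_all
  then show "finite (all_words n)" "card (all_words n) = 4 ^ n"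
    unfolding all_words_def using finite_lists_length_eq card_lists_length_eq by metis+
qed

text \<open>A starting height below the roof is below 25, which leaves at most n + 25 units of time
  for the t returns and their cost.\<close>

lemma code_in:
  assumes p: "(x, s) \<in> dyck.D"
  shows "code k n (x, s) \<in> (SIGMA t:{..n + 25}. all_words (win k) \<times> cheap_words t (n + 25 - t) \<times>
    all_words (win k + 1) \<times> {0..25 * fact k} \<times> small_sum_lists t (nat \<lfloor>t * (24 / (real k + 1))\<rfloor> + 1))"
proof -
  define t where "t = crossings n (x, s)"
  have x: "x \<in> \<Sigma>\<^sub>4" and s: "0 \<le> s" "s < 25"
    using p roof_le[of x] unfolding dyck.D_def alph_iff[symmetric] by auto
  have "t + cost t x \<le> n + s"
    using crossings(1)[OF p, of n] unfolding birkhoff_roof t_def .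
  then have c: "t + cost t x \<le> n + 25" using s by linarith
  then have t: "t \<le> n + 25" using cost_ge0[of t x] by linarith
  have "wd x 0 t \<in> cheap_words t (n + 25 - t)"
    unfolding cheap_words_def using x c by (intro CollectI exI[of _ x]) simp
  moreover have "level k 0 (x, s) \<in> {0..25 * fact k}"
  proof -
    have l: "level k 0 (x, s) = \<lfloor>s * fact k\<rfloor>" by (simp add: level_def drift_def)
    have "s * fact k \<le> 25 * fact k" using s by simp
    then have "\<lfloor>s * fact k\<rfloor> \<le> \<lfloor>25 * fact k :: real\<rfloor>" by (rule floor_mono)
    also have "\<lfloor>25 * fact k :: real\<rfloor> = 25 * fact k"
    proof -
      have "(25 * fact k :: real) = of_int (25 * fact k)" by simp
      then show ?thesis by (simp only: floor_of_int)
    qed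
    finally show ?thesis unfolding l using s by simp
  qed
  ultimately show ?thesis
    using t wd_in[OF x] drops_small[of k t "(x, s)"]
    unfolding code_def Let_def fst_conv t_def[symmetric] all_words_def
    by (intro SigmaI) auto
qed

text \<open>A word of length t has budget n + 25 - t, so the bound 3^(length + budget) is 3^(n + 25)
  for every t: time spent on penalties is lost for letters.\<close>

lemma card_code_image:
  fixes z :: real
  assumes z: "0 < z" "z < 1"
  shows "finite (code k n ` dyck.D)"
    and "card (code k n ` dyck.D) \<le> (real n + 26) * (4 ^ win k * (2 * (real n + 26) * 3 powr (real n + 25) *
       (4 ^ (win k + 1) * ((25 * fact k + 1) *
       ((1 / z) powr ((real n + 25) * (24 / (real k + 1)) + 1) * (1 / (1 - z)) ^ (n + 25))))))"
    (is "_ \<le> (real n + 26) * ?b")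
proof -
  let ?C = "\<lambda>t. all_words (win k) \<times> cheap_words t (n + 25 - t) \<times>
    all_words (win k + 1) \<times> {0..25 * fact k :: int} \<times> small_sum_lists t (nat \<lfloor>t * (24 / (real k + 1))\<rfloor> + 1)"
  have fin: "finite (?C t)" for t
    using card_small_sum_lists[OF z] by (intro finite_cartesian_product all_words finite_cheap_words) auto
  have sub: "code k n ` dyck.D \<subseteq> (SIGMA t:{..n + 25}. ?C t)"
  proof (rule image_subsetI)
    fix p assume "p \<in> dyck.D"
    then show "code k n p \<in> (SIGMA t:{..n + 25}. ?C t)" using code_in[of "fst p" "snd p" k n] by simp
  qed
  show "finite (code k n ` dyck.D)" by (rule finite_subset[OF sub finite_SigmaI[OF finite_atMost fin]])
  have C: "real (card (?C t)) \<le> ?b" if t: "t \<le> n + 25" for t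
  proof -
    let ?d = "nat \<lfloor>t * (24 / (real k + 1))\<rfloor> + 1"
    have "real (card (cheap_words t (n + 25 - t))) \<le> 2 * (real t + 1) * 3 powr (real t + real (n + 25 - t))"
      using card_cheap_words[of t "n + 25 - t"] t by simp
    also have "\<dots> \<le> 2 * (real n + 26) * 3 powr (real n + 25)"
      using t by (intro mult_mono powr_mono) auto
    finally have 1: "real (card (cheap_words t (n + 25 - t))) \<le> 2 * (real n + 26) * 3 powr (real n + 25)" .
    have "real (card (small_sum_lists t ?d)) \<le> (1 / z) ^ ?d * (1 / (1 - z)) ^ t"
      using card_small_sum_lists[OF z] by blast
    also have "\<dots> \<le> (1 / z) powr ((real n + 25) * (24 / (real k + 1)) + 1) * (1 / (1 - z)) ^ (n + 25)"
    proof (rule mult_mono)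
      have "real ?d \<le> t * (24 / (real k + 1)) + 1" by (simp add: le_floor_iff[symmetric] of_nat_nat)
      also have "\<dots> \<le> (real n + 25) * (24 / (real k + 1)) + 1"
        using t by (intro add_mono mult_right_mono) auto
      finally have "(1 / z) powr real ?d \<le> (1 / z) powr ((real n + 25) * (24 / (real k + 1)) + 1)"
        using z by (intro powr_mono) auto
      then show "(1 / z) ^ ?d \<le> (1 / z) powr ((real n + 25) * (24 / (real k + 1)) + 1)"
        using z by (subst powr_realpow[symmetric]) auto
      show "(1 / (1 - z)) ^ t \<le> (1 / (1 - z)) ^ (n + 25)"
        using z t by (intro power_increasing) auto
    qed (use z in auto)
    finally have 2: "real (card (small_sum_lists t ?d)) \<le>
      (1 / z) powr ((real n + 25) * (24 / (real k + 1)) + 1) * (1 / (1 - z)) ^ (n + 25)" .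
    have 3: "real (card {0..25 * fact k :: int}) = 25 * fact k + 1" by simp
    have "real (card (?C t)) = 4 ^ win k * (real (card (cheap_words t (n + 25 - t))) *
       (4 ^ (win k + 1) * (real (card {0..25 * fact k :: int}) * real (card (small_sum_lists t ?d)))))"
      by (simp only: card_cartesian_product of_nat_mult all_words(2) of_nat_power of_nat_numeral)
    also have "\<dots> \<le> ?b"
      unfolding 3 using 1 2 by (intro mult_mono) auto
    finally show ?thesis .
  qed
  have "card (code k n ` dyck.D) \<le> card (SIGMA t:{..n + 25}. ?C t)"
    by (rule card_mono[OF finite_SigmaI[OF finite_atMost fin] sub])
  also have "\<dots> = (\<Sum>t\<in>{..n + 25}. card (?C t))" by (rule card_SigmaI) (simp, intro ballI fin)
  finally have "real (card (code k n ` dyck.D)) \<le> (\<Sum>t\<in>{..n + 25}. real (card (?C t)))"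
    by (simp only: of_nat_le_iff of_nat_sum[symmetric])
  also have "\<dots> \<le> (\<Sum>t\<in>{..n + 25}. ?b)" by (intro sum_mono C) simp
  also have "\<dots> = (real n + 26) * ?b" by simp
  finally show "card (code k n ` dyck.D) \<le> (real n + 26) * ?b" .
qed

lemma eventually_card_code:
  assumes e: "0 < e"
  shows "\<exists>k0. \<forall>k\<ge>k0. \<forall>\<^sub>F n in sequentially. ln (card (code k n ` dyck.D)) \<le> n * (ln 3 + e)"
proof -
  \<comment> \<open>Chosen so that the factor (1 / (1 - z))^n costs e / 4 per unit of time.\<close>
  define z where "z = 1 - exp (- (e / 4))"
  have z: "0 < z" "z < 1" using e by (simp_all add: z_def)
  have l1: "ln (1 / (1 - z)) = e / 4" by (simp add: z_def ln_div)
  define c where "c = ln (1 / z)"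
  have c: "0 < c" unfolding c_def using z by (intro ln_gt_zero) simp
  \<comment> \<open>Makes 24 c / (k + 1) at most e / 4. The choice of k comes after that of z
    because c grows without bound as z tends to 0.\<close>
  obtain k0 :: nat where k0: "96 * c / e < k0" using reals_Archimedean2 by blast
  have "\<forall>\<^sub>F n in sequentially. ln (card (code k n ` dyck.D)) \<le> n * (ln 3 + e)" if k: "k0 \<le> k" for k
  proof -
    have "96 * c / e \<le> real k + 1" using k0 k by linarith
    then have "96 * c \<le> (real k + 1) * e" using e by (simp add: pos_divide_le_eq)
    then have ck: "24 / (real k + 1) * c \<le> e / 4" by (simp add: field_simps)
    \<comment> \<open>Collects all contributions that do not grow with n; the two factors n + 26,
      each at most 27 n, leave 2 ln n besides.\<close>
    define C where "C = win k * ln 4 + ln 2 + 25 * ln 3 + (win k + 1) * ln 4 + ln (25 * fact k + 1)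
      + 25 * (e / 4) + c + 25 * (e / 4) + 2 * ln 27"
    have "(\<lambda>n. C / real n + 2 * (ln (real n) / real n)) \<longlonglongrightarrow> 0 + 2 * 0"
      by (intro tendsto_add tendsto_mult tendsto_const lim_ln_over_n lim_const_over_n)
    then have "\<forall>\<^sub>F n in sequentially. C / real n + 2 * (ln (real n) / real n) < e / 2"
      using e by (intro order_tendstoD(2)) auto
    then show ?thesis
      using eventually_gt_at_top[of 0]
    proof eventually_elim
      case (elim n)
      have n: "0 < real n" using elim by simp
      have "(C + 2 * ln n) / n < e / 2" using elim(1) by (simp add: add_divide_distrib)
      then have Cn: "C + 2 * ln n \<le> n * (e / 2)" using n by (simp add: pos_divide_less_eq mult.commute)
      let ?N = "card (code k n ` dyck.D)"
      let ?b = "(real n + 26) * (4 ^ win k * (2 * (real n + 26) * 3 powr (real n + 25) *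
         (4 ^ (win k + 1) * ((25 * fact k + 1) *
         ((1 / z) powr ((real n + 25) * (24 / (real k + 1)) + 1) * (1 / (1 - z)) ^ (n + 25))))))"
      show "ln ?N \<le> n * (ln 3 + e)"
      proof (cases "?N = 0")
        case False
        have "ln ?N \<le> ln ?b"
          using False card_code_image(2)[OF z, of k n] by (intro ln_mono) auto
        also have "\<dots> = ln (real n + 26) + (win k * ln 4 + (ln 2 + ln (real n + 26) + (real n + 25) * ln 3 +
           ((win k + 1) * ln 4 + (ln (25 * fact k + 1) +
           (((real n + 25) * (24 / (real k + 1)) + 1) * c + (n + 25) * (e / 4))))))"
        proof -
          have p: "0 < (25 * fact k + 1 :: real)" by (simp add: add_pos_pos)
          define m where "m = real n + 26"
          have m: "0 < m" by (simp add: m_def)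
          show ?thesis unfolding m_def[symmetric]
            using z p m by (simp add: ln_mult_pos ln_realpow ln_powr l1 c_def[symmetric] del: power_Suc)
        qed
        also have "ln (real n + 26) \<le> ln 27 + ln n"
        proof -
          have "ln (real n + 26) \<le> ln (27 * real n)" using elim by (intro ln_mono) auto
          then show ?thesis using n by (simp add: ln_mult_pos)
        qed
        also have "((real n + 25) * (24 / (real k + 1)) + 1) * c \<le> (real n + 25) * (e / 4) + c"
          using mult_left_mono[OF ck, of "real n + 25"] by (simp add: algebra_simps)
        finally show ?thesis using Cn by (simp add: C_def algebra_simps)
      qed (use e in \<open>simp add: add_nonneg_nonneg\<close>)
    qed
  qed
  then show ?thesis by blast
qed

text \<open>\<open>N\<close> is pushed to the product space by \<open>rep\<close>, where each set of
  \<open>P\<close> is a union of label classes up to small measure. The label then predicts the cell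
  up to a small error probability, and label names are counted by codes.\<close>

theorem entropy_upper_bound:
  assumes N: "flow_invariant_measure dyck.T dyck.\<phi> N"
  shows "flow_entropy dyck.\<phi> N \<le> ereal (ln 3)"
  unfolding flow_entropy_def ks_entropy_def
proof (rule SUP_least, elim CollectE conjE, unfold ereal_less_eq)
  fix P assume P: "finite P" "P \<subseteq> sets N" "partition_on (space N) P"
  have sets_N: "sets N = sets (borel_of dyck.T)" and space_N: "space N = dyck.cls ` dyck.D"
    using N by (auto simp: flow_invariant_measure_def dyck.topspace_T)
  interpret prob_space N using N by (simp add: flow_invariant_measure_def)
  interpret partitioned_system N "dyck.\<phi> 1" P
    by unfold_locales (use N P in \<open>auto simp: flow_invariant_measure_def\<close>)
  have rep [measurable]: "dyck.rep \<in> N \<rightarrow>\<^sub>M borel"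
    using dyck.rep_measurable measurable_cong_sets[OF sets_N refl] by blast
  have rep_D: "dyck.rep y \<in> dyck.D" "dyck.cls (dyck.rep y) = y" if "y \<in> space N" for y
    using that unfolding space_N by auto
  show "entropy_wrt_partition N (dyck.\<phi> 1) P \<le> ln 3"
  proof (rule entropy_le)
    fix e :: real assume e: "0 < e"
    define M where "M = distr N borel dyck.rep"
    have M: "finite_measure M" "sets M = sets borel"
      unfolding M_def by (auto intro!: finite_measure_distr)
    define G where "G B = {p \<in> dyck.D. dyck.cls p \<in> B}" for B
    have G: "G B \<in> sets borel" if "B \<in> P" for B
      unfolding G_def using that P sets_N by (intro dyck.cls_vimage_sets) auto
    define E where "E k S B = (G B - label k -` S) \<union> (label k -` S - G B)" for k S B
    \<comment> \<open>The summand 1 keeps the sum of the card P errors strictly below e.\<close>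
    have "0 < e / (card P + 1)" using e by simp
    then have "\<forall>B\<in>P. \<exists>k0. \<forall>k\<ge>k0. \<exists>S. measure M (E k S B) < e / (card P + 1)"
      using label_approximates_borel[OF M] G M unfolding E_def by (simp add: M_def)
    then obtain kk where kk: "\<And>B k. B \<in> P \<Longrightarrow> kk B \<le> k \<Longrightarrow> \<exists>S. measure M (E k S B) < e / (card P + 1)"
      by metis
    obtain k0 where k0: "\<And>k. k0 \<le> k \<Longrightarrow> \<forall>\<^sub>F n in sequentially. ln (card (code k n ` dyck.D)) \<le> n * (ln 3 + e)"
      using eventually_card_code[OF e] by blast
    define k where "k = Max (insert k0 (kk ` P))"
    have "kk B \<le> k" if "B \<in> P" for B
      unfolding k_def using P(1) that by (auto intro: Max_ge)
    have "k0 \<le> k" unfolding k_def using P(1) by (intro Max_ge) auto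
    have "\<forall>B\<in>P. \<exists>S. measure M (E k S B) < e / (card P + 1)"
      using kk \<open>\<And>B. B \<in> P \<Longrightarrow> kk B \<le> k\<close> by blast
    then obtain S where S: "\<And>B. B \<in> P \<Longrightarrow> measure M (E k (S B) B) < e / (card P + 1)" by metis
    define lab where "lab y = label k (dyck.rep y)" for y
    \<comment> \<open>The predictor picks any set whose approximation contains the label. The
      default {} is never a member of a partition, so it counts as an error.\<close>
    define g where "g l = (if \<exists>B\<in>P. l \<in> S B then SOME B. B \<in> P \<and> l \<in> S B else {})" for l
    have lab: "lab \<in> N \<rightarrow>\<^sub>M count_space UNIV"
      unfolding lab_def by (rule measurable_compose[OF rep label_measurable])
    have E_sets: "E k (S B) B \<in> sets borel" if "B \<in> P" for B
      unfolding E_def using G[OF that] measurable_sets[OF label_measurable, of "S B" k] by auto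
    have rep_E: "dyck.rep -` E k (S B) B \<inter> space N \<in> sets N" if "B \<in> P" for B
      by (rule measurable_sets[OF rep E_sets[OF that]])
    let ?err = "{y \<in> space N. cell y \<noteq> g (lab y)}"
    have err_eq: "?err = (\<Union>B\<in>P. B \<inter> (lab -` {l. g l \<noteq> B} \<inter> space N))"
    proof (intro equalityI subsetI)
      fix y assume "y \<in> ?err"
      then show "y \<in> (\<Union>B\<in>P. B \<inter> (lab -` {l. g l \<noteq> B} \<inter> space N))"
        using cell_in[of y] in_cell[of y] by (intro UN_I[of "cell y"]) auto
    qed (auto simp: cell_eq)
    have err: "?err \<in> sets N"
      unfolding err_eq
    proof (rule sets.finite_UN[OF P(1)])
      fix B assume "B \<in> P"
      then have "B \<in> sets N" using P(2) by blast
      moreover have "lab -` {l. g l \<noteq> B} \<inter> space N \<in> sets N" by (rule measurable_sets[OF lab]) simp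
      ultimately show "B \<inter> (lab -` {l. g l \<noteq> B} \<inter> space N) \<in> sets N" by (rule sets.Int)
    qed
    \<comment> \<open>At a wrong prediction the point lies either in its own cell but outside its
      approximation, or in the approximation of the predicted set but outside that set.\<close>
    have "?err \<subseteq> (\<Union>B\<in>P. dyck.rep -` E k (S B) B \<inter> space N)"
    proof
      fix y assume y: "y \<in> ?err"
      then have c: "cell y \<in> P" "y \<in> cell y" and yN: "y \<in> space N"
        using cell_in in_cell by auto
      have Gy: "dyck.rep y \<in> G B \<longleftrightarrow> y \<in> B" for B
        using rep_D[OF yN] by (simp add: G_def)
      show "y \<in> (\<Union>B\<in>P. dyck.rep -` E k (S B) B \<inter> space N)"
      proof (cases "lab y \<in> S (cell y)")
        case False
        then have "dyck.rep y \<in> E k (S (cell y)) (cell y)"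
          using Gy[of "cell y"] c unfolding E_def lab_def by auto
        with c yN show ?thesis by auto
      next
        case True
        then have ex: "\<exists>B. B \<in> P \<and> lab y \<in> S B" using c by blast
        have "g (lab y) = (SOME B. B \<in> P \<and> lab y \<in> S B)" unfolding g_def using ex by (auto intro: if_P)
        with someI_ex[OF ex] have gy: "g (lab y) \<in> P" "lab y \<in> S (g (lab y))" by auto
        then have "y \<notin> g (lab y)" using y cell_eq by auto
        then have "dyck.rep y \<in> E k (S (g (lab y))) (g (lab y))"
          using Gy gy unfolding E_def lab_def by auto
        with gy yN show ?thesis by auto
      qed
    qed
    then have "prob ?err \<le> prob (\<Union>B\<in>P. dyck.rep -` E k (S B) B \<inter> space N)"
      by (rule finite_measure_mono[OF _ sets.finite_UN[OF P(1) rep_E]])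
    also have "\<dots> \<le> (\<Sum>B\<in>P. prob (dyck.rep -` E k (S B) B \<inter> space N))"
      by (rule finite_measure_subadditive_finite[OF P(1)]) (rule image_subsetI, rule rep_E)
    also have "\<dots> = (\<Sum>B\<in>P. measure M (E k (S B) B))"
      unfolding M_def using E_sets by (intro sum.cong refl) (simp add: measure_distr)
    also have "\<dots> \<le> (\<Sum>B\<in>P. e / (card P + 1))" using S by (intro sum_mono less_imp_le)
    also have "\<dots> < e" using e by (simp add: field_simps)
    finally have small: "prob ?err < e" .
    have names: "finite (label_names lab n) \<and> card (label_names lab n) \<le> card (code k n ` dyck.D)" for n
    proof -
      define F where "F p = (\<lambda>j\<in>{..<n}. lab ((dyck.\<phi> 1 ^^ j) (dyck.cls p)))" for p
      have eq: "label_names lab n = F ` dyck.D" unfolding label_names_def space_N image_image F_def ..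
      have fin: "finite (code k n ` dyck.D)" by (rule card_code_image(1)[of "1/2"]) auto
      have det: "F p = F q" if "p \<in> dyck.D" "q \<in> dyck.D" "code k n p = code k n q" for p q
      proof -
        have "lab ((dyck.\<phi> 1 ^^ j) (dyck.cls p)) = lab ((dyck.\<phi> 1 ^^ j) (dyck.cls q))" if "j < n" for j
          using code_determines_labels[of "fst p" "snd p" "fst q" "snd q" k n j] that
            \<open>p \<in> dyck.D\<close> \<open>q \<in> dyck.D\<close> \<open>code k n p = code k n q\<close>
          unfolding lab_def prod.collapse by blast
        then show ?thesis unfolding F_def by (intro restrict_ext) simp
      qed
      from card_image_le_of_determines[of "code k n" dyck.D F, OF fin det]
      show ?thesis unfolding eq by blast
    qed
    have "\<forall>\<^sub>F n in sequentially. finite (label_names lab n) \<and> ln (card (label_names lab n)) \<le> n * (ln 3 + e)"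
      using k0[OF \<open>k0 \<le> k\<close>]
    proof eventually_elim
      case (elim n)
      have "label_names lab n \<noteq> {}" using not_empty by (auto simp: label_names_def)
      then have "ln (card (label_names lab n)) \<le> ln (card (code k n ` dyck.D))"
        using names[of n] by (intro ln_mono) (auto simp: card_gt_0_iff)
      with elim names[of n] show ?case by linarith
    qed
    with err small show "\<exists>(lab :: _ \<Rightarrow> nat list \<times> int) g. {y \<in> space N. cell y \<noteq> g (lab y)} \<in> sets N \<and>
     prob {y \<in> space N. cell y \<noteq> g (lab y)} < e \<and>
     (\<forall>\<^sub>F n in sequentially. finite (label_names lab n) \<and> ln (card (label_names lab n)) \<le> n * (ln 3 + e))"
      by (intro exI[of _ lab] exI[of _ g] conjI)
  qed
qed

subsection \<open>Two codings of the Dyck shift\<close>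

text \<open>Letters 0 and 1 are opening brackets of the two kinds, everything else is a closing bracket,
  which takes the kind of its partner. Closing brackets without a partner become 2.\<close>

definition closings :: "(int \<Rightarrow> nat) \<Rightarrow> int \<Rightarrow> nat" where
  "closings w j = (if w j < 2 then w j
     else if \<exists>p. matched w p j then w (THE p. matched w p j) + 2 else 2)"

lemma closings_open: "w j < 2 \<Longrightarrow> closings w j = w j"
  by (simp add: closings_def)

lemma closings_matched: "matched w p j \<Longrightarrow> closings w j = w p + 2"
proof -
  assume m: "matched w p j"
  then have "(THE p. matched w p j) = p" using matched_unique by (intro the_equality)
  moreover have "\<not> w j < 2" using matched_step(2)[OF m] by (simp add: step_def split: if_splits)
  ultimately show ?thesis using m unfolding closings_def by auto
qed

lemma closings_unmatched: "\<not> w j < 2 \<Longrightarrow> \<not> (\<exists>p. matched w p j) \<Longrightarrow> closings w j = 2"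
  by (simp add: closings_def)

lemma closings_cases:
  obtains "w j < 2" "closings w j = w j"
  | p where "\<not> w j < 2" "matched w p j" "w p < 2" "closings w j = w p + 2"
  | "\<not> w j < 2" "\<not> (\<exists>p. matched w p j)" "closings w j = 2"
proof (cases "w j < 2")
  case False
  show ?thesis
  proof (cases "\<exists>p. matched w p j")
    case True
    then obtain p where p: "matched w p j" by blast
    have "w p < 2" using matched_step(1)[OF p] by (simp add: step_def split: if_splits)
    with p False closings_matched[OF p] that(2) show ?thesis by blast
  qed (use False closings_unmatched that(3) in blast)
qed (use closings_open that(1) in blast)

lemma step_closings: "step (closings w j) = step (w j)"
  by (rule closings_cases[of w j]) (auto simp: step_def)

lemma min_closings: "min 2 (closings w j) = min 2 (w j)"
  by (rule closings_cases[of w j]) auto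

lemma closings_alph: "closings w j \<in> {0,1,2,3}"
  by (rule closings_cases[of w j]) auto

text \<open>Recolouring closing brackets changes no steps and hence no matching.\<close>

lemma closings_dyck: "closings w \<in> dyck"
proof -
  have "closings w q = closings w p + 2" if "matched (closings w) p q" for p q
  proof -
    have m: "matched w p q" using that matched_cong[of p q "closings w" w] step_closings by blast
    have "w p < 2" using matched_step(1)[OF m] by (simp add: step_def split: if_splits)
    then show ?thesis using closings_matched[OF m] closings_open by simp
  qed
  then show ?thesis unfolding dyck_def using closings_alph by blast
qed

lemma closings_shift: "closings (shift_iter n w) = shift_iter n (closings w)"
proof
  fix j
  have s: "shift_iter n w i = w (i + n)" for i by (simp add: shift_iter_def)
  have "closings (shift_iter n w) j = closings w (j + n)"
  proof (rule closings_cases[of w "j + n"])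
    assume "w (j + n) < 2" "closings w (j + n) = w (j + n)"
    then show ?thesis using closings_open[of "shift_iter n w" j] by (simp add: s)
  next
    fix p assume "matched w p (j + n)" "closings w (j + n) = w p + 2"
    then show ?thesis using closings_matched[of "shift_iter n w" "p - n" j] by (simp add: matched_shift s)
  next
    assume "\<not> w (j + n) < 2" "\<not> (\<exists>p. matched w p (j + n))" "closings w (j + n) = 2"
    then show ?thesis using closings_unmatched[of "shift_iter n w" j] by (simp add: matched_shift s)
  qed
  then show "closings (shift_iter n w) j = shift_iter n (closings w) j" by (simp add: shift_iter_def)
qed

lemma open_local:
  fixes P :: "(int \<Rightarrow> 'a::discrete_topology) \<Rightarrow> bool"
  assumes "\<And>x y. P x \<Longrightarrow> (\<And>i. a \<le> i \<Longrightarrow> i \<le> b \<Longrightarrow> x i = y i) \<Longrightarrow> P y"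
  shows "open {x. P x}"
proof (subst open_subopen, intro ballI)
  fix x assume x: "x \<in> {x. P x}"
  let ?U = "\<Inter>i\<in>{a..b}. {y. y i \<in> {x i}}"
  have "open ?U" by (intro open_INT ballI open_coord) auto
  moreover have "?U \<subseteq> {x. P x}"
  proof
    fix y assume "y \<in> ?U"
    then have eq: "x i = y i" if "a \<le> i" "i \<le> b" for i using that by auto
    have "P y" by (rule assms[of x y]) (use x eq in auto)
    then show "y \<in> {x. P x}" by simp
  qed
  ultimately show "\<exists>T. open T \<and> x \<in> T \<and> T \<subseteq> {x. P x}" by (intro exI[of _ ?U]) auto
qed

lemma open_matched: "open {x. matched x p q \<and> Q (x p) (x q)}"
proof (rule open_local[where a = p and b = q])
  fix x y :: "int \<Rightarrow> nat"
  assume x: "matched x p q \<and> Q (x p) (x q)" and xy: "\<And>i. p \<le> i \<Longrightarrow> i \<le> q \<Longrightarrow> x i = y i"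
  have "matched y p q" using x xy matched_cong[of p q x y] by metis
  moreover have "p < q" using x by (simp add: matched_def)
  then have "x p = y p" "x q = y q" by (simp_all add: xy)
  ultimately show "matched y p q \<and> Q (y p) (y q)" using x by simp
qed

text \<open>The partner may lie arbitrarily far to the left, so \<open>closings\<close> is not
  continuous. But each coordinate is decided by countably many open conditions, one for each
  possible partner.\<close>

lemma closings_measurable: "closings \<in> borel \<rightarrow>\<^sub>M borel"
proof (rule measurable_coordinatewise_then_product)
  fix j :: int
  have m: "{w. matched w p j \<and> Q (w p) (w j)} \<in> sets borel" for p Q
    by (rule borel_open[OF open_matched])
  have c: "{w :: int \<Rightarrow> nat. w j \<in> V} \<in> sets borel" for V
    by (rule borel_open[OF open_coord])
  have iff: "closings w j = v \<longleftrightarrow> w j \<in> {v} \<inter> {..<2} \<or> (\<exists>p. matched w p j \<and> w p + 2 = v) \<or>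
      (w j \<in> (if v = 2 then - {..<2} else {}) \<and> \<not> (\<exists>p. matched w p j \<and> True))" for v w
  proof (cases "w j < 2")
    case True
    have "\<not> matched w p j" for p
      using True matched_step(2)[of w p j] by (auto simp: step_def)
    then show ?thesis using True closings_open[of w j] by auto
  next
    case False
    show ?thesis
    proof (cases "\<exists>p. matched w p j")
      case True
      then obtain p where p: "matched w p j" by blast
      have "(\<exists>p. matched w p j \<and> w p + 2 = v) \<longleftrightarrow> w p + 2 = v"
        using p matched_unique[OF p] by metis
      then show ?thesis using False p closings_matched[OF p] by auto
    next
      case none: False
      show ?thesis unfolding closings_unmatched[of w j, OF False none] using False none by auto
    qed
  qed
  have "{w. closings w j = v} \<in> sets borel" for v
  proof -
    have "{w. closings w j = v} = {w. w j \<in> {v} \<inter> {..<2}} \<union> (\<Union>p. {w. matched w p j \<and> w p + 2 = v}) \<union>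
      ({w. w j \<in> (if v = 2 then - {..<2} else {})} - (\<Union>p. {w. matched w p j \<and> True}))"
      unfolding iff by blast
    also have "\<dots> \<in> sets borel"
      by (intro sets.Un sets.Diff sets.countable_UN'' c m) auto
    finally show ?thesis .
  qed
  then have "(\<lambda>w. closings w j) \<in> borel \<rightarrow>\<^sub>M count_space UNIV"
    by (subst measurable_count_space_eq_countable) (auto simp: vimage_def)
  then show "(\<lambda>w. closings w j) \<in> borel \<rightarrow>\<^sub>M borel"
    by (rule measurable_compose) simp
qed

lemma abs_ht_le: "i \<le> j \<Longrightarrow> \<bar>ht x i j\<bar> \<le> j - i"
proof (induction j rule: int_ge_induct)
  case (step j)
  then have "ht x i (j + 1) = ht x i j + step (x j)" using ht_add[of i j "j + 1" x] by simp
  moreover have "\<bar>ht x i j\<bar> \<le> j - i" using step.IH .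
  ultimately show ?case using step_cases[of "x j"] by linarith
qed simp

text \<open>The closing brackets of the window that are unmatched within it are the first passages of
  the height, seen from the left end \<open>- n\<close>, to the levels \<open>- 1, - 2, \<dots>\<close>. Placing the
  corresponding opening brackets at the positions \<open>- n - 1, - n - 2, \<dots>\<close> gives all of them partners
  of the right kind.\<close>

lemma closings_dense:
  assumes x: "x \<in> dyck"
  shows "\<exists>w0 m. (\<forall>i. w0 i \<in> {0,1,2}) \<and>
    (\<forall>w. (\<forall>i. - int m \<le> i \<and> i \<le> int m \<longrightarrow> w i = w0 i) \<longrightarrow>
      (\<forall>j. - int n \<le> j \<and> j \<le> int n \<longrightarrow> closings w j = x j))"
proof -
  have alph: "x i \<in> {0,1,2,3}" for i using x unfolding dyck_def by blast
  have leg: "x q = x p + 2" if "matched x p q" for p q using x that unfolding dyck_def by blast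
  define N where "N = - int n"
  define passage where "passage c q \<longleftrightarrow> N \<le> q \<and> ht x N (q + 1) = - c \<and>
    (\<forall>r. N < r \<and> r \<le> q \<longrightarrow> - c < ht x N r)" for c q
  have uniq: "q = q'" if "passage c q" "passage c q'" for c q q'
  proof -
    have *: False if "passage c q" "passage c q'" "q < q'" for q q'
    proof -
      have "N < q + 1 \<and> q + 1 \<le> q'" using that(1,3) unfolding passage_def by linarith
      then have "- c < ht x N (q + 1)" using that(2) unfolding passage_def by blast
      then show False using that(1) unfolding passage_def by linarith
    qed
    show ?thesis
    proof (rule ccontr)
      assume "q \<noteq> q'"
      then have "q < q' \<or> q' < q" by linarith
      with *[OF that] *[OF that(2,1)] show False by blast
    qed
  qed
  \<comment> \<open>Places left of the window that serve as nobody's partner get the opening bracket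
    0, so the height rises by 1 at every one of them.\<close>
  define w0 where "w0 i = (if N \<le> i then min 2 (x i)
    else if \<exists>q. passage (N - i) q \<and> 2 \<le> x q then x (THE q. passage (N - i) q) - 2 else 0)" for i
  have w0_low: "w0 i \<in> {0,1}" if "i < N" for i
  proof -
    have sub: "x q - 2 \<in> {0,1}" for q using alph[of q] by auto
    have nl: "\<not> N \<le> i" using that by simp
    show ?thesis
    proof (cases "\<exists>q. passage (N - i) q \<and> 2 \<le> x q")
      case True
      show ?thesis unfolding w0_def if_not_P[OF nl] if_P[OF True] by (rule sub)
    next
      case False
      show ?thesis unfolding w0_def if_not_P[OF nl] if_not_P[OF False] by simp
    qed
  qed
  have w0: "w0 i \<in> {0,1,2}" for i
  proof (cases "N \<le> i")
    case True
    show ?thesis unfolding w0_def if_P[OF True] using alph[of i] by auto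
  next
    case False
    then have "w0 i \<in> {0,1}" by (intro w0_low) simp
    then show ?thesis by blast
  qed
  \<comment> \<open>At most 2 n + 1 brackets of the window lack a partner inside it, so partners
    reach down to -3 n - 1 at most.\<close>
  define m where "m = 3 * n + 2"
  have "closings w j = x j"
    if w: "\<forall>i. - int m \<le> i \<and> i \<le> int m \<longrightarrow> w i = w0 i" and j: "- int n \<le> j" "j \<le> int n" for w j
  proof -
    have ww: "w i = w0 i" if "- int m \<le> i" "i \<le> int n" for i
      using w that by (simp add: m_def)
    have wx: "w i = min 2 (x i)" if "N \<le> i" "i \<le> int n" for i
      using ww[of i] that by (simp add: N_def m_def w0_def)
    have st: "step (w i) = step (x i)" if "N \<le> i" "i \<le> int n" for i
      unfolding wx[OF that] by (simp add: step_def)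
    have Nj: "N \<le> j" using j by (simp add: N_def)
    show ?thesis
    proof (cases "x j < 2")
      case True
      then have "w j = x j" using wx[OF Nj j(2)] by simp
      then show ?thesis using closings_open[of w j] True by simp
    next
      case close: False
      then have sj: "step (x j) = - 1" by (simp add: step_def)
      show ?thesis
      proof (cases "\<exists>p\<ge>N. matched x p j")
        case True
        then obtain p where p: "N \<le> p" "matched x p j" by blast
        have pj: "p < j" using p(2) by (simp add: matched_def)
        have "matched w p j" using p j by (subst matched_cong[of p j w x]) (auto intro!: st)
        then have "closings w j = w p + 2" by (rule closings_matched)
        moreover have "x p < 2" using matched_step(1)[OF p(2)] by (simp add: step_def split: if_splits)
        ultimately show ?thesis using wx[of p] p(1) pj j leg[OF p(2)] by simp
      next
        case False
        have neg: "ht x k (j + 1) < 0" if "N \<le> k" "k \<le> j" for k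
        proof (rule ccontr)
          assume "\<not> ht x k (j + 1) < 0"
          then have "0 \<le> ht x k (j + 1)" by simp
          from ex_match_left[OF sj that(2) this] show False using False that(1) by (meson order_trans)
        qed
        define c where "c = - ht x N (j + 1)"
        have c: "1 \<le> c" "c \<le> 2 * int n + 1"
          using neg[of N] Nj abs_ht_le[of N "j + 1" x] j unfolding c_def N_def by linarith+
        have low: "- c < ht x N r" if "N < r" "r \<le> j" for r
          using ht_add[of N r "j + 1" x] neg[of r] that unfolding c_def by linarith
        have pass: "passage c j"
          using Nj low unfolding passage_def c_def by simp
        define p where "p = N - c"
        have pm: "- int m \<le> p" "p < N" using c unfolding p_def m_def N_def by linarith+
        have the: "(THE q. passage c q) = j" using pass uniq by (intro the_equality)
        have ex: "\<exists>q. passage c q \<and> 2 \<le> x q" using pass close by (intro exI[of _ j]) simp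
        have "N - p = c" by (simp add: p_def)
        then have "w0 p = x j - 2" unfolding w0_def using pm(2) the ex by simp
        then have wp: "w p = x j - 2" using ww[of p] pm N_def by simp
        have up: "ht w p r = r - p" if "p \<le> r" "r \<le> N" for r
        proof -
          have "ht w p r = (\<Sum>k\<in>{p..<r}. 1)"
            unfolding ht_def
          proof (rule sum.cong)
            fix k assume k: "k \<in> {p..<r}"
            then have "w k = w0 k" using pm that N_def by (intro ww) auto
            moreover have "w0 k \<in> {0,1}" using k that by (intro w0_low) auto
            ultimately show "step (w k) = 1" by (auto simp: step_def)
          qed simp
          then show ?thesis using that by simp
        qed
        have beyond: "ht w p r = c + ht x N r" if "N \<le> r" "r \<le> j + 1" for r
        proof -
          have "ht w p r = ht w p N + ht w N r" using pm that by (intro ht_add) auto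
          moreover have "ht w N r = ht x N r" using that j by (intro ht_cong st) auto
          ultimately show ?thesis using up[of N] pm by (simp add: p_def)
        qed
        have "matched w p j"
          unfolding matched_def
        proof (intro conjI allI impI)
          show "p < j" using pm Nj by linarith
          show "ht w p (j + 1) = 0" using beyond[of "j + 1"] Nj by (simp add: c_def)
          fix r assume r: "p < r \<and> r \<le> j"
          show "0 < ht w p r"
          proof (cases "r \<le> N")
            case True
            then show ?thesis using up[of r] r by simp
          next
            case False
            then show ?thesis using beyond[of r] low[of r] r by simp
          qed
        qed
        then show ?thesis using closings_matched[of w p j] wp close by simp
      qed
    qed
  qed
  then show ?thesis using w0 by (intro exI[of _ w0] exI[of _ m]) blast
qed

section \<open>Time reversal and the second coding\<close>

definition flip :: "nat \<Rightarrow> nat" where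
  "flip v = (if v < 2 then v + 2 else v - 2)"

text \<open>Reversing time turns openings into closings; \<open>flip\<close> exchanges the two roles
  and keeps the kind.\<close>

definition reflect :: "(int \<Rightarrow> nat) \<Rightarrow> int \<Rightarrow> nat" where
  "reflect x i = flip (x (- i))"

lemma flip_in: "v \<in> {0,1,2,3} \<Longrightarrow> flip v \<in> {0,1,2,3}"
  by (auto simp: flip_def)

lemma flip_flip: "v \<in> {0,1,2,3} \<Longrightarrow> flip (flip v) = v"
  by (auto simp: flip_def)

lemma step_flip: "v \<in> {0,1,2,3} \<Longrightarrow> step (flip v) = - step v"
  by (auto simp: flip_def step_def)

text \<open>Steps change sign and the places i to j - 1 go to 1 - j to -i, so an excursion above
  level 0 read backwards is again one.\<close>

lemma matched_reflect:
  assumes x: "x \<in> \<Sigma>\<^sub>4" and m: "matched (reflect x) p q"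
  shows "matched x (- q) (- p)"
proof -
  have ht: "ht (reflect x) i j = - ht x (1 - j) (1 - i)" for i j
  proof -
    have "ht (reflect x) i j = (\<Sum>k\<in>{i..<j}. - step (x (- k)))"
      unfolding ht_def reflect_def by (intro sum.cong refl step_flip Sigma4D[OF x])
    also have "\<dots> = (\<Sum>k\<in>{1 - j..<1 - i}. - step (x k))"
      by (rule sum.reindex_bij_betw[of "\<lambda>k. - k"], rule bij_betwI[of _ _ _ "\<lambda>k. - k"]) auto
    finally show ?thesis by (simp add: ht_def sum_negf)
  qed
  have z: "ht x (- q) (- p + 1) = 0" and pq: "p < q"
    using m ht[of p "q + 1"] by (auto simp: matched_def)
  have "0 < ht x (- q) r" if r: "- q < r" "r \<le> - p" for r
  proof -
    have "0 < ht (reflect x) p (1 - r)" using m r unfolding matched_def by auto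
    then have "ht x r (1 - p) < 0" using ht[of p "1 - r"] by simp
    then show ?thesis using ht_add[of "- q" r "1 - p" x] z r by simp
  qed
  then show ?thesis using z pq unfolding matched_def by simp
qed

lemma reflect_dyck:
  assumes "x \<in> dyck"
  shows "reflect x \<in> dyck"
proof -
  have x: "x \<in> \<Sigma>\<^sub>4" using assms unfolding dyck_def by blast
  have "reflect x q = reflect x p + 2" if "matched (reflect x) p q" for p q
  proof -
    have m: "matched x (- q) (- p)" by (rule matched_reflect[OF x that])
    then have "x (- p) = x (- q) + 2" using assms unfolding dyck_def by blast
    moreover have "x (- q) < 2" using matched_step(1)[OF m] by (simp add: step_def split: if_splits)
    ultimately show ?thesis by (simp add: reflect_def flip_def)
  qed
  moreover have "reflect x i \<in> {0,1,2,3}" for i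
    unfolding reflect_def by (rule flip_in[OF Sigma4D[OF x]])
  ultimately show ?thesis unfolding dyck_def by blast
qed

text \<open>Letters 0 and 1 become closing brackets of the two kinds; every other letter becomes an
  opening bracket with the kind of its partner to the right, or 0 if it has none.\<close>

definition openings :: "(int \<Rightarrow> nat) \<Rightarrow> int \<Rightarrow> nat" where
  "openings w = reflect (closings (\<lambda>i. w (- i)))"

text \<open>Plays for \<open>openings\<close> the role that \<open>min 2\<close> plays for
  \<open>closings\<close>; the cap keeps its values at most 2 on all naturals.\<close>

definition close_kind :: "nat \<Rightarrow> nat" where
  "close_kind v = (if v < 2 then 2 else min 2 (v - 2))"

lemma openings_dyck: "openings w \<in> dyck"
  unfolding openings_def by (rule reflect_dyck[OF closings_dyck])

lemma openings_shift: "openings (shift_iter n w) = shift_iter n (openings w)"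
proof -
  have "(\<lambda>i. shift_iter n w (- i)) = shift_iter (- n) (\<lambda>i. w (- i))"
    by (simp add: shift_iter_def algebra_simps)
  then have "openings (shift_iter n w) = reflect (shift_iter (- n) (closings (\<lambda>i. w (- i))))"
    by (simp only: openings_def closings_shift)
  also have "\<dots> = shift_iter n (reflect (closings (\<lambda>i. w (- i))))"
    by (simp add: reflect_def shift_iter_def fun_eq_iff algebra_simps)
  finally show ?thesis unfolding openings_def .
qed

lemma close_kind_openings: "close_kind (openings w j) = min 2 (w j)"
  unfolding openings_def reflect_def
  by (rule closings_cases[of "\<lambda>i. w (- i)" "- j"]) (auto simp: flip_def close_kind_def)

lemma openings_measurable: "openings \<in> borel \<rightarrow>\<^sub>M borel"
proof -
  have neg: "(\<lambda>w i. w (- i)) \<in> (borel :: (int \<Rightarrow> nat) measure) \<rightarrow>\<^sub>M borel"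
    by (rule borel_measurable_continuous_onI[OF continuous_on_coordinatewise_then_product]) simp
  have "reflect \<in> borel \<rightarrow>\<^sub>M borel"
  proof (rule measurable_coordinatewise_then_product)
    fix i :: int
    have "(\<lambda>x :: int \<Rightarrow> nat. x (- i)) \<in> borel \<rightarrow>\<^sub>M borel"
      by (rule borel_measurable_continuous_onI) simp
    moreover have "flip \<in> borel \<rightarrow>\<^sub>M borel"
      by (rule borel_measurable_continuous_onI) (simp add: continuous_on_discrete)
    ultimately show "(\<lambda>x. reflect x i) \<in> borel \<rightarrow>\<^sub>M borel" unfolding reflect_def by (rule measurable_compose)
  qed
  from measurable_compose[OF measurable_compose[OF neg closings_measurable] this]
  show ?thesis unfolding openings_def .
qed

text \<open>This is \<open>closings_dense\<close> for the reflected point, read backwards.\<close>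

lemma openings_dense:
  assumes x: "x \<in> dyck"
  shows "\<exists>w0 m. (\<forall>i. w0 i \<in> {0,1,2}) \<and>
    (\<forall>w. (\<forall>i. - int m \<le> i \<and> i \<le> int m \<longrightarrow> w i = w0 i) \<longrightarrow>
      (\<forall>j. - int n \<le> j \<and> j \<le> int n \<longrightarrow> openings w j = x j))"
proof -
  obtain w0 m where w0: "\<And>i. w0 i \<in> {0,1,2}" and
    m: "\<And>w j. (\<And>i. - int m \<le> i \<Longrightarrow> i \<le> int m \<Longrightarrow> w i = w0 i) \<Longrightarrow> - int n \<le> j \<Longrightarrow> j \<le> int n \<Longrightarrow>
      closings w j = reflect x j"
    using closings_dense[OF reflect_dyck[OF x], of n] by metis
  have "openings w j = x j"
    if "\<forall>i. - int m \<le> i \<and> i \<le> int m \<longrightarrow> w i = w0 (- i)" "- int n \<le> j" "j \<le> int n" for w j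
  proof -
    have "closings (\<lambda>i. w (- i)) (- j) = reflect x (- j)"
      using that by (intro m) auto
    moreover have "x j \<in> {0,1,2,3}" using x unfolding dyck_def by blast
    ultimately show ?thesis using flip_flip unfolding openings_def reflect_def by simp
  qed
  then show ?thesis using w0 by (intro exI[of _ "\<lambda>i. w0 (- i)"] exI[of _ m]) blast
qed

subsection \<open>The Bernoulli measure\<close>

abbreviation letter :: "nat measure" where
  "letter \<equiv> measure_pmf (pmf_of_set {0,1,2})"

definition bern :: "(int \<Rightarrow> nat) measure" where
  "bern = Pi\<^sub>M UNIV (\<lambda>_. letter)"

interpretation letters: product_prob_space "\<lambda>_ :: int. letter" UNIV ..

interpretation bern: prob_space bern
  unfolding bern_def by (rule prob_space_PiM) (rule measure_pmf.prob_space_axioms)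

text \<open>Letters and index set are countable, so the product sigma-algebra is the Borel
  one.\<close>

lemma sets_bern [measurable_cong]: "sets bern = sets borel"
proof -
  have "sets bern = sets (Pi\<^sub>M UNIV (\<lambda>_ :: int. borel :: nat measure))"
    unfolding bern_def by (intro sets_PiM_cong) (auto simp: sets_borel_eq_count_space)
  then show ?thesis by (simp add: sets_PiM_equal_borel)
qed

lemma space_bern [simp]: "space bern = UNIV"
  by (simp add: bern_def space_PiM)

lemma measure_letter: "measure letter V = card ({0,1,2} \<inter> V) / 3"
  by (subst measure_pmf_of_set) auto

lemma measure_cylinder:
  assumes "finite J"
  shows "measure bern {w. \<forall>i\<in>J. w i \<in> V i} = (\<Prod>i\<in>J. card ({0,1,2} \<inter> V i) / 3)"
proof -
  have "emeasure bern {w. \<forall>i\<in>J. w i \<in> V i} = (\<Prod>i\<in>J. emeasure letter (V i))"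
    using letters.emeasure_PiM_Collect[of J V] assms by (simp add: bern_def space_PiM)
  also have "\<dots> = ennreal (\<Prod>i\<in>J. measure letter (V i))"
    by (simp add: measure_pmf.emeasure_eq_measure prod_ennreal)
  finally have "measure bern {w. \<forall>i\<in>J. w i \<in> V i} = (\<Prod>i\<in>J. measure letter (V i))"
    by (simp add: bern.emeasure_eq_measure prod_nonneg)
  then show ?thesis by (simp only: measure_letter)
qed

lemma shift_iter_measurable [measurable]: "shift_iter n \<in> bern \<rightarrow>\<^sub>M bern"
proof -
  have "shift_iter n \<in> (borel :: (int \<Rightarrow> nat) measure) \<rightarrow>\<^sub>M borel"
    by (rule borel_measurable_continuous_onI[OF continuous_on_shift_iter])
  then show ?thesis using measurable_cong_sets[OF sets_bern sets_bern] by blast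
qed

lemma distr_shift: "distr bern bern (shift_iter n) = bern"
proof -
  have "distr bern bern (\<lambda>w. \<lambda>i\<in>UNIV. w (i + n)) = bern"
    unfolding bern_def
    by (rule distr_PiM_reindex[of UNIV "\<lambda>_. letter" "\<lambda>i. i + n" UNIV])
      (auto intro: measure_pmf.prob_space_axioms injI)
  moreover have "(\<lambda>w. \<lambda>i\<in>UNIV. w (i + n)) = (shift_iter n :: (int \<Rightarrow> nat) \<Rightarrow> _)"
    by (simp add: fun_eq_iff shift_iter_def restrict_def)
  ultimately show ?thesis by (simp only:)
qed

lemma measure_shift_vimage: "C \<in> sets bern \<Longrightarrow> measure bern (shift_iter n -` C) = measure bern C"
  using measure_distr[OF shift_iter_measurable, of C n] by (simp add: distr_shift)

definition window_word :: "nat \<Rightarrow> (int \<Rightarrow> nat) \<Rightarrow> nat list" where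
  "window_word k w = wd w (- int k) (2 * k + 1)"

lemma window_word_eq_iff: "window_word k w = l \<longleftrightarrow>
    length l = 2 * k + 1 \<and> (\<forall>i\<in>{- int k..int k}. w i \<in> {l ! nat (i + int k)})"
proof -
  have "window_word k w = l \<longleftrightarrow> length l = 2 * k + 1 \<and> (\<forall>j<2 * k + 1. w (- int k + int j) = l ! j)"
    unfolding window_word_def list_eq_iff_nth_eq by auto
  also have "(\<forall>j<2 * k + 1. w (- int k + int j) = l ! j) \<longleftrightarrow>
      (\<forall>i\<in>{- int k..int k}. w i \<in> {l ! nat (i + int k)})"
  proof
    assume *: "\<forall>j<2 * k + 1. w (- int k + int j) = l ! j"
    show "\<forall>i\<in>{- int k..int k}. w i \<in> {l ! nat (i + int k)}"
    proof
      fix i assume "i \<in> {- int k..int k}"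
      then have "nat (i + int k) < 2 * k + 1" "- int k + int (nat (i + int k)) = i" by auto
      then show "w i \<in> {l ! nat (i + int k)}" using *[rule_format, of "nat (i + int k)"] by simp
    qed
  next
    assume *: "\<forall>i\<in>{- int k..int k}. w i \<in> {l ! nat (i + int k)}"
    show "\<forall>j<2 * k + 1. w (- int k + int j) = l ! j"
    proof (intro allI impI)
      fix j assume "j < 2 * k + 1"
      then show "w (- int k + int j) = l ! j" using *[rule_format, of "- int k + int j"] by simp
    qed
  qed
  finally show ?thesis .
qed

lemma cylinder_sets: "finite J \<Longrightarrow> {w. \<forall>i\<in>J. w i \<in> V i} \<in> sets bern"
proof -
  assume J: "finite J"
  have "{w. \<forall>i\<in>J. w i \<in> V i} = (\<Inter>i\<in>J. {w. w i \<in> V i})" by auto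
  moreover have "open (\<Inter>i\<in>J. {w :: int \<Rightarrow> nat. w i \<in> V i})" using J by (intro open_INT ballI open_coord)
  ultimately show ?thesis unfolding sets_bern by simp
qed

lemma window_word_sets: "{w. window_word k w = l} \<in> sets bern"
  unfolding window_word_eq_iff using cylinder_sets[of "{- int k..int k}" "\<lambda>i. {l ! nat (i + int k)}"]
  by (cases "length l = 2 * k + 1") auto

lemma window_word_measurable: "window_word k \<in> bern \<rightarrow>\<^sub>M count_space UNIV"
  by (subst measurable_count_space_eq_countable) (auto simp: vimage_def window_word_sets)

text \<open>Shifting by the window length moves the places -k..k to the disjoint places k + 1..3 k +
  1.\<close>

lemma independent_windows:
  "measure bern ({w. window_word k w = u} \<inter> {w. window_word k (shift_iter (2 * int k + 1) w) = v}) =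
     measure bern {w. window_word k w = u} * measure bern {w. window_word k w = v}"
proof (cases "length u = 2 * k + 1 \<and> length v = 2 * k + 1")
  case False
  then have "{w. window_word k w = u} = {} \<or> {w. window_word k w = v} = {} \<and>
      {w. window_word k (shift_iter (2 * int k + 1) w) = v} = {}"
    by (auto simp: window_word_eq_iff)
  then show ?thesis by auto
next
  case True
  let ?J = "{- int k..int k}" and ?K = "{int k + 1..3 * int k + 1}"
  let ?c = "2 * int k + 1"
  define V where "V i = (if i \<le> int k then {u ! nat (i + int k)} else {v ! nat (i - ?c + int k)})" for i
  have "(\<forall>i\<in>?J. shift_iter ?c w i \<in> {v ! nat (i + int k)}) \<longleftrightarrow> (\<forall>i\<in>?K. w i \<in> V i)" for w
  proof
    assume *: "\<forall>i\<in>?J. shift_iter ?c w i \<in> {v ! nat (i + int k)}"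
    show "\<forall>i\<in>?K. w i \<in> V i"
    proof
      fix i assume "i \<in> ?K"
      then show "w i \<in> V i" using *[rule_format, of "i - ?c"] by (simp add: shift_iter_def V_def)
    qed
  next
    assume *: "\<forall>i\<in>?K. w i \<in> V i"
    show "\<forall>i\<in>?J. shift_iter ?c w i \<in> {v ! nat (i + int k)}"
    proof
      fix i assume "i \<in> ?J"
      then show "shift_iter ?c w i \<in> {v ! nat (i + int k)}"
        using *[rule_format, of "i + ?c"] by (simp add: shift_iter_def V_def)
    qed
  qed
  then have eq: "{w. window_word k w = u} \<inter> {w. window_word k (shift_iter ?c w) = v} =
      {w. \<forall>i\<in>?J \<union> ?K. w i \<in> V i}"
    using True unfolding window_word_eq_iff by (auto simp: V_def)
  have J: "measure bern {w. window_word k w = u} = (\<Prod>i\<in>?J. card ({0,1,2} \<inter> V i) / 3)"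
  proof -
    have "measure bern {w. window_word k w = u} = (\<Prod>i\<in>?J. card ({0,1,2} \<inter> {u ! nat (i + int k)}) / 3)"
      using True measure_cylinder[of ?J "\<lambda>i. {u ! nat (i + int k)}"] unfolding window_word_eq_iff by simp
    also have "\<dots> = (\<Prod>i\<in>?J. card ({0,1,2} \<inter> V i) / 3)"
      by (intro prod.cong refl) (simp add: V_def)
    finally show ?thesis .
  qed
  have "measure bern {w. window_word k w = v} = (\<Prod>i\<in>?J. card ({0,1,2} \<inter> {v ! nat (i + int k)}) / 3)"
    using True measure_cylinder[of ?J "\<lambda>i. {v ! nat (i + int k)}"] unfolding window_word_eq_iff by simp
  also have "\<dots> = (\<Prod>i\<in>?K. card ({0,1,2} \<inter> V i) / 3)"
    by (rule prod.reindex_bij_witness[of _ "\<lambda>i. i - ?c" "\<lambda>i. i + ?c"]) (auto simp: V_def)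
  finally have K: "measure bern {w. window_word k w = v} = (\<Prod>i\<in>?K. card ({0,1,2} \<inter> V i) / 3)" .
  have "measure bern {w. \<forall>i\<in>?J \<union> ?K. w i \<in> V i} = (\<Prod>i\<in>?J \<union> ?K. card ({0,1,2} \<inter> V i) / 3)"
    by (rule measure_cylinder) simp
  also have "\<dots> = (\<Prod>i\<in>?J. card ({0,1,2} \<inter> V i) / 3) * (\<Prod>i\<in>?K. card ({0,1,2} \<inter> V i) / 3)"
    by (rule prod.union_disjoint) auto
  finally show ?thesis unfolding eq J K .
qed

text \<open>\<open>bern\<close> lives on all sequences of naturals; discarding a null set restores a
  finite alphabet.\<close>

lemma bern_full: "{w. \<forall>i. w i \<in> {0,1,2}} \<in> sets bern" "measure bern {w. \<forall>i. w i \<in> {0,1,2}} = 1"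
proof -
  have eq: "{w. \<forall>i. w i \<in> {0,1,2}} = (\<Inter>i. {w :: int \<Rightarrow> nat. w i \<in> {0,1,2}})" by blast
  have s: "{w :: int \<Rightarrow> nat. w i \<in> {0,1,2}} \<in> sets bern" for i
    using cylinder_sets[of "{i}" "\<lambda>_. {0,1,2}"] by simp
  then show F: "{w. \<forall>i. w i \<in> {0,1,2}} \<in> sets bern" unfolding eq by auto
  have "measure bern {w. w i \<in> {0,1,2}} = 1" for i
    using measure_cylinder[of "{i}" "\<lambda>_. {0,1,2}"] by simp
  then have "AE w in bern. w i \<in> {0,1,2}" for i
    using s by (intro bern.AE_I_eq_1) (auto simp: bern.emeasure_eq_measure)
  then have "AE w in bern. \<forall>i. w i \<in> {0,1,2}" by (simp add: AE_all_countable)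
  then have "AE w in bern. w \<in> {w. \<forall>i. w i \<in> {0,1,2}}" by simp
  then show "measure bern {w. \<forall>i. w i \<in> {0,1,2}} = 1"
    by (simp only: bern.AE_in_set_eq_1[OF F])
qed

text \<open>An invariant set of measure p is approximated by a window event A. Its copy moved by one
  window length approximates the set equally well and is independent of A, so p is close to the
  measure of the intersection, which is close to p^2.\<close>

lemma bern_zero_one:
  assumes C: "C \<in> sets bern" and inv: "\<And>n w. shift_iter n w \<in> C \<longleftrightarrow> w \<in> C"
  shows "measure bern C = 0 \<or> measure bern C = 1"
proof -
  define F :: "(int \<Rightarrow> nat) set" where "F = {w. \<forall>i. w i \<in> {0,1,2}}"
  define p where "p = measure bern C"
  have bound: "\<bar>p - p * p\<bar> \<le> 4 * e" if e: "0 < e" for e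
  proof -
    have CF: "C \<inter> F \<in> sets bern" using C bern_full(1) unfolding F_def by (rule sets.Int)
    have "\<exists>k0. \<forall>k\<ge>k0. \<exists>S. measure bern ((C \<inter> F - window_word k -` S) \<union> (window_word k -` S \<inter> space bern - C \<inter> F)) < e"
    proof (rule label_approximation[OF bern.finite_measure_axioms window_word_measurable _ _ _ CF e])
      show "window_word k p = window_word k q" if "window_word (Suc k) p = window_word (Suc k) q" for k p q
        using that unfolding window_word_def wd_eq_iff by simp
      show "sets bern = sigma_sets (space bern) {W. open W}" unfolding sets_bern by (simp add: borel_def)
      show "\<exists>k. {q \<in> space bern. window_word k q = window_word k p} \<subseteq> W" if W: "W \<in> {W. open W}" "p \<in> W" for W p
      proof -
        obtain n :: nat where n: "\<forall>y. (\<forall>i. - int n \<le> i \<and> i \<le> int n \<longrightarrow> y i = p i) \<longrightarrow> y \<in> W"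
          using open_contains_cylinder[OF CollectD[OF W(1)] W(2)] by blast
        have "q \<in> W" if q: "window_word n q = window_word n p" for q
        proof (rule n[rule_format])
          fix i assume "- int n \<le> i \<and> i \<le> int n"
          then show "q i = p i" using q[unfolded window_word_def wd_eq_iff, rule_format, of i] by simp
        qed
        then show ?thesis by blast
      qed
    qed
    then obtain k S where kS: "measure bern ((C \<inter> F - window_word k -` S) \<union> (window_word k -` S - C \<inter> F)) < e"
      by (auto simp: space_bern)
    define W3 :: "nat list set" where "W3 = {l. set l \<subseteq> {0,1,2} \<and> length l = 2 * k + 1}"
    \<comment> \<open>Restriction to three letters makes the set of window words finite, so that the
      measures below are finite sums.\<close>
    define W where "W = S \<inter> W3"
    have finW: "finite W" unfolding W_def W3_def by (intro finite_Int disjI2 finite_lists_length_eq) simp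
    let ?c = "2 * int k + 1"
    define A where "A = window_word k -` W"
    have A_sets: "A \<in> sets bern" using measurable_sets[OF window_word_measurable, of W k] by (simp add: A_def)
    have S_sets: "window_word k -` S \<in> sets bern" using measurable_sets[OF window_word_measurable, of S k] by simp
    have wF: "window_word k w \<in> W3" if "w \<in> F" for w
    proof -
      have "w i \<in> {0,1,2}" for i using that unfolding F_def by blast
      then have "set (window_word k w) \<subseteq> {0,1,2}"
        unfolding window_word_def wd_def set_map by (intro image_subsetI)
      then show ?thesis by (simp add: W3_def window_word_def)
    qed
    have sub: "(C \<inter> F - A) \<union> (A - C \<inter> F) \<subseteq> (C \<inter> F - window_word k -` S) \<union> (window_word k -` S - C \<inter> F)"
      using wF unfolding A_def W_def by blast
    have d: "measure bern ((C \<inter> F - A) \<union> (A - C \<inter> F)) < e"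
      using kS bern.finite_measure_mono[OF sub] CF S_sets by (simp add: sets.Un sets.Diff)
    have mono: "\<bar>measure bern X - measure bern Y\<bar> \<le> measure bern ((X - Y) \<union> (Y - X))"
      if XY: "X \<in> sets bern" "Y \<in> sets bern" for X Y
    proof -
      have "measure bern X \<le> measure bern (Y \<union> ((X - Y) \<union> (Y - X)))"
        using XY by (intro bern.finite_measure_mono) auto
      also have "\<dots> \<le> measure bern Y + measure bern ((X - Y) \<union> (Y - X))"
        using XY by (intro measure_Un_le) auto
      finally have 1: "measure bern X \<le> measure bern Y + measure bern ((X - Y) \<union> (Y - X))" .
      have "measure bern Y \<le> measure bern (X \<union> ((X - Y) \<union> (Y - X)))"
        using XY by (intro bern.finite_measure_mono) auto
      also have "\<dots> \<le> measure bern X + measure bern ((X - Y) \<union> (Y - X))"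
        using XY by (intro measure_Un_le) auto
      finally show ?thesis using 1 by linarith
    qed
    have pCF: "measure bern (C \<inter> F) = p"
    proof -
      have "AE w in bern. w \<in> F"
        using bern_full unfolding F_def by (intro bern.AE_prob_1) simp
      then have "measure bern (C \<inter> F) = measure bern C"
        using C CF by (intro bern.finite_measure_eq_AE) auto
      then show ?thesis by (simp add: p_def)
    qed
    have shift_sets: "shift_iter ?c -` X \<in> sets bern" if "X \<in> sets bern" for X
      using measurable_sets[OF shift_iter_measurable that, of ?c] by simp
    have A_un: "A = (\<Union>u\<in>W. {w. window_word k w = u})" by (auto simp: A_def)
    have mA: "measure bern A = (\<Sum>u\<in>W. measure bern {w. window_word k w = u})"
      unfolding A_un using finW window_word_sets
      by (intro bern.finite_measure_finite_Union) (auto simp: disjoint_family_on_def)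
    have "measure bern (A \<inter> shift_iter ?c -` A) =
      (\<Sum>u\<in>W. measure bern ({w. window_word k w = u} \<inter> shift_iter ?c -` A))"
    proof -
      have "A \<inter> shift_iter ?c -` A = (\<Union>u\<in>W. {w. window_word k w = u} \<inter> shift_iter ?c -` A)"
        by (subst A_un) blast
      then show ?thesis
        using finW window_word_sets shift_sets[OF A_sets]
        by (simp only:) (intro bern.finite_measure_finite_Union, auto simp: disjoint_family_on_def)
    qed
    also have "\<dots> = (\<Sum>u\<in>W. \<Sum>v\<in>W. measure bern ({w. window_word k w = u} \<inter> {w. window_word k (shift_iter ?c w) = v}))"
    proof (intro sum.cong refl)
      fix u
      have "{w. window_word k w = u} \<inter> shift_iter ?c -` A =
          (\<Union>v\<in>W. {w. window_word k w = u} \<inter> {w. window_word k (shift_iter ?c w) = v})"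
        by (subst A_un) blast
      moreover have "{w. window_word k (shift_iter ?c w) = v} \<in> sets bern" for v
        using shift_sets[OF window_word_sets[of k v]] by (simp add: vimage_def)
      ultimately show "measure bern ({w. window_word k w = u} \<inter> shift_iter ?c -` A) =
        (\<Sum>v\<in>W. measure bern ({w. window_word k w = u} \<inter> {w. window_word k (shift_iter ?c w) = v}))"
        using finW window_word_sets
        by (simp only:) (intro bern.finite_measure_finite_Union, auto simp: disjoint_family_on_def)
    qed
    also have "\<dots> = measure bern A * measure bern A"
      unfolding independent_windows mA by (simp add: sum_product)
    finally have AA: "measure bern (A \<inter> shift_iter ?c -` A) = measure bern A * measure bern A" .
    let ?E = "(C \<inter> F - A) \<union> (A - C \<inter> F)"
    have E_sets: "?E \<in> sets bern" using CF A_sets by auto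
    have invF: "shift_iter ?c w \<in> C \<inter> F \<longleftrightarrow> w \<in> C \<inter> F" for w
    proof -
      have "(\<forall>i. w (i + ?c) \<in> {0,1,2}) \<longleftrightarrow> (\<forall>i. w i \<in> {0,1,2})"
        by (metis diff_add_cancel)
      then have "shift_iter ?c w \<in> F \<longleftrightarrow> w \<in> F" unfolding F_def mem_Collect_eq shift_iter_def .
      then show ?thesis using inv[of ?c w] by blast
    qed
    \<comment> \<open>The set differs from A and from its shifted copy by less than e each, which
      gives 2 e; replacing the measure of A by p in its square costs another 2 e, as both are at
      most 1.\<close>
    have "\<bar>measure bern (C \<inter> F) - measure bern (A \<inter> shift_iter ?c -` A)\<bar> \<le>
        measure bern ((C \<inter> F - A \<inter> shift_iter ?c -` A) \<union> (A \<inter> shift_iter ?c -` A - C \<inter> F))"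
      using CF A_sets shift_sets[OF A_sets] by (intro mono) auto
    also have "\<dots> \<le> measure bern (?E \<union> shift_iter ?c -` ?E)"
      using E_sets shift_sets[OF E_sets] invF by (intro bern.finite_measure_mono) auto
    also have "\<dots> \<le> measure bern ?E + measure bern (shift_iter ?c -` ?E)"
      using E_sets shift_sets[OF E_sets] by (intro measure_Un_le) auto
    also have "\<dots> \<le> 2 * e" using d measure_shift_vimage[OF E_sets, of ?c] by simp
    finally have 1: "\<bar>p - measure bern A * measure bern A\<bar> \<le> 2 * e" unfolding pCF AA .
    have 2: "\<bar>p - measure bern A\<bar> < e" using mono[OF CF A_sets] d unfolding pCF by linarith
    have "\<bar>measure bern A * measure bern A - p * p\<bar> = \<bar>measure bern A - p\<bar> * \<bar>measure bern A + p\<bar>"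
      by (simp add: abs_mult[symmetric] algebra_simps)
    also have "\<dots> \<le> e * 2"
    proof (rule mult_mono)
      show "\<bar>measure bern A - p\<bar> \<le> e" using 2 by linarith
      show "\<bar>measure bern A + p\<bar> \<le> 2"
        using bern.prob_le_1[of A] bern.prob_le_1[of C] measure_nonneg[of bern A] measure_nonneg[of bern C]
        unfolding p_def by linarith
    qed (use e in auto)
    finally show ?thesis using 1 by linarith
  qed
  have "\<bar>p - p * p\<bar> \<le> 0"
  proof (rule field_le_epsilon)
    fix e :: real assume "0 < e"
    then show "\<bar>p - p * p\<bar> \<le> 0 + e" using bound[of "e / 4"] by simp
  qed
  then have "p * (1 - p) = 0" by (simp add: algebra_simps)
  then show ?thesis unfolding p_def by auto
qed

subsection \<open>Measures of maximal entropy\<close>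

text \<open>Rotations of the circle preserve Lebesgue measure: the part of the translated interval
  beyond 1 is moved back by periodicity.\<close>

lemma nn_integral_periodic:
  fixes h :: "real \<Rightarrow> ennreal"
  assumes [measurable]: "h \<in> borel_measurable borel" and per: "\<And>s. h (s + 1) = h s"
    and c: "0 \<le> c" "c < 1"
  shows "(\<integral>\<^sup>+s. h (s + c) * indicator {0..<1} s \<partial>lborel) = (\<integral>\<^sup>+s. h s * indicator {0..<1} s \<partial>lborel)"
proof -
  have "(\<integral>\<^sup>+s. h s * indicator {c..<1 + c} s \<partial>lborel)
      = (\<integral>\<^sup>+s. h (c + 1 * s) * indicator {c..<1 + c} (c + 1 * s) \<partial>lborel)"
    by (subst nn_integral_real_affine[where c = 1 and t = c]) auto
  also have "\<dots> = (\<integral>\<^sup>+s. h (s + c) * indicator {0..<1} s \<partial>lborel)"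
    by (intro nn_integral_cong) (auto simp: indicator_def add.commute)
  finally have 1: "(\<integral>\<^sup>+s. h (s + c) * indicator {0..<1} s \<partial>lborel)
      = (\<integral>\<^sup>+s. h s * indicator {c..<1 + c} s \<partial>lborel)" ..
  have "(\<integral>\<^sup>+s. h s * indicator {1..<1 + c} s \<partial>lborel)
      = (\<integral>\<^sup>+s. h (1 + 1 * s) * indicator {1..<1 + c} (1 + 1 * s) \<partial>lborel)"
    by (subst nn_integral_real_affine[where c = 1 and t = 1]) auto
  also have "\<dots> = (\<integral>\<^sup>+s. h s * indicator {0..<c} s \<partial>lborel)"
    using per by (intro nn_integral_cong) (auto simp: indicator_def add.commute)
  finally have 2: "(\<integral>\<^sup>+s. h s * indicator {1..<1 + c} s \<partial>lborel)
      = (\<integral>\<^sup>+s. h s * indicator {0..<c} s \<partial>lborel)" .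
  have "(\<integral>\<^sup>+s. h s * indicator {c..<1 + c} s \<partial>lborel)
      = (\<integral>\<^sup>+s. h s * indicator {c..<1} s + h s * indicator {1..<1 + c} s \<partial>lborel)"
    using c by (intro nn_integral_cong) (auto simp: indicator_def)
  also have "\<dots> = (\<integral>\<^sup>+s. h s * indicator {c..<1} s \<partial>lborel) + (\<integral>\<^sup>+s. h s * indicator {0..<c} s \<partial>lborel)"
    by (subst nn_integral_add) (auto simp: 2)
  also have "\<dots> = (\<integral>\<^sup>+s. h s * indicator {c..<1} s + h s * indicator {0..<c} s \<partial>lborel)"
    by (subst nn_integral_add) auto
  also have "\<dots> = (\<integral>\<^sup>+s. h s * indicator {0..<1} s \<partial>lborel)"
    using c by (intro nn_integral_cong) (auto simp: indicator_def)
  finally show ?thesis using 1 by simp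
qed

lemma dyck_alph: "x \<in> dyck \<Longrightarrow> x i \<in> alph"
  unfolding dyck_def alph_def by blast

lemma dyck_shift: "shift_iter n x \<in> dyck \<longleftrightarrow> x \<in> dyck"
proof -
  have *: "shift_iter n x \<in> dyck" if "x \<in> dyck" for n x
  proof -
    have "shift_iter n x i \<in> {0,1,2,3}" for i
      unfolding shift_iter_def using that unfolding dyck_def by blast
    moreover have "shift_iter n x q = shift_iter n x p + 2" if "matched (shift_iter n x) p q" for p q
    proof -
      have "matched x (p + n) (q + n)" using that unfolding matched_shift .
      then have "x (q + n) = x (p + n) + 2" using \<open>x \<in> dyck\<close> unfolding dyck_def by blast
      then show ?thesis by (simp add: shift_iter_def)
    qed
    ultimately show ?thesis unfolding dyck_def by blast
  qed
  have "shift_iter (- n) (shift_iter n x) = x" by (simp add: shift_iter_def)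
  with *[of "shift_iter n x" "- n"] *[of x n] show ?thesis by metis
qed

lemma roof_dyck: "x \<in> dyck \<Longrightarrow> roof x = 1"
  by (simp add: roof_def excess_dyck)

lemma birkhoff_dyck:
  assumes "x \<in> dyck" shows "birkhoff_sum roof n x = n"
proof -
  have *: "birkhoff_sum roof (i + 1) x = birkhoff_sum roof i x + 1" for i
    using roof_dyck[of "shift_iter i x"] dyck_shift[of i x] assms by (simp add: birkhoff_sum_add_one)
  show ?thesis
  proof (induction n rule: int_induct[of _ 0])
    case (step2 i)
    then show ?case using *[of "i - 1"] by simp
  qed (simp_all add: *)
qed

definition unit_interval :: "real measure" where
  "unit_interval = uniform_measure lborel {0..<1}"

interpretation unit_interval: prob_space unit_interval
  unfolding unit_interval_def by (rule prob_space_uniform_measure) auto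

lemma sets_unit_interval [measurable_cong]: "sets unit_interval = sets borel"
  by (simp add: unit_interval_def)

section \<open>The invariant measure carried by a coding\<close>

text \<open>What the two codings share. Reading the letter back from a single coordinate by
  \<open>dc\<close> yields entropy ln 3; \<open>k_dense\<close>, by which every window of a Dyck
  point is forced by a three-letter cylinder, yields full support over the Dyck shift.\<close>

locale dyck_coding =
  fixes k :: "(int \<Rightarrow> nat) \<Rightarrow> int \<Rightarrow> nat" and dc :: "nat \<Rightarrow> nat"
  assumes k_measurable: "k \<in> borel \<rightarrow>\<^sub>M borel"
    and k_dyck: "k w \<in> dyck"
    and k_shift: "k (shift_iter n w) = shift_iter n (k w)"
    and dc_k: "dc (k w j) = min 2 (w j)"
    and dc_le: "dc v \<le> 2"
    and k_dense: "x \<in> dyck \<Longrightarrow> \<exists>w0 m. (\<forall>i. w0 i \<in> {0,1,2}) \<and>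
      (\<forall>w. (\<forall>i. - int m \<le> i \<and> i \<le> int m \<longrightarrow> w i = w0 i) \<longrightarrow>
        (\<forall>j. - int r \<le> j \<and> j \<le> int r \<longrightarrow> k w j = x j))"
begin

text \<open>Over the Dyck shift the roof is 1, so the height is a point of the circle. With
  \<open>frac\<close> the map is defined and periodic for all real s, and the flow translates s and
  shifts w.\<close>

definition \<Psi> :: "real \<times> (int \<Rightarrow> nat) \<Rightarrow> ((int \<Rightarrow> nat) \<times> real) set" where
  "\<Psi> = (\<lambda>(s, w). dyck.cls (k w, frac s))"

definition mme :: "((int \<Rightarrow> nat) \<times> real) set measure" where
  "mme = distr (unit_interval \<Otimes>\<^sub>M bern) (borel_of dyck.T) \<Psi>"

lemma in_D: "(k w, frac s) \<in> dyck.D"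
  using dyck_alph[OF k_dyck[of w]] frac_lt_1[of s] by (simp add: dyck.D_def roof_dyck[OF k_dyck])

lemma \<Psi>_measurable: "\<Psi> \<in> unit_interval \<Otimes>\<^sub>M bern \<rightarrow>\<^sub>M borel_of dyck.T"
proof -
  have k: "k \<in> bern \<rightarrow>\<^sub>M borel"
    using k_measurable measurable_cong_sets[OF sets_bern refl] by blast
  have "(\<lambda>p. (k (snd p), frac (fst p))) \<in> unit_interval \<Otimes>\<^sub>M bern \<rightarrow>\<^sub>M (borel :: (int \<Rightarrow> nat) measure) \<Otimes>\<^sub>M (borel :: real measure)"
  proof (rule measurable_Pair)
    show "(\<lambda>p. k (snd p)) \<in> unit_interval \<Otimes>\<^sub>M bern \<rightarrow>\<^sub>M borel"
      by (rule measurable_compose[OF measurable_snd k])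
    show "(\<lambda>p. frac (fst p)) \<in> unit_interval \<Otimes>\<^sub>M bern \<rightarrow>\<^sub>M borel"
      unfolding frac_def by measurable
  qed
  then have "(\<lambda>p. (k (snd p), frac (fst p))) \<in> unit_interval \<Otimes>\<^sub>M bern \<rightarrow>\<^sub>M restrict_space borel dyck.D"
    unfolding borel_prod by (intro measurable_restrict_space2) (auto simp: in_D)
  from measurable_compose[OF this dyck.cls_measurable]
  show ?thesis by (simp add: \<Psi>_def case_prod_beta')
qed

lemma sets_mme: "sets mme = sets (borel_of dyck.T)" and space_mme: "space mme = topspace dyck.T"
  by (simp_all add: mme_def space_borel_of)

lemma \<Psi>_space: "\<Psi> p \<in> topspace dyck.T"
  by (cases p) (simp add: \<Psi>_def dyck.cls_in in_D)

lemma emeasure_mme: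
  assumes B: "B \<in> sets (borel_of dyck.T)"
  shows "emeasure mme B = (\<integral>\<^sup>+s. emeasure bern {w. \<Psi> (s, w) \<in> B} * indicator {0..<1} s \<partial>lborel)"
    and "(\<lambda>s. emeasure bern {w. \<Psi> (s, w) \<in> B}) \<in> borel_measurable borel"
    and "{w. \<Psi> (s, w) \<in> B} \<in> sets bern"
proof -
  define Q where "Q = \<Psi> -` B \<inter> space (unit_interval \<Otimes>\<^sub>M bern)"
  have Q: "Q \<in> sets (unit_interval \<Otimes>\<^sub>M bern)"
    unfolding Q_def by (rule measurable_sets[OF \<Psi>_measurable B])
  have sp: "space (unit_interval \<Otimes>\<^sub>M bern) = UNIV"
    by (simp add: space_pair_measure unit_interval_def)
  have sec: "Pair s -` Q = {w. \<Psi> (s, w) \<in> B}" for s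
    by (auto simp: Q_def sp)
  show "{w. \<Psi> (s, w) \<in> B} \<in> sets bern" using sets_Pair1[OF Q, of s] unfolding sec .
  have "(\<lambda>s. emeasure bern (Pair s -` Q)) \<in> borel_measurable unit_interval"
    by (rule bern.measurable_emeasure_Pair[OF Q])
  then show m: "(\<lambda>s. emeasure bern {w. \<Psi> (s, w) \<in> B}) \<in> borel_measurable borel"
    unfolding sec using measurable_cong_sets[OF sets_unit_interval refl] by blast
  have "emeasure mme B = emeasure (unit_interval \<Otimes>\<^sub>M bern) Q"
    unfolding mme_def Q_def by (rule emeasure_distr[OF \<Psi>_measurable B])
  also have "\<dots> = (\<integral>\<^sup>+s. emeasure bern {w. \<Psi> (s, w) \<in> B} \<partial>unit_interval)"
    by (simp only: bern.emeasure_pair_measure_alt[OF Q] sec)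
  also have "\<dots> = (\<integral>\<^sup>+s. emeasure bern {w. \<Psi> (s, w) \<in> B} * indicator {0..<1} s \<partial>lborel)"
    unfolding unit_interval_def using m
    by (subst nn_integral_uniform_measure) (auto simp: ennreal_mult_divide_eq[where b = 1, simplified])
  finally show "emeasure mme B = (\<integral>\<^sup>+s. emeasure bern {w. \<Psi> (s, w) \<in> B} * indicator {0..<1} s \<partial>lborel)" .
qed

lemma measure_mme_base:
  assumes B: "B \<in> sets (borel_of dyck.T)" and C: "\<And>s w. 0 \<le> s \<Longrightarrow> s < 1 \<Longrightarrow> \<Psi> (s, w) \<in> B \<longleftrightarrow> w \<in> C"
  shows "measure mme B = measure bern C"
proof -
  have "emeasure mme B = (\<integral>\<^sup>+s. emeasure bern C * indicator {0..<1::real} s \<partial>lborel)"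
    unfolding emeasure_mme(1)[OF B] by (intro nn_integral_cong) (auto simp: indicator_def C)
  also have "\<dots> = emeasure bern C" by (subst nn_integral_cmult_indicator) auto
  finally show ?thesis by (simp add: measure_def)
qed

lemma prob_space_mme: "prob_space mme"
proof -
  interpret pair_prob_space unit_interval bern ..
  show ?thesis unfolding mme_def by (rule prob_space_distr[OF \<Psi>_measurable])
qed

lemma flow_\<Psi>: "dyck.\<phi> t (\<Psi> (s, w)) = \<Psi> (s + t, shift_iter \<lfloor>frac s + t\<rfloor> w)"
proof -
  let ?n = "\<lfloor>frac s + t\<rfloor>"
  have "dyck.\<phi> t (dyck.cls (k w, frac s)) = dyck.cls (shift_iter ?n (k w), t + frac s - birkhoff_sum roof ?n (k w))"
    by (rule dyck.flow_cls(1)[OF in_D]) (simp_all add: birkhoff_dyck[OF k_dyck], linarith+)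
  moreover have "t + frac s - of_int ?n = frac (s + t)"
  proof -
    have "frac s + t = (s + t) - of_int \<lfloor>s\<rfloor>" by (simp add: frac_def)
    then have "?n = \<lfloor>s + t\<rfloor> - \<lfloor>s\<rfloor>" by (simp only: floor_diff_of_int)
    then show ?thesis by (simp add: frac_def)
  qed
  moreover have "k (shift_iter ?n w) = shift_iter ?n (k w)" by (rule k_shift)
  ultimately show ?thesis
    unfolding \<Psi>_def case_prod_conv by (simp only: birkhoff_dyck[OF k_dyck])
qed

lemma \<Psi>_periodic: "\<Psi> (s + of_int z, w) = \<Psi> (s, w)"
  by (simp add: \<Psi>_def frac_def)

text \<open>The amount of the shift in \<open>flow_\<Psi>\<close> depends on s only, so at fixed s
  it is invisible to \<open>bern\<close>; what remains is a translation of a periodic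
  variable.\<close>

lemma mme_invariant: "flow_invariant_measure dyck.T dyck.\<phi> mme"
  unfolding flow_invariant_measure_def measure_preserving_map_def
proof (intro conjI allI prob_space_mme space_mme sets_mme)
  fix t
  show meas: "dyck.\<phi> t \<in> mme \<rightarrow>\<^sub>M mme"
    using dyck.flow_measurable[of t] measurable_cong_sets[OF sets_mme sets_mme] by blast
  show "distr mme mme (dyck.\<phi> t) = mme"
  proof (rule measure_eqI)
    fix B assume "B \<in> sets (distr mme mme (dyck.\<phi> t))"
    then have B: "B \<in> sets (borel_of dyck.T)" "B \<in> sets mme" by (simp_all add: sets_mme)
    let ?h = "\<lambda>s. emeasure bern {w. \<Psi> (s, w) \<in> B}"
    let ?B' = "dyck.\<phi> t -` B \<inter> space mme"
    have B': "?B' \<in> sets (borel_of dyck.T)"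
      using measurable_sets[OF meas B(2)] by (simp add: sets_mme)
    have per: "?h (s + of_int z) = ?h s" for s z by (simp only: \<Psi>_periodic)
    have "emeasure bern {w. \<Psi> (s, w) \<in> ?B'} = ?h (s + t)" for s
    proof -
      have "{w. \<Psi> (s, w) \<in> ?B'} = shift_iter \<lfloor>frac s + t\<rfloor> -` {w. \<Psi> (s + t, w) \<in> B} \<inter> space bern"
        by (auto simp: flow_\<Psi> space_mme \<Psi>_space)
      then have "emeasure bern {w. \<Psi> (s, w) \<in> ?B'} =
          emeasure (distr bern bern (shift_iter \<lfloor>frac s + t\<rfloor>)) {w. \<Psi> (s + t, w) \<in> B}"
        using emeasure_mme(3)[OF B(1)] by (simp only: emeasure_distr[OF shift_iter_measurable])
      then show ?thesis by (simp only: distr_shift)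
    qed
    then have "emeasure (distr mme mme (dyck.\<phi> t)) B = (\<integral>\<^sup>+s. ?h (s + t) * indicator {0..<1} s \<partial>lborel)"
      by (simp only: emeasure_distr[OF meas B(2)] emeasure_mme(1)[OF B'])
    also have "\<dots> = (\<integral>\<^sup>+s. ?h (s + frac t) * indicator {0..<1} s \<partial>lborel)"
    proof -
      have "?h (s + t) = ?h (s + frac t)" for s
        using per[of "s + frac t" "\<lfloor>t\<rfloor>"] by (simp add: frac_def)
      then show ?thesis by simp
    qed
    also have "\<dots> = emeasure mme B"
      unfolding emeasure_mme(1)[OF B(1)]
      using per[of _ 1] by (intro nn_integral_periodic emeasure_mme(2)[OF B(1)] frac_ge_0 frac_lt_1) simp
    finally show "emeasure (distr mme mme (dyck.\<phi> t)) B = emeasure mme B" .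
  qed simp
qed

definition rectangle :: "nat \<Rightarrow> ((int \<Rightarrow> nat) \<times> real) set set" where
  "rectangle a = dyck.cls ` ({p. dc (fst p 0) = a} \<inter> dyck.D)"

lemma rectangle_sets: "rectangle a \<in> sets (borel_of dyck.T)"
proof -
  have "open {p :: (int \<Rightarrow> nat) \<times> real. dc (fst p 0) = a}"
    using open_vimage_fst[OF open_coord[of 0 "{v. dc v = a}"]] by (simp add: vimage_def)
  then show ?thesis unfolding rectangle_def by (intro dyck.cls_image_sets borel_open)
qed

lemma cls_rectangle: "p \<in> dyck.D \<Longrightarrow> dyck.cls p \<in> rectangle a \<longleftrightarrow> dc (fst p 0) = a"
  unfolding rectangle_def using dyck.cls_inj by blast

lemma \<Psi>_rectangle: "\<Psi> (s, w) \<in> rectangle a \<longleftrightarrow> min 2 (w 0) = a"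
  using cls_rectangle[OF in_D] dc_k by (simp add: \<Psi>_def)

lemma card_letters: "a \<le> 2 \<Longrightarrow> card ({0,1,2::nat} \<inter> {v. min 2 v = a}) = 1"
proof -
  assume "a \<le> 2"
  then have "{0,1,2::nat} \<inter> {v. min 2 v = a} = {a}" by (auto simp: min_def)
  then show ?thesis by simp
qed

lemma measure_rectangle: "a \<le> 2 \<Longrightarrow> measure mme (rectangle a) = 1 / 3"
proof -
  assume a: "a \<le> 2"
  have "measure mme (rectangle a) = measure bern {w. \<forall>i\<in>{0}. w i \<in> {v. min 2 v = a}}"
    by (rule measure_mme_base[OF rectangle_sets]) (simp add: \<Psi>_rectangle)
  also have "\<dots> = 1 / 3" by (subst measure_cylinder) (simp_all only: card_letters[OF a] finite.intros, simp)
  finally show ?thesis .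
qed

lemma flow_1_\<Psi>: "(dyck.\<phi> 1 ^^ j) (\<Psi> (s, w)) = \<Psi> (s, shift_iter (int j) w)"
proof (induction j)
  case (Suc j)
  have "\<lfloor>frac s + 1\<rfloor> = 1" using frac_ge_0[of s] frac_lt_1[of s] by linarith
  then have "dyck.\<phi> 1 (\<Psi> (s, shift_iter (int j) w)) = \<Psi> (s + 1, shift_iter (int (Suc j)) w)"
    by (simp add: flow_\<Psi> shift_iter_add[symmetric])
  then show ?case using Suc \<Psi>_periodic[of s 1] by simp
qed (simp add: shift_iter_0)

text \<open>A single partition suffices for a lower bound. The time-one map keeps s and shifts by
  one place, so names under the three rectangles are cylinders of n independent uniform letters, of
  mass 3^(-n).\<close>

lemma mme_entropy_ge: "ereal (ln 3) \<le> flow_entropy dyck.\<phi> mme"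
proof -
  define P where "P = rectangle ` {..2}"
  \<comment> \<open>The coding of the constant sequence shows that no rectangle is empty.\<close>
  have ex: "\<exists>p\<in>dyck.D. dc (fst p 0) = a" if "a \<le> 2" for a
    using that dc_k[of "\<lambda>_. a" 0] in_D[of "\<lambda>_. a" 0] by (intro bexI[OF _ in_D[of "\<lambda>_. a" 0]]) simp
  have P: "finite P" "P \<subseteq> sets mme" "partition_on (space mme) P"
  proof -
    show "finite P" "P \<subseteq> sets mme" using rectangle_sets by (auto simp: P_def sets_mme)
    show "partition_on (space mme) P"
    proof (rule partition_onI)
      show "\<Union> P = space mme"
        unfolding space_mme dyck.topspace_T P_def rectangle_def using dc_le by blast
      show "disjnt p q" if pq: "p \<in> P" "q \<in> P" "p \<noteq> q" for p q
      proof -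
        obtain a b where ab: "p = rectangle a" "q = rectangle b" using pq unfolding P_def by blast
        have "a \<noteq> b" using ab pq(3) by blast
        show ?thesis
          unfolding disjnt_iff
        proof (intro allI notI)
          fix y assume y: "y \<in> p \<and> y \<in> q"
          then obtain r where "r \<in> dyck.D" "y = dyck.cls r" unfolding ab rectangle_def by blast
          with y cls_rectangle[of r] \<open>a \<noteq> b\<close> show False unfolding ab by simp
        qed
      qed
      show "{} \<notin> P" using ex unfolding P_def rectangle_def by blast
    qed
  qed
  interpret prob_space mme by (rule prob_space_mme)
  interpret partitioned_system mme "dyck.\<phi> 1" P
    by unfold_locales (use mme_invariant P in \<open>auto simp: flow_invariant_measure_def\<close>)
  have "entropy_wrt_partition mme (dyck.\<phi> 1) P = ln 3"
  proof (rule entropy_eq_uniform)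
    fix n y assume y: "y \<in> space mme"
    have v: "name n y \<in> {..<n} \<rightarrow>\<^sub>E P" by (rule name_in[OF y])
    have "\<forall>j\<in>{..<n}. \<exists>a\<le>2. name n y j = rectangle a" using v unfolding P_def by blast
    then obtain a where a: "\<And>j. j < n \<Longrightarrow> a j \<le> 2 \<and> name n y j = rectangle (a j)" by (metis lessThan_iff)
    let ?B = "name n -` {name n y} \<inter> space mme"
    have "?B \<in> sets mme" by (rule measurable_sets[OF name_measurable]) simp
    then have B: "?B \<in> sets (borel_of dyck.T)" by (simp add: sets_mme)
    let ?J = "int ` {..<n}" and ?V = "\<lambda>i. {v. min 2 v = a (nat i)}"
    have "\<Psi> (s, w) \<in> ?B \<longleftrightarrow> w \<in> {w. \<forall>i\<in>?J. w i \<in> ?V i}" for s w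
    proof -
      have sp: "\<Psi> (s, w) \<in> space mme" using \<Psi>_space space_mme by simp
      have "\<Psi> (s, w) \<in> ?B \<longleftrightarrow> (\<forall>j<n. (dyck.\<phi> 1 ^^ j) (\<Psi> (s, w)) \<in> name n y j)"
        using name_eq_iff[OF sp v] sp by simp
      also have "\<dots> \<longleftrightarrow> (\<forall>j<n. min 2 (w (int j)) = a j)"
        using a by (simp add: flow_1_\<Psi> \<Psi>_rectangle shift_iter_def)
      finally show ?thesis by auto
    qed
    then have "measure mme ?B = measure bern {w. \<forall>i\<in>?J. w i \<in> ?V i}"
      by (intro measure_mme_base[OF B])
    also have "\<dots> = (\<Prod>i\<in>?J. card ({0,1,2} \<inter> ?V i) / 3)" by (rule measure_cylinder) simp
    also have "\<dots> = (\<Prod>i\<in>?J. 1 / 3)"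
      using a by (intro prod.cong refl) (auto simp: card_letters[unfolded One_nat_def])
    also have "\<dots> = exp (- (n * ln 3))"
      by (simp add: card_image power_one_over exp_minus exp_of_nat_mult field_simps)
    finally show "fibre_prob mme (name n) (name n y) \<in> {0, exp (- (n * ln 3))}"
      by (simp add: fibre_prob_def)
  qed
  then show ?thesis
    unfolding flow_entropy_def ks_entropy_def using P by (intro SUP_upper2[of P]) auto
qed

lemma mme_maximal: "measure_of_maximal_entropy dyck.T dyck.\<phi> mme"
proof -
  have "(SUP N \<in> {N. flow_invariant_measure dyck.T dyck.\<phi> N}. flow_entropy dyck.\<phi> N) = flow_entropy dyck.\<phi> mme"
  proof (rule antisym)
    show "(SUP N \<in> {N. flow_invariant_measure dyck.T dyck.\<phi> N}. flow_entropy dyck.\<phi> N) \<le> flow_entropy dyck.\<phi> mme"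
      using entropy_upper_bound mme_entropy_ge by (intro SUP_least) (auto intro: order_trans)
  qed (use mme_invariant in \<open>intro SUP_upper, simp\<close>)
  then show ?thesis unfolding measure_of_maximal_entropy_def using mme_invariant by simp
qed

text \<open>The flow carries the section s = 0 to every height below 1, so an invariant set is
  determined by that section, and integer times make the section shift-invariant.\<close>

lemma mme_ergodic: "flow_ergodic dyck.\<phi> mme"
  unfolding flow_ergodic_def
proof (intro ballI impI)
  fix B assume B: "B \<in> sets mme" and "\<forall>t. dyck.\<phi> t -` B \<inter> space mme = B"
  then have inv: "dyck.\<phi> t (\<Psi> p) \<in> B \<longleftrightarrow> \<Psi> p \<in> B" for t p
    using \<Psi>_space[of p] unfolding space_mme by blast
  define C where "C = {w. \<Psi> (0, w) \<in> B}"
  have C: "C \<in> sets bern"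
    unfolding C_def by (rule emeasure_mme(3)) (use B sets_mme in simp)
  have base: "\<Psi> (s, w) \<in> B \<longleftrightarrow> w \<in> C" if "0 \<le> s" "s < 1" for s w
  proof -
    have "\<lfloor>frac 0 + s\<rfloor> = 0" using that by (simp add: floor_eq_iff)
    then show ?thesis using inv[of s "(0, w)"] by (simp add: flow_\<Psi> shift_iter_0 C_def)
  qed
  have "shift_iter n w \<in> C \<longleftrightarrow> w \<in> C" for n w
    using inv[of "of_int n" "(0, w)"] \<Psi>_periodic[of 0 n] by (simp add: flow_\<Psi> C_def)
  then have "measure bern C = 0 \<or> measure bern C = 1" by (rule bern_zero_one[OF C])
  moreover have "measure mme B = measure bern C"
    by (rule measure_mme_base[OF _ base]) (use B sets_mme in simp_all)
  ultimately show "measure mme B = 0 \<or> measure mme B = 1" by simp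
qed

text \<open>The right-hand side does not mention the coding, so both measures get the same support.
  An illegal pair is visible in a finite window, so the complement is open and null; conversely
  \<open>k_dense\<close> puts mass near every point over the Dyck shift.\<close>

lemma mme_support: "measure_support dyck.T mme = dyck.cls ` {p \<in> dyck.D. fst p \<in> dyck}"
proof (intro equalityI subsetI)
  fix y assume y: "y \<in> measure_support dyck.T mme"
  then obtain x s where xs: "(x, s) \<in> dyck.D" "y = dyck.cls (x, s)"
    by (auto simp: measure_support_def dyck.topspace_T)
  show "y \<in> dyck.cls ` {p \<in> dyck.D. fst p \<in> dyck}"
  proof (rule ccontr)
    assume "y \<notin> dyck.cls ` {p \<in> dyck.D. fst p \<in> dyck}"
    then have x: "x \<notin> dyck" using xs by auto
    define U where "U = dyck.cls ` {p \<in> dyck.D. fst p \<notin> dyck}"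
    define W where "W = (\<Union>p q. {x. matched x p q \<and> x q \<noteq> x p + 2})"
    have W: "x \<in> W \<longleftrightarrow> x \<notin> dyck" if "\<And>i. x i \<in> alph" for x
      using that unfolding W_def dyck_def alph_def by blast
    have "openin dyck.T U"
      unfolding dyck.openin_T
    proof (intro conjI exI)
      show "U \<subseteq> dyck.cls ` dyck.D" unfolding U_def by blast
      show "open (W \<times> (UNIV :: real set))"
        unfolding W_def by (intro open_Times open_UN ballI open_matched open_UNIV)
      show "{p \<in> roof_region alph roof. dyck.cls p \<in> U} = roof_region alph roof \<inter> (W \<times> UNIV)"
      proof (intro set_eqI)
        fix p :: "(int \<Rightarrow> nat) \<times> real"
        obtain z r where p: "p = (z, r)" by force
        show "p \<in> {p \<in> roof_region alph roof. dyck.cls p \<in> U} \<longleftrightarrow> p \<in> roof_region alph roof \<inter> (W \<times> UNIV)"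
        proof (cases "p \<in> roof_region alph roof")
          case True
          then have z: "\<And>i. z i \<in> alph" and r: "0 \<le> r" "r \<le> roof z" unfolding p dyck.R_def' by auto
          have U: "dyck.cls q \<in> U \<longleftrightarrow> fst q \<notin> dyck" if "q \<in> dyck.D" for q
            unfolding U_def using that dyck.cls_inj by blast
          have "dyck.cls p \<in> U \<longleftrightarrow> z \<notin> dyck"
          \<comment> \<open>A roof point is glued to the base point of the shifted sequence, which
            is in the Dyck shift exactly when \<open>z\<close> is.\<close>
          proof (cases "r = roof z")
            case True
            have "(left_shift z, 0) \<in> dyck.D"
              using z dyck.pos[of "left_shift z"] by (simp add: dyck.D_def left_shift_def)
            from U[OF this] show ?thesis
              using dyck.cls_top[of z] z True p dyck_shift[of 1 z] by (simp add: shift_iter_1)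
          next
            case False
            then have "p \<in> dyck.D" using z r p by (simp add: dyck.D_def)
            from U[OF this] show ?thesis using p by simp
          qed
          then show ?thesis using True W[OF z] p by simp
        qed simp
      qed
    qed
    moreover have "y \<in> U" unfolding U_def using xs x by force
    ultimately have "0 < emeasure mme U" using y unfolding measure_support_def by blast
    moreover have "\<Psi> (s, w) \<notin> U" for s w
    proof
      assume "\<Psi> (s, w) \<in> U"
      then obtain q where "q \<in> dyck.D" "fst q \<notin> dyck" "dyck.cls (k w, frac s) = dyck.cls q"
        unfolding U_def \<Psi>_def by auto
      then have "q = (k w, frac s)" using dyck.cls_inj[OF in_D] by metis
      then show False using \<open>fst q \<notin> dyck\<close> k_dyck by simp
    qed
    then have "emeasure mme U = 0"
      unfolding emeasure_mme(1)[OF openin_sets_borel_of[OF \<open>openin dyck.T U\<close>]] by simp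
    ultimately show False by simp
  qed
next
  fix y assume "y \<in> dyck.cls ` {p \<in> dyck.D. fst p \<in> dyck}"
  then obtain x s where xs: "(x, s) \<in> dyck.D" "x \<in> dyck" "y = dyck.cls (x, s)" by force
  have s: "0 \<le> s" "s < 1" using xs(1) roof_dyck[OF xs(2)] by (auto simp: dyck.D_def)
  show "y \<in> measure_support dyck.T mme"
    unfolding measure_support_def
  proof (intro CollectI conjI allI impI)
    show "y \<in> topspace dyck.T" using xs by (simp add: dyck.cls_in)
    fix U assume U: "openin dyck.T U" "y \<in> U"
    obtain W where W: "open W" "{p \<in> dyck.D. dyck.cls p \<in> U} = dyck.D \<inter> W"
      by (rule dyck.open_sub_D[OF U(1)])
    then have "(x, s) \<in> W" using U(2) xs by blast
    then obtain V1 V2 where V: "open V1" "open V2" "(x, s) \<in> V1 \<times> V2" "V1 \<times> V2 \<subseteq> W"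
      using open_prod_elim[OF W(1)] by blast
    obtain n :: nat where n: "\<forall>y. (\<forall>i. - int n \<le> i \<and> i \<le> int n \<longrightarrow> y i = x i) \<longrightarrow> y \<in> V1"
      using open_contains_cylinder[OF V(1), of x] V(3) by blast
    obtain e where e: "0 < e" "\<And>r. \<bar>r - s\<bar> < e \<Longrightarrow> r \<in> V2"
      using V(2,3) unfolding open_dist by (auto simp: dist_real_def)
    obtain w0 m where w0: "\<And>i. w0 i \<in> {0,1,2}" and
      m: "\<And>w j. \<forall>i. - int m \<le> i \<and> i \<le> int m \<longrightarrow> w i = w0 i \<Longrightarrow> - int n \<le> j \<and> j \<le> int n \<Longrightarrow> k w j = x j"
      using k_dense[OF xs(2), of n] by blast
    let ?C = "{w. \<forall>i\<in>{- int m..int m}. w i \<in> {w0 i}}"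
    have "measure bern ?C = (\<Prod>i\<in>{- int m..int m}. card ({0,1,2} \<inter> {w0 i}) / 3)"
      by (rule measure_cylinder) simp
    also have "\<dots> > 0"
    proof (rule prod_pos)
      fix i
      have "{0,1,2} \<inter> {w0 i} = {w0 i}" using w0[of i] by auto
      then show "0 < real (card ({0,1,2} \<inter> {w0 i})) / 3" by simp
    qed
    finally have C: "0 < emeasure bern ?C" by (simp add: bern.emeasure_eq_measure)
    \<comment> \<open>A right neighbourhood of s inside [0, 1), available also for s = 0.\<close>
    define b where "b = min 1 (s + e)"
    have b: "s < b" "b \<le> 1" using s e by (simp_all add: b_def)
    have "emeasure bern ?C * indicator {s..<b} r \<le> emeasure bern {w. \<Psi> (r, w) \<in> U} * indicator {0..<1} r" for r
    proof (cases "r \<in> {s..<b}")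
      case True
      then have r: "0 \<le> r" "r < 1" "r \<in> V2" using s b e(2)[of r] by (auto simp: b_def)
      have "?C \<subseteq> {w. \<Psi> (r, w) \<in> U}"
      proof
        fix w assume "w \<in> ?C"
        then have "k w \<in> V1" using m[of w] by (intro n[rule_format]) auto
        moreover have fr: "frac r = r" using r by (simp add: frac_eq)
        ultimately have "(k w, frac r) \<in> dyck.D \<inter> W"
          using r(3) V(4) in_D[of w r] unfolding fr by blast
        then show "w \<in> {w. \<Psi> (r, w) \<in> U}" unfolding W(2)[symmetric] \<Psi>_def by simp
      qed
      then have "emeasure bern ?C \<le> emeasure bern {w. \<Psi> (r, w) \<in> U}"
        by (rule emeasure_mono) (rule emeasure_mme(3)[OF openin_sets_borel_of[OF U(1)]])
      then show ?thesis using True r by simp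
    qed simp
    then have "(\<integral>\<^sup>+r. emeasure bern ?C * indicator {s..<b} r \<partial>lborel) \<le> emeasure mme U"
      unfolding emeasure_mme(1)[OF openin_sets_borel_of[OF U(1)]] by (rule nn_integral_mono)
    moreover have "(\<integral>\<^sup>+r. emeasure bern ?C * indicator {s..<b} r \<partial>lborel) = emeasure bern ?C * ennreal (b - s)"
      using b by (subst nn_integral_cmult_indicator) auto
    moreover have "0 < emeasure bern ?C * ennreal (b - s)"
      using C b by (simp add: ennreal_zero_less_mult_iff)
    ultimately show "0 < emeasure mme U" by (simp only: less_le_trans)
  qed
qed

end

interpretation closings: dyck_coding closings "min 2"
  by unfold_locales (rule closings_measurable closings_dyck closings_shift min_closings closings_dense | simp)+

interpretation openings: dyck_coding openings close_kind
  by unfold_locales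
    (rule openings_measurable openings_dyck openings_shift close_kind_openings openings_dense
      | simp add: close_kind_def)+

text \<open>Over four letters the two sets \<open>rectangle 2\<close> are complementary: closing
  brackets for one coding, opening brackets for the other. A common measure would give mass 1/3 to
  both.\<close>

lemma mme_distinct: "closings.mme \<noteq> openings.mme"
proof
  assume eq: "closings.mme = openings.mme"
  have "openings.rectangle 2 \<subseteq> topspace dyck.T - closings.rectangle 2"
  proof
    fix y assume "y \<in> openings.rectangle 2"
    then obtain p where p: "p \<in> dyck.D" "y = dyck.cls p" "close_kind (fst p 0) = 2"
      unfolding openings.rectangle_def by blast
    have "fst p 0 \<in> alph" using p(1) by (auto simp: dyck.D_def)
    then have "min 2 (fst p 0) \<noteq> 2" using p(3) by (auto simp: close_kind_def alph_def)
    then show "y \<in> topspace dyck.T - closings.rectangle 2"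
      using p closings.cls_rectangle[OF p(1), of 2] dyck.cls_in by simp
  qed
  moreover have "topspace dyck.T - closings.rectangle 2 \<subseteq> openings.rectangle 2"
  proof
    fix y assume y: "y \<in> topspace dyck.T - closings.rectangle 2"
    then obtain p where p: "p \<in> dyck.D" "y = dyck.cls p" unfolding dyck.topspace_T by blast
    then have "min 2 (fst p 0) \<noteq> 2" using closings.cls_rectangle[OF p(1), of 2] y by simp
    then have "close_kind (fst p 0) = 2" by (simp add: close_kind_def min_def split: if_splits)
    then show "y \<in> openings.rectangle 2" using p openings.cls_rectangle[OF p(1), of 2] by simp
  qed
  ultimately have O: "openings.rectangle 2 = topspace dyck.T - closings.rectangle 2" by blast
  interpret prob_space closings.mme by (rule closings.prob_space_mme)
  have "measure closings.mme (openings.rectangle 2) = 1 - measure closings.mme (closings.rectangle 2)"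
    unfolding O closings.space_mme[symmetric]
    by (rule prob_compl) (simp add: closings.sets_mme closings.rectangle_sets)
  then show False
    using closings.measure_rectangle[of 2] openings.measure_rectangle[of 2] eq by simp
qed

theorem corollary4p2:
  shows "\<exists>(A :: nat set) (\<rho> :: (int \<Rightarrow> nat) \<Rightarrow> real).
           finite A \<and>
           continuous_map (full_shift A) (top_of_set {0<..}) \<rho> \<and>
           (\<exists>M N. M \<noteq> N \<and>
              measure_of_maximal_entropy (suspension A \<rho>) (susp_flow A \<rho>) M \<and>
              measure_of_maximal_entropy (suspension A \<rho>) (susp_flow A \<rho>) N \<and>
              flow_ergodic (susp_flow A \<rho>) M \<and>
              flow_ergodic (susp_flow A \<rho>) N \<and>
              measure_support (suspension A \<rho>) M = measure_support (suspension A \<rho>) N)"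
proof (intro exI conjI)
  show "finite alph" by (simp add: alph_def)
  show "continuous_map (full_shift alph) (top_of_set {0<..}) roof"
    unfolding full_shift_eq using continuous_on_subset[OF dyck.cont subset_UNIV] dyck.pos
    by (auto simp: continuous_map_in_subtopology)
  show "closings.mme \<noteq> openings.mme" by (rule mme_distinct)
  show "measure_support dyck.T closings.mme = measure_support dyck.T openings.mme"
    by (simp only: closings.mme_support openings.mme_support)
qed (rule closings.mme_maximal openings.mme_maximal closings.mme_ergodic openings.mme_ergodic)+

end
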